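(* Assume the OMv conjecture holds. Then for every $\varepsilon>0$ there is no algorithm solving incremental (or decremental) maximum $st$-flow with amortized time $O(n^{1-\varepsilon})$ per operation, where $n$ is the number of nodes. This holds both on unweighted directed graphs and on weighted undirected graphs.
   Context: Incremental (resp. decremental) maximum $st$-flow: maintain a graph with edge capacities and two fixed nodes $s,t$ under edge insertions (resp. deletions), and answer queries asking for the maximum $s$–$t$ flow value. In the unweighted case all capacities are $1$. No preprocessing is allowed. The decremental version starts from a suitable initial graph. Online matrix-vector multiplication (OMv): an $n\times n$ boolean matrix $M$ is given and may be preprocessed; then $n$ boolean vectors $v^1,\dots,v^n$ arrive one at a time, and the Boolean product $Mv^i$ must be output before $v^{i+1}$ is revealed. OMv conjecture: for no $\varepsilon>0$ is there an algorithm solving OMv in total time $O(n^{3-\varepsilon})$. *)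

theory Defs
  imports Complex_Main "HOL-Library.Landau_Symbols"
begin

section \<open>A word RAM\<close>

text \<open>
  Algorithms are programs of a structured word RAM: one memory of cells addressed by natural
  numbers, indirect addressing, arithmetic and bitwise operations at unit cost.  A word is a number
  below the bound \<open>B\<close>; below, \<open>B = (n + 2) ^ c\<close> for a constant \<open>c\<close> of the algorithm, that is, the
  word length is logarithmic in \<open>n\<close>.  A program whose computation leaves the range of words
  (in a value or in an address) has no execution.
\<close>

datatype binop = Plus | Minus | Times | Div | Mod | And | Or | Xor | Shl | Shr | Less | Eq

fun binop_val :: "binop \<Rightarrow> nat \<Rightarrow> nat \<Rightarrow> nat" where
  "binop_val Plus x y = x + y"
| "binop_val Minus x y = x - y"
| "binop_val Times x y = x * y"
| "binop_val Div x y = x div y"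
| "binop_val Mod x y = x mod y"
| "binop_val And x y = and x y"
| "binop_val Or x y = or x y"
| "binop_val Xor x y = xor x y"
| "binop_val Shl x y = push_bit y x"
| "binop_val Shr x y = drop_bit y x"
| "binop_val Less x y = of_bool (x < y)"
| "binop_val Eq x y = of_bool (x = y)"

datatype aexp = Lit nat | Cell aexp | Op binop aexp aexp

type_synonym memory = "nat \<Rightarrow> nat"

fun aval :: "memory \<Rightarrow> aexp \<Rightarrow> nat" where
  "aval m (Lit k) = k"
| "aval m (Cell a) = m (aval m a)"
| "aval m (Op b x y) = binop_val b (aval m x) (aval m y)"

fun acost :: "aexp \<Rightarrow> nat" where
  "acost (Lit k) = 1"
| "acost (Cell a) = 1 + acost a"
| "acost (Op b x y) = 1 + acost x + acost y"

text \<open>All intermediate values, addresses included, are words.\<close>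

fun fits :: "nat \<Rightarrow> memory \<Rightarrow> aexp \<Rightarrow> bool" where
  "fits B m (Lit k) \<longleftrightarrow> k < B"
| "fits B m (Cell a) \<longleftrightarrow> fits B m a \<and> m (aval m a) < B"
| "fits B m (Op b x y) \<longleftrightarrow> fits B m x \<and> fits B m y \<and> binop_val b (aval m x) (aval m y) < B"

datatype com =
    Skip
  | Assign aexp aexp
  | Read aexp
  | Write aexp
  | Seq com com
  | Cond aexp com com
  | While aexp com

text \<open>Memory, unread input, output written so far.\<close>

type_synonym state = "memory \<times> nat list \<times> nat list"

text \<open>
  \<open>exec B p s t s'\<close>: started in \<open>s\<close>, the program \<open>p\<close> terminates in \<open>s'\<close> after time \<open>t\<close>.
  Reading from an exhausted input has no execution.
\<close>

inductive exec :: "nat \<Rightarrow> com \<Rightarrow> state \<Rightarrow> nat \<Rightarrow> state \<Rightarrow> bool" for B :: nat where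
  Skip: "exec B Skip s 1 s"
| Assign: "fits B m a \<Longrightarrow> fits B m e \<Longrightarrow>
    exec B (Assign a e) (m, xs, ys) (1 + acost a + acost e) (m(aval m a := aval m e), xs, ys)"
| Read: "fits B m a \<Longrightarrow> x < B \<Longrightarrow>
    exec B (Read a) (m, x # xs, ys) (1 + acost a) (m(aval m a := x), xs, ys)"
| Write: "fits B m e \<Longrightarrow>
    exec B (Write e) (m, xs, ys) (1 + acost e) (m, xs, ys @ [aval m e])"
| Seq: "exec B p s t s' \<Longrightarrow> exec B q s' t' s'' \<Longrightarrow> exec B (Seq p q) s (t + t') s''"
| CondTrue: "fits B m e \<Longrightarrow> aval m e \<noteq> 0 \<Longrightarrow> exec B p (m, xs, ys) t s' \<Longrightarrow>
    exec B (Cond e p q) (m, xs, ys) (1 + acost e + t) s'"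
| CondFalse: "fits B m e \<Longrightarrow> aval m e = 0 \<Longrightarrow> exec B q (m, xs, ys) t s' \<Longrightarrow>
    exec B (Cond e p q) (m, xs, ys) (1 + acost e + t) s'"
| WhileTrue: "fits B m e \<Longrightarrow> aval m e \<noteq> 0 \<Longrightarrow> exec B p (m, xs, ys) t s' \<Longrightarrow>
    exec B (While e p) s' t' s'' \<Longrightarrow>
    exec B (While e p) (m, xs, ys) (1 + acost e + t + t') s''"
| WhileFalse: "fits B m e \<Longrightarrow> aval m e = 0 \<Longrightarrow>
    exec B (While e p) (m, xs, ys) (1 + acost e) (m, xs, ys)"

text \<open>
  An online algorithm runs its program once per request, and only the memory survives from one
  request to the next.  So the answer to a request is complete before the next request is visible.
  The time of a session is the total over all its requests.
\<close>

inductive session ::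
    "nat \<Rightarrow> com \<Rightarrow> memory \<Rightarrow> nat list list \<Rightarrow> nat list list \<Rightarrow> nat \<Rightarrow> bool" for B :: nat and p :: com where
  Nil: "session B p m [] [] 0"
| Cons: "exec B p (m, xs, []) t (m', xs', ys) \<Longrightarrow> session B p m' xss yss t' \<Longrightarrow>
    session B p m (xs # xss) (ys # yss) (t + t')"

abbreviation initial_memory :: memory where
  "initial_memory \<equiv> \<lambda>_. 0"


section \<open>Online matrix-vector multiplication\<close>

text \<open>
  The first request carries \<open>n\<close> and the matrix, row by row; answering it is the preprocessing, whose
  output is irrelevant and whose time counts.  The next \<open>n\<close> requests are the vectors
  \<open>v 0, \<dots>, v (n - 1)\<close>.
\<close>

definition enc_matrix :: "nat \<Rightarrow> (nat \<Rightarrow> nat \<Rightarrow> bool) \<Rightarrow> nat list" where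
  "enc_matrix n M = n # concat (map (\<lambda>i. map (\<lambda>j. of_bool (M i j)) [0..<n]) [0..<n])"

definition enc_vector :: "nat \<Rightarrow> (nat \<Rightarrow> bool) \<Rightarrow> nat list" where
  "enc_vector n w = map (\<lambda>i. of_bool (w i)) [0..<n]"

definition bool_mult :: "nat \<Rightarrow> (nat \<Rightarrow> nat \<Rightarrow> bool) \<Rightarrow> (nat \<Rightarrow> bool) \<Rightarrow> nat \<Rightarrow> bool" where
  "bool_mult n M w i \<longleftrightarrow> (\<exists>j<n. M i j \<and> w j)"

definition solves_OMv :: "com \<Rightarrow> (nat \<Rightarrow> real) \<Rightarrow> bool" where
  "solves_OMv p T \<longleftrightarrow> (\<exists>c. \<forall>n\<ge>1. \<forall>M v. \<exists>out0 t.
     session ((n + 2) ^ c) p initial_memory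
       (enc_matrix n M # map (\<lambda>k. enc_vector n (v k)) [0..<n])
       (out0 # map (\<lambda>k. enc_vector n (bool_mult n M (v k))) [0..<n]) t \<and>
     real t \<le> T n)"

definition OMv_conjecture :: bool where
  "OMv_conjecture \<longleftrightarrow> (\<forall>\<epsilon>::real. \<epsilon> > 0 \<longrightarrow>
     \<not> (\<exists>p T. solves_OMv p T \<and> T \<in> O(\<lambda>n. real n powr (3 - \<epsilon>))))"


section \<open>Maximum flow\<close>

text \<open>
  A graph on the nodes \<open>{0..<n}\<close> is given by its capacities; capacity \<open>0\<close> means that there is no
  edge.  In an undirected graph the capacities are symmetric.
\<close>

type_synonym graph = "nat \<Rightarrow> nat \<Rightarrow> nat"

abbreviation empty_graph :: graph where
  "empty_graph \<equiv> \<lambda>_ _. 0"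

text \<open>
  Flows are skew-symmetric: \<open>f u v\<close> is the net flow from \<open>u\<close> to \<open>v\<close>.  For symmetric capacities the
  constraint says that the flow over an edge, in whichever direction, is at most its capacity.
\<close>

definition is_flow :: "nat \<Rightarrow> graph \<Rightarrow> nat \<Rightarrow> nat \<Rightarrow> (nat \<Rightarrow> nat \<Rightarrow> real) \<Rightarrow> bool" where
  "is_flow n g s t f \<longleftrightarrow>
     (\<forall>u<n. \<forall>v<n. f u v = - f v u \<and> f u v \<le> real (g u v)) \<and>
     (\<forall>u<n. u \<noteq> s \<longrightarrow> u \<noteq> t \<longrightarrow> (\<Sum>v<n. f u v) = 0)"

definition flow_value :: "nat \<Rightarrow> nat \<Rightarrow> (nat \<Rightarrow> nat \<Rightarrow> real) \<Rightarrow> real" where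
  "flow_value n s f = (\<Sum>v<n. f s v)"

definition is_max_flow_value :: "nat \<Rightarrow> graph \<Rightarrow> nat \<Rightarrow> nat \<Rightarrow> real \<Rightarrow> bool" where
  "is_max_flow_value n g s t y \<longleftrightarrow>
     (\<exists>f. is_flow n g s t f \<and> flow_value n s f = y) \<and>
     (\<forall>f. is_flow n g s t f \<longrightarrow> flow_value n s f \<le> y)"


section \<open>Incremental and decremental maximum flow\<close>

datatype orientation = Directed | Undirected

datatype mode = Incremental | Decremental

datatype request = Insert nat nat nat | Delete nat nat | Query

definition set_capacity :: "orientation \<Rightarrow> nat \<Rightarrow> nat \<Rightarrow> nat \<Rightarrow> graph \<Rightarrow> graph" where
  "set_capacity d u v c g = (\<lambda>x y.
     if (x = u \<and> y = v) \<or> (d = Undirected \<and> x = v \<and> y = u) then c else g x y)"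

fun update :: "orientation \<Rightarrow> request \<Rightarrow> graph \<Rightarrow> graph" where
  "update d (Insert u v c) g = set_capacity d u v c g"
| "update d (Delete u v) g = set_capacity d u v 0 g"
| "update d Query g = g"

text \<open>
  Graphs are simple: an inserted edge must be absent, a deleted edge must be present.  Capacities
  range over \<open>{1..W}\<close>.
\<close>

fun legal_request :: "mode \<Rightarrow> nat \<Rightarrow> nat \<Rightarrow> graph \<Rightarrow> request \<Rightarrow> bool" where
  "legal_request md n W g (Insert u v c) \<longleftrightarrow>
     md = Incremental \<and> u < n \<and> v < n \<and> u \<noteq> v \<and> g u v = 0 \<and> 1 \<le> c \<and> c \<le> W"
| "legal_request md n W g (Delete u v) \<longleftrightarrow> md = Decremental \<and> u < n \<and> v < n \<and> g u v \<noteq> 0"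
| "legal_request md n W g Query \<longleftrightarrow> True"

fun legal :: "mode \<Rightarrow> orientation \<Rightarrow> nat \<Rightarrow> nat \<Rightarrow> graph \<Rightarrow> request list \<Rightarrow> bool" where
  "legal md d n W g [] \<longleftrightarrow> True"
| "legal md d n W g (r # rs) \<longleftrightarrow> legal_request md n W g r \<and> legal md d n W (update d r g) rs"

text \<open>The outputs \<open>outs\<close> answer the requests; output produced for an update is ignored.\<close>

fun correct_answers ::
    "orientation \<Rightarrow> nat \<Rightarrow> nat \<Rightarrow> nat \<Rightarrow> graph \<Rightarrow> request list \<Rightarrow> nat list list \<Rightarrow> bool" where
  "correct_answers d n s t g [] outs \<longleftrightarrow> outs = []"
| "correct_answers d n s t g (r # rs) outs \<longleftrightarrow> (\<exists>ys outs'. outs = ys # outs' \<and>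
     (r = Query \<longrightarrow> (\<exists>y. ys = [y] \<and> is_max_flow_value n g s t (real y))) \<and>
     correct_answers d n s t (update d r g) rs outs')"

definition insertions :: "(nat \<times> nat \<times> nat) list \<Rightarrow> request list" where
  "insertions es = map (\<lambda>(u, v, c). Insert u v c) es"

fun enc_request :: "request \<Rightarrow> nat list" where
  "enc_request (Insert u v c) = [0, u, v, c]"
| "enc_request (Delete u v) = [1, u, v]"
| "enc_request Query = [2]"

definition enc_init :: "nat \<Rightarrow> nat \<Rightarrow> nat \<Rightarrow> (nat \<times> nat \<times> nat) list \<Rightarrow> nat list" where
  "enc_init n s t es = [n, s, t, length es] @ concat (map (\<lambda>(u, v, c). [u, v, c]) es)"

text \<open>
  \<open>p\<close> solves incremental or decremental maximum flow, with capacities at most \<open>W n\<close>, in amortized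
  time \<open>T n\<close> per operation.  Its first request is the initial graph, given by the list \<open>es\<close> of its
  edges; it is empty in the incremental case.  There is no free preprocessing: reading the initial
  graph belongs to the total time, where each of its nodes and edges counts as an operation.
  The bound holds for every finite sequence of operations, hence for every prefix of one.
\<close>

definition solves_dynamic_flow ::
    "mode \<Rightarrow> orientation \<Rightarrow> (nat \<Rightarrow> nat) \<Rightarrow> com \<Rightarrow> (nat \<Rightarrow> real) \<Rightarrow> bool" where
  "solves_dynamic_flow md d W p T \<longleftrightarrow> (\<exists>c. \<forall>n s t es rs.
     s < n \<longrightarrow> t < n \<longrightarrow> s \<noteq> t \<longrightarrow>
     (md = Incremental \<longrightarrow> es = []) \<longrightarrow>
     legal Incremental d n (W n) empty_graph (insertions es) \<longrightarrow>
     legal md d n (W n) (fold (update d) (insertions es) empty_graph) rs \<longrightarrow>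
     (\<exists>out0 outs \<tau>.
        session ((n + 2) ^ c) p initial_memory
          (enc_init n s t es # map enc_request rs) (out0 # outs) \<tau> \<and>
        correct_answers d n s t (fold (update d) (insertions es) empty_graph) rs outs \<and>
        real \<tau> \<le> real (n + length es + length rs) * T n))"

end

theory Submission
  imports Defs
begin

text \<open>
  A dynamic flow algorithm is used to multiply \<open>q \<times> q\<close> blocks of the matrix, \<open>q \<approx> \<surd>n\<close>, with the
  corresponding parts of the vectors.  An instance for a block has \<open>7 q\<close> nodes and supports \<open>q\<close>
  rounds; a round finds one of the rows of a given set that are hit by the current vector, or
  reports that there is none.  It costs \<open>O(q)\<close> operations: the edges from \<open>F r\<close> to the rows and from
  the columns to \<open>E r\<close> represent the row set and the vector, and the maximum flow exceeds a value
  that is fixed for the round iff an active row is hit.  After a round its edges are neutralised: in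
  the directed case by edges from \<open>s\<close> to \<open>E r\<close> and from \<open>F r\<close> to \<open>t\<close>; in the undirected case, where
  an edge into a hub \<open>F r\<close> or \<open>E r\<close> is a unit of bias towards \<open>s\<close> or \<open>t\<close>, by the opposite bias.
  There the directed matrix edge from row \<open>i\<close> to column \<open>j\<close> is simulated by an undirected edge
  together with a unit of bias of the row towards \<open>t\<close> and of the column towards \<open>s\<close>.
  In the decremental case all edges are present initially and a round deletes the others.

  For each vector a block is played until a round fails, and a row that was found is never asked for
  again, so a vector takes at most \<open>2 q\<^sup>2\<close> rounds.  An exhausted instance is replaced by a new
  one in fresh memory.  This gives \<open>O(q n)\<close> instances of \<open>O(q\<^sup>2)\<close> operations each, hence time
  \<open>O(q n q\<^sup>2 q powr (1 - \<epsilon>)) = O(n powr (3 - \<epsilon> / 2))\<close>.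
\<close>

section \<open>Cuts, and flows on classes of nodes\<close>

text \<open>Updates cannot be undone: an incremental instance keeps the edges of every old vector.
  Hence each round consumes its own pair of hubs \<open>F r\<close>, \<open>E r\<close>, and the
  \<open>q\<close> rounds of an instance, with O(q) operations each, balance the O(q^2) operations
  of its set-up. Rounds that only tested one row would be too many; a round that names a hit row is
  charged to that row, and a failing one to its block. Within a round, answers are compared only
  with each other, so the program never computes the threshold that separates hit from no hit. Two
  further obstacles come from the machine model. The hypothesis on the flow algorithm speaks about
  whole request sequences, whereas requests here depend on earlier answers; determinism of programs
  bridges this gap. And the simulated program expects memory that is all zero, while clearing an old
  area could take \<open>(7 * q + 2) ^ c\<close> steps.\<close>

lemma is_flow_anti: "is_flow n g s t f \<Longrightarrow> u < n \<Longrightarrow> v < n \<Longrightarrow> f u v = - f v u"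
  unfolding is_flow_def by blast

lemma is_flow_cap: "is_flow n g s t f \<Longrightarrow> u < n \<Longrightarrow> v < n \<Longrightarrow> f u v \<le> real (g u v)"
  unfolding is_flow_def by blast

lemma is_flow_balance: "is_flow n g s t f \<Longrightarrow> u < n \<Longrightarrow> u \<noteq> s \<Longrightarrow> u \<noteq> t \<Longrightarrow> (\<Sum>v<n. f u v) = 0"
  unfolding is_flow_def by blast

text \<open>Conservation removes every node of \<open>X\<close> other than \<open>s\<close> from the
  sum, and skew-symmetry cancels the flow inside \<open>X\<close>.\<close>

lemma flow_value_cut:
  assumes f: "is_flow n g s t f" and X: "X \<subseteq> {..<n}" "s \<in> X" "t \<notin> X"
  shows "flow_value n s f = (\<Sum>u\<in>X. \<Sum>v\<in>{..<n} - X. f u v)"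
proof -
  have fin: "finite X" using X(1) finite_subset by blast
  have anti: "f u v = - f v u" if "u < n" "v < n" for u v
    using is_flow_anti[OF f that] .
  have zero: "(\<Sum>u\<in>X. \<Sum>v\<in>X. f u v) = 0"
  proof -
    have "(\<Sum>u\<in>X. \<Sum>v\<in>X. f u v) = (\<Sum>u\<in>X. \<Sum>v\<in>X. - f v u)"
      using X(1) by (intro sum.cong refl anti) auto
    also have "\<dots> = - (\<Sum>u\<in>X. \<Sum>v\<in>X. f u v)"
      by (subst sum.swap) (simp add: sum_negf)
    finally show ?thesis by simp
  qed
  have "flow_value n s f = (\<Sum>u\<in>X. \<Sum>v<n. f u v)"
  proof -
    have "(\<Sum>u\<in>X - {s}. \<Sum>v<n. f u v) = 0"
      using X by (intro sum.neutral ballI is_flow_balance[OF f]) auto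
    then show ?thesis
      using sum.remove[OF fin X(2), of "\<lambda>u. \<Sum>v<n. f u v"] by (simp add: flow_value_def)
  qed
  also have "\<dots> = (\<Sum>u\<in>X. (\<Sum>v\<in>{..<n} - X. f u v) + (\<Sum>v\<in>X. f u v))"
    using X(1) by (intro sum.cong refl sum.subset_diff) auto
  finally show ?thesis by (simp add: sum.distrib zero)
qed

text \<open>Weak duality. Every upper bound on a flow value below comes from an explicit flow that
  fills an explicit cut.\<close>

lemma saturated_cut_max:
  assumes f0: "is_flow n g s t f0" and f: "is_flow n g s t f"
    and X: "X \<subseteq> {..<n}" "s \<in> X" "t \<notin> X"
    and sat: "\<And>u v. u \<in> X \<Longrightarrow> v < n \<Longrightarrow> v \<notin> X \<Longrightarrow> real (g u v) \<le> f0 u v"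
  shows "flow_value n s f \<le> flow_value n s f0"
  unfolding flow_value_cut[OF f0 X] flow_value_cut[OF f X]
proof (intro sum_mono)
  fix u v assume u: "u \<in> X" and v: "v \<in> {..<n} - X"
  then have "f u v \<le> real (g u v)" using is_flow_cap[OF f] X(1) by auto
  also have "\<dots> \<le> f0 u v" using sat u v by auto
  finally show "f u v \<le> f0 u v" .
qed

type_synonym node = "nat \<times> nat"

abbreviation dec :: "nat \<Rightarrow> nat \<Rightarrow> node" where
  "dec q u \<equiv> (u div q, u mod q)"

abbreviation enc :: "nat \<Rightarrow> node \<Rightarrow> nat" where
  "enc q x \<equiv> fst x * q + snd x"

lemma sum_classes:
  fixes \<phi> :: "node \<Rightarrow> 'a::comm_monoid_add"
  assumes "q > 0"
  shows "(\<Sum>v<7 * q. \<phi> (dec q v)) = (\<Sum>c<7. \<Sum>i<q. \<phi> (c, i))"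
proof -
  have "(\<Sum>v<7 * q. \<phi> (dec q v)) = (\<Sum>c<7. sum (\<lambda>v. \<phi> (dec q v)) {c * q..<c * q + q})"
    by (simp add: sum.nat_group)
  also have "\<dots> = (\<Sum>c<7. \<Sum>i<q. \<phi> (c, i))"
  proof (rule sum.cong[OF refl])
    fix c :: nat
    have "sum (\<lambda>v. \<phi> (dec q v)) {c * q..<c * q + q} = (\<Sum>i\<in>{0..<q}. \<phi> (dec q (i + c * q)))"
      using sum.shift_bounds_nat_ivl[of "\<lambda>v. \<phi> (dec q v)" 0 "c * q" q] by (simp add: add.commute)
    also have "\<dots> = (\<Sum>i<q. \<phi> (c, i))"
      using assms by (intro sum.cong) auto
    finally show "sum (\<lambda>v. \<phi> (dec q v)) {c * q..<c * q + q} = (\<Sum>i<q. \<phi> (c, i))" .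
  qed
  finally show ?thesis .
qed

lemma class_bound: "u < 7 * q \<Longrightarrow> q > 0 \<Longrightarrow> u div q < 7 \<and> u mod q < (q::nat)"
  by (simp add: less_mult_imp_div_less)

definition node_sum :: "nat \<Rightarrow> (node \<Rightarrow> real) \<Rightarrow> real" where
  "node_sum q \<phi> = (\<Sum>c<7. \<Sum>i<q. \<phi> (c, i))"

lemma node_sum_expand: "node_sum q \<phi> = (\<Sum>i<q. \<phi> (0,i)) + (\<Sum>i<q. \<phi> (1,i)) + (\<Sum>i<q. \<phi> (2,i)) +
    (\<Sum>i<q. \<phi> (3,i)) + (\<Sum>i<q. \<phi> (4,i)) + (\<Sum>i<q. \<phi> (5,i)) + (\<Sum>i<q. \<phi> (6,i))"
  by (simp add: node_sum_def eval_nat_numeral)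

text \<open>As \<open>q \<ge> 2\<close>, the numbers 0 and 1 decode to \<open>(0,0)\<close> and
  \<open>(0,1)\<close>, which are the terminals.\<close>

definition is_max :: "nat \<Rightarrow> (node \<Rightarrow> node \<Rightarrow> nat) \<Rightarrow> nat \<Rightarrow> bool" where
  "is_max q g y \<longleftrightarrow> is_max_flow_value (7 * q) (\<lambda>u v. g (dec q u) (dec q v)) 0 1 (real y)"

definition valid_node :: "nat \<Rightarrow> node \<Rightarrow> bool" where
  "valid_node q x \<longleftrightarrow> fst x < 7 \<and> snd x < q"

text \<open>Here \<open>h u v - h v u\<close> is the net flow, so that only capacities and node balances matter.\<close>

lemma net_flow:
  assumes q: "q \<ge> 2"
    and cap: "\<And>x y. valid_node q x \<Longrightarrow> valid_node q y \<Longrightarrow> 0 \<le> h x y \<and> h x y \<le> real (g x y)"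
    and bal: "\<And>x. valid_node q x \<Longrightarrow> x \<noteq> (0,0) \<Longrightarrow> x \<noteq> (0,1) \<Longrightarrow>
      node_sum q (h x) = node_sum q (\<lambda>y. h y x)"
  defines "f \<equiv> \<lambda>u v. h (dec q u) (dec q v) - h (dec q v) (dec q u)"
  shows "is_flow (7 * q) (\<lambda>u v. g (dec q u) (dec q v)) 0 1 f"
    and "flow_value (7 * q) 0 f = node_sum q (h (0,0)) - node_sum q (\<lambda>y. h y (0,0))"
proof -
  have val: "valid_node q (dec q u)" if "u < 7 * q" for u
    using class_bound[OF that] q by (simp add: valid_node_def)
  have s: "(\<Sum>v<7 * q. f u v) = node_sum q (h (dec q u)) - node_sum q (\<lambda>y. h y (dec q u))" for u
    unfolding f_def node_sum_def sum_subtractf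
    using sum_classes[of q "h (dec q u)"] sum_classes[of q "\<lambda>y. h y (dec q u)"] q by simp
  have "dec q u \<noteq> (0,0)" "dec q u \<noteq> (0,1)" if "u \<noteq> 0" "u \<noteq> 1" "u < 7 * q" for u
    using that q by (auto simp: div_eq_0_iff)
  then have "(\<Sum>v<7 * q. f u v) = 0" if "u \<noteq> 0" "u \<noteq> 1" "u < 7 * q" for u
    using that bal[OF val] s by simp
  moreover have "f u v \<le> real (g (dec q u) (dec q v))" if "u < 7 * q" "v < 7 * q" for u v
    using cap[OF val val, OF that] cap[OF val val, OF that(2,1)] by (simp add: f_def)
  ultimately show "is_flow (7 * q) (\<lambda>u v. g (dec q u) (dec q v)) 0 1 f"
    by (simp add: is_flow_def f_def)
  show "flow_value (7 * q) 0 f = node_sum q (h (0,0)) - node_sum q (\<lambda>y. h y (0,0))"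
    using s[of 0] by (simp add: flow_value_def)
qed

lemma is_max_lower:
  assumes "is_max q g y" "is_flow (7 * q) (\<lambda>u v. g (dec q u) (dec q v)) 0 1 f"
  shows "flow_value (7 * q) 0 f \<le> y"
  using assms by (auto simp: is_max_def is_max_flow_value_def)

text \<open>The flow bounds the answer from below and the cut from above. The cut is a predicate on
  pairs of class and index, so that saturation can be checked class by class.\<close>

lemma is_max_saturated:
  assumes mx: "is_max q g y" and q: "q \<ge> 2"
    and f: "is_flow (7 * q) (\<lambda>u v. g (dec q u) (dec q v)) 0 1 f"
    and h: "f = (\<lambda>u v. h (dec q u) (dec q v) - h (dec q v) (dec q u))"
    and X: "X (0,0)" "\<not> X (0,1)"
    and sat: "\<And>x z. valid_node q x \<Longrightarrow> valid_node q z \<Longrightarrow> X x \<Longrightarrow> \<not> X z \<Longrightarrow> real (g x z) \<le> h x z - h z x"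
  shows "real y = flow_value (7 * q) 0 f"
proof (rule antisym)
  obtain f' where f': "is_flow (7 * q) (\<lambda>u v. g (dec q u) (dec q v)) 0 1 f'"
    "flow_value (7 * q) 0 f' = real y"
    using mx by (auto simp: is_max_def is_max_flow_value_def)
  have val: "valid_node q (dec q u)" if "u < 7 * q" for u
    using class_bound[OF that] q by (simp add: valid_node_def)
  have "flow_value (7 * q) 0 f' \<le> flow_value (7 * q) 0 f"
  proof (rule saturated_cut_max[OF f f'(1), where X = "{u. u < 7 * q \<and> X (dec q u)}"])
    fix u v assume "u \<in> {u. u < 7 * q \<and> X (dec q u)}" "v < 7 * q" "v \<notin> {u. u < 7 * q \<and> X (dec q u)}"
    then show "real (g (dec q u) (dec q v)) \<le> f u v"
      using sat[OF val val] by (auto simp: h)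
  qed (use X q in auto)
  then show "real y \<le> flow_value (7 * q) 0 f" using f'(2) by simp
  show "flow_value (7 * q) 0 f \<le> real y" by (rule is_max_lower[OF mx f])
qed

section \<open>Two gadgets that detect a hit\<close>

text \<open>
  A node is a pair of a class and an index: class 0 contains \<open>s = (0,0)\<close> and \<open>t = (0,1)\<close>, class 1 the
  rows, 2 the columns, 3 the \<open>F r\<close>, 4 the \<open>E r\<close>; the nodes of class 5 are joined to \<open>s\<close> and those of
  class 6 to \<open>t\<close> in order to bias the columns and the rows in the undirected case.
\<close>

definition edge_cap :: "orientation \<Rightarrow> nat \<Rightarrow> node \<Rightarrow> node \<Rightarrow> nat" where
  "edge_cap d q x y = (if d = Undirected \<and> (fst x = 0 \<or> fst y = 0) then 2 * q else 1)"

definition edge_graph :: "orientation \<Rightarrow> nat \<Rightarrow> (node \<times> node) set \<Rightarrow> node \<Rightarrow> node \<Rightarrow> nat" where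
  "edge_graph d q E x y =
     (if (x, y) \<in> E \<or> (d = Undirected \<and> (y, x) \<in> E) then edge_cap d q x y else 0)"

text \<open>A path from \<open>F r\<close> through a row and a column to \<open>E r\<close>. As the
  edges at \<open>E r\<close> encode the vector, it says that some row joined to \<open>F r\<close>
  is a one of the product.\<close>

definition hit :: "nat \<Rightarrow> (node \<times> node) set \<Rightarrow> nat \<Rightarrow> bool" where
  "hit q E r \<longleftrightarrow> (\<exists>i<q. \<exists>j<q. ((3,r),(1,i)) \<in> E \<and> ((1,i),(2,j)) \<in> E \<and> ((2,j),(4,r)) \<in> E)"

text \<open>In the rule names, \<open>A\<close> stands for rows, \<open>B\<close> for columns,
  \<open>F\<close> and \<open>E\<close> for the hubs. \<open>sF\<close> and \<open>Et\<close> let a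
  pair of hubs carry a unit through the matrix; with \<open>sE\<close> and \<open>Ft\<close> present
  as well, each hub passes a unit straight from \<open>s\<close> to \<open>t\<close>.\<close>

inductive directed_edge :: "nat \<Rightarrow> node \<Rightarrow> node \<Rightarrow> bool" for q where
  AB: "i < q \<Longrightarrow> j < q \<Longrightarrow> directed_edge q (1,i) (2,j)"
| FA: "k < q \<Longrightarrow> j < q \<Longrightarrow> directed_edge q (3,k) (1,j)"
| BE: "k < q \<Longrightarrow> j < q \<Longrightarrow> directed_edge q (2,j) (4,k)"
| sF: "k < q \<Longrightarrow> directed_edge q (0,0) (3,k)"
| Et: "k < q \<Longrightarrow> directed_edge q (4,k) (0,1)"
| sE: "k < q \<Longrightarrow> directed_edge q (0,0) (4,k)"
| Ft: "k < q \<Longrightarrow> directed_edge q (3,k) (0,1)"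

definition directed_edges :: "nat \<Rightarrow> (node \<times> node) set" where
  "directed_edges q = {(x, y). directed_edge q x y}"

text \<open>Each \<open>k\<close> in \<open>K\<close> contributes two units, one through
  \<open>F k\<close> alone and one through \<open>E k\<close> alone. The other \<open>w\<close>
  units follow \<open>F r\<close>, row \<open>a\<close>, column \<open>b\<close>,
  \<open>E r\<close>; \<open>w\<close> is 1 for a hit and 0 for the base flow.\<close>

definition directed_flow :: "nat set \<Rightarrow> nat \<Rightarrow> nat \<Rightarrow> nat \<Rightarrow> real \<Rightarrow> node \<Rightarrow> node \<Rightarrow> real" where
  "directed_flow K r a b w x y = (case x of (c, i) \<Rightarrow> case y of (c', i') \<Rightarrow>
     if c = 0 \<and> c' = 3 \<and> i = 0 then of_bool (i' \<in> K) + (if i' = r then w else 0)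
     else if c = 4 \<and> c' = 0 \<and> i' = 1 then of_bool (i \<in> K) + (if i = r then w else 0)
     else if c = 0 \<and> c' = 4 \<and> i = 0 then of_bool (i' \<in> K)
     else if c = 3 \<and> c' = 0 \<and> i' = 1 then of_bool (i \<in> K)
     else if c = 3 \<and> c' = 1 \<and> i = r then if i' = a then w else 0
     else if c = 1 \<and> c' = 2 \<and> i = a then if i' = b then w else 0
     else if c = 2 \<and> c' = 4 \<and> i = b then if i' = r then w else 0
     else 0)"

lemma sum_if_and:
  fixes w :: real and q a :: nat
  shows "(\<Sum>i<q. if P \<and> i = a then w else 0) = (if P \<and> a < q then w else 0)"
    "(\<Sum>i<q. if i = a \<and> P then w else 0) = (if P \<and> a < q then w else 0)"
    "(\<Sum>i<q. if i = a then if P then w else 0 else 0) = (if P \<and> a < q then w else 0)"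
  by (cases P; simp)+

lemma class_cases:
  assumes "valid_node q x"
  obtains i where "i < q" "x = (0,i)" | i where "i < q" "x = (1,i)" | i where "i < q" "x = (2,i)"
  | i where "i < q" "x = (3,i)" | i where "i < q" "x = (4,i)" | i where "i < q" "x = (5,i)"
  | i where "i < q" "x = (6,i)"
proof -
  obtain c i where x: "x = (c, i)" by force
  have c: "c = 0 \<or> c = 1 \<or> c = 2 \<or> c = 3 \<or> c = 4 \<or> c = 5 \<or> c = 6" and i: "i < q"
    using assms by (auto simp: valid_node_def x)
  show thesis
    using c
  proof (elim disjE)
    assume "c = 0" then show thesis using that(1)[OF i] x by blast
  next
    assume "c = 1" then show thesis using that(2)[OF i] x by blast
  next
    assume "c = 2" then show thesis using that(3)[OF i] x by blast
  next
    assume "c = 3" then show thesis using that(4)[OF i] x by blast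
  next
    assume "c = 4" then show thesis using that(5)[OF i] x by blast
  next
    assume "c = 5" then show thesis using that(6)[OF i] x by blast
  next
    assume "c = 6" then show thesis using that(7)[OF i] x by blast
  qed
qed

text \<open>Another pair of hubs is either neutral, and its two direct units fill the edges
  \<open>s\<close> to \<open>F k\<close> and \<open>E k\<close> to \<open>t\<close>, or dead, and
  both of these edges are absent. An additional unit has to leave through \<open>F r\<close> and to
  arrive through \<open>E r\<close>.\<close>

lemma directed_gadget:
  assumes q: "q \<ge> 2" and r: "r < q" and E: "E \<subseteq> directed_edges q" and K: "K \<subseteq> {..<q} - {r}"
    and neutral: "\<And>k. k \<in> K \<Longrightarrow> ((0,0),(3,k)) \<in> E \<and> ((4,k),(0,1)) \<in> E \<and> ((0,0),(4,k)) \<in> E \<and> ((3,k),(0,1)) \<in> E"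
    and dead: "\<And>k. k < q \<Longrightarrow> k \<noteq> r \<Longrightarrow> k \<notin> K \<Longrightarrow> ((0,0),(3,k)) \<notin> E \<and> ((4,k),(0,1)) \<notin> E"
    and open_r: "((0,0),(3,r)) \<in> E" "((4,r),(0,1)) \<in> E" "((0,0),(4,r)) \<notin> E" "((3,r),(0,1)) \<notin> E"
    and mx: "is_max q (edge_graph Directed q E) y"
  shows "if hit q E r then real y > 2 * real (card K) else real y = 2 * real (card K)"
proof -
  define h where "h = (\<lambda>w a b. directed_flow K r a b w)"
  define f where "f = (\<lambda>w a b u v. h w a b (dec q u) (dec q v) - h w a b (dec q v) (dec q u))"
  have rK: "r \<notin> K" and Kq: "\<And>k. k \<in> K \<Longrightarrow> k < q" using K by auto
  have cap1: "edge_graph Directed q E x y = of_bool ((x, y) \<in> E)" for x y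
    by (simp add: edge_graph_def edge_cap_def)
  have flow: "is_flow (7 * q) (\<lambda>u v. edge_graph Directed q E (dec q u) (dec q v)) 0 1 (f w a b)"
    "flow_value (7 * q) 0 (f w a b) = 2 * real (card K) + w"
    if w: "w = 0 \<or> w = 1 \<and> ((3,r),(1,a)) \<in> E \<and> ((1,a),(2,b)) \<in> E \<and> ((2,b),(4,r)) \<in> E"
      and ab: "a < q" "b < q" for w a b
  proof -
    have w0: "w \<ge> 0" using w by auto
    have "0 \<le> h w a b x z \<and> h w a b x z \<le> real (edge_graph Directed q E x z)"
      if v: "valid_node q x" "valid_node q z" for x z
    proof (cases "w = 0")
      case True
      show ?thesis
        by (cases rule: class_cases[OF v(1)]; cases rule: class_cases[OF v(2)])
          (simp_all add: True cap1 h_def directed_flow_def neutral del: One_nat_def)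
    next
      case False
      then have "w = 1" "((3,r),(1,a)) \<in> E" "((1,a),(2,b)) \<in> E" "((2,b),(4,r)) \<in> E" using w by auto
      then show ?thesis
        by (cases rule: class_cases[OF v(1)]; cases rule: class_cases[OF v(2)])
          (simp_all add: cap1 h_def directed_flow_def neutral open_r rK del: One_nat_def)
    qed
    moreover have "node_sum q (h w a b x) = node_sum q (\<lambda>y. h w a b y x)"
      if "valid_node q x" "x \<noteq> (0,0)" "x \<noteq> (0,1)" for x
      using that(1)
      by (cases rule: class_cases)
        (use that ab r q in \<open>auto simp: node_sum_expand h_def directed_flow_def sum_if_and simp del: One_nat_def cong: if_cong\<close>)
    ultimately show "is_flow (7 * q) (\<lambda>u v. edge_graph Directed q E (dec q u) (dec q v)) 0 1 (f w a b)"
      and "flow_value (7 * q) 0 (f w a b) = 2 * real (card K) + w"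
      unfolding f_def using net_flow[OF q, of "h w a b" "edge_graph Directed q E"] K r
      by (auto simp: node_sum_expand h_def directed_flow_def sum.distrib of_bool_def
          sum.If_cases Int_absorb1 subset_Diff_insert)
  qed
  show ?thesis
  proof (cases "hit q E r")
    case True
    then obtain a b where ab: "a < q" "b < q" "((3,r),(1,a)) \<in> E" "((1,a),(2,b)) \<in> E" "((2,b),(4,r)) \<in> E"
      by (auto simp: hit_def)
    then have "2 * real (card K) + 1 \<le> real y"
      using is_max_lower[OF mx flow(1), of 1 a b] flow(2)[of 1 a b] by simp
    then show ?thesis using True by simp
  next
    case False
    \<comment> \<open>What \<open>F r\<close> reaches, together with every \<open>E k\<close> other
      than \<open>E r\<close>. With these on the source side, the cut contains their full edges to
      \<open>t\<close> and not the column edges into them; without a hit, no column of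
      \<open>X\<close> is joined to \<open>E r\<close>.\<close>
    define X where "X = (\<lambda>(c, i). c = 0 \<and> i = 0 \<or> c = 4 \<and> i \<noteq> r \<or> c = 3 \<and> i = r \<or>
      c = 1 \<and> ((3,r),(1,i)) \<in> E \<or> c = (2::nat) \<and> (\<exists>a<q. ((3,r),(1,a)) \<in> E \<and> ((1,a),(2,i)) \<in> E))"
    have "real y = flow_value (7 * q) 0 (f 0 0 0)"
    proof (rule is_max_saturated[OF mx q flow(1)])
      fix x z assume v: "valid_node q x" "valid_node q z" "X x" "\<not> X z"
      show "real (edge_graph Directed q E x z) \<le> h 0 0 0 x z - h 0 0 0 z x"
      proof (cases "(x, z) \<in> E")
        case e: True
        then have "directed_edge q x z" using E by (auto simp: directed_edges_def)
        then show ?thesis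
        proof cases
          case (AB i j)
          then show ?thesis using v e by (auto simp: X_def)
        next
          case (FA k j)
          then show ?thesis using v e by (simp add: X_def)
        next
          case (BE k j)
          then show ?thesis using v e False by (auto simp: X_def hit_def)
        next
          case (sF k)
          then show ?thesis using v e dead[of k] rK
            by (auto simp: X_def cap1 h_def directed_flow_def simp del: One_nat_def)
        next
          case (Et k)
          then show ?thesis using v e dead[of k] rK
            by (auto simp: X_def cap1 h_def directed_flow_def simp del: One_nat_def)
        next
          case (sE k)
          then show ?thesis using v e open_r by (auto simp: X_def)
        next
          case (Ft k)
          then show ?thesis using v e open_r by (auto simp: X_def)
        qed
      next
        case False
        have "0 \<le> h 0 0 0 x z - h 0 0 0 z x"
          by (cases rule: class_cases[OF v(1)]; cases rule: class_cases[OF v(2)])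
            (use v(3,4) rK in \<open>simp_all add: h_def directed_flow_def X_def del: One_nat_def\<close>)
        then show ?thesis using False by (simp add: cap1)
      qed
    qed (use q in \<open>auto simp: X_def f_def\<close>)
    then show ?thesis using flow(2)[of 0 0 0] q False by simp
  qed
qed

section \<open>The undirected gadget\<close>

inductive undirected_edge :: "nat \<Rightarrow> node \<Rightarrow> node \<Rightarrow> bool" for q where
  AB: "i < q \<Longrightarrow> j < q \<Longrightarrow> undirected_edge q (1,i) (2,j)"
| AQ: "i < q \<Longrightarrow> j < q \<Longrightarrow> undirected_edge q (1,i) (6,j)"
| PB: "i < q \<Longrightarrow> j < q \<Longrightarrow> undirected_edge q (5,i) (2,j)"
| FA: "k < q \<Longrightarrow> j < q \<Longrightarrow> undirected_edge q (3,k) (1,j)"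
| BE: "k < q \<Longrightarrow> j < q \<Longrightarrow> undirected_edge q (2,j) (4,k)"
| AE: "k < q \<Longrightarrow> j < q \<Longrightarrow> undirected_edge q (1,j) (4,k)"
| FB: "k < q \<Longrightarrow> j < q \<Longrightarrow> undirected_edge q (3,k) (2,j)"
| sF: "k < q \<Longrightarrow> undirected_edge q (0,0) (3,k)"
| Et: "k < q \<Longrightarrow> undirected_edge q (4,k) (0,1)"
| sP: "k < q \<Longrightarrow> undirected_edge q (0,0) (5,k)"
| Qt: "k < q \<Longrightarrow> undirected_edge q (6,k) (0,1)"

definition undirected_edges :: "nat \<Rightarrow> (node \<times> node) set" where
  "undirected_edges q = {(x, y). undirected_edge q x y}"

text \<open>In the base flow each matrix edge carries a unit backwards, from column to row, fed
  through class 5 and drained through class 6. The other hubs carry units \<open>F k\<close> - row -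
  \<open>E k\<close> (counted by \<open>f\<close>) and \<open>F k\<close> - column -
  \<open>E k\<close> (counted by \<open>g\<close>). The hit unit passes from row \<open>a\<close> to
  column \<open>b\<close> by cancelling the backward unit there: this is how an undirected edge
  acquires a direction.\<close>

definition undirected_flow ::
    "nat \<Rightarrow> (nat \<Rightarrow> nat \<Rightarrow> real) \<Rightarrow> (nat \<Rightarrow> nat \<Rightarrow> real) \<Rightarrow> (nat \<Rightarrow> nat \<Rightarrow> real) \<Rightarrow>
     nat \<Rightarrow> nat \<Rightarrow> nat \<Rightarrow> real \<Rightarrow> node \<Rightarrow> node \<Rightarrow> real" where
  "undirected_flow q m f g r a b w x y = (case x of (c, i) \<Rightarrow> case y of (c', j) \<Rightarrow>
     if c = 0 \<and> c' = 5 \<and> i = 0 then (\<Sum>l<q. m j l)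
     else if c = 5 \<and> c' = 2 then m i j
     else if c = 2 \<and> c' = 1 then m j i - (if j = a \<and> i = b then w else 0)
     else if c = 1 \<and> c' = 6 then m i j
     else if c = 6 \<and> c' = 0 \<and> j = 1 then (\<Sum>l<q. m l i)
     else if c = 0 \<and> c' = 3 \<and> i = 0 then (\<Sum>l<q. f j l) + (\<Sum>l<q. g j l) + (if j = r then w else 0)
     else if c = 3 \<and> c' = 1 then f i j + (if i = r \<and> j = a then w else 0)
     else if c = 1 \<and> c' = 4 then f j i
     else if c = 3 \<and> c' = 2 then g i j
     else if c = 2 \<and> c' = 4 then g j i + (if j = r \<and> i = b then w else 0)
     else if c = 4 \<and> c' = 0 \<and> j = 1 then (\<Sum>l<q. f i l) + (\<Sum>l<q. g i l) + (if i = r then w else 0)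
     else 0)"

text \<open>The backward unit fills a matrix edge from column to row but leaves it open from row to
  column. \<open>V\<close> is the value of the base flow; the edges at \<open>F r\<close> and
  \<open>E r\<close> do not enter it.\<close>

lemma undirected_gadget:
  fixes q r y :: nat and E :: "(node \<times> node) set"
  defines "m \<equiv> \<lambda>i j. of_bool (((1,i),(2,j)) \<in> E) :: real"
    and "f \<equiv> \<lambda>k i. of_bool (k \<noteq> r \<and> ((3,k),(1,i)) \<in> E) :: real"
    and "g \<equiv> \<lambda>k j. of_bool (k \<noteq> r \<and> ((2,j),(4,k)) \<in> E) :: real"
  defines "V \<equiv> (\<Sum>i<q. \<Sum>j<q. m i j) + (\<Sum>k<q. (\<Sum>i<q. f k i) + (\<Sum>j<q. g k j))"
  assumes q: "q \<ge> 2" and r: "r < q" and E: "E \<subseteq> undirected_edges q"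
    and copies: "\<And>i j. i < q \<Longrightarrow> j < q \<Longrightarrow>
      (((1,i),(6,j)) \<in> E \<longleftrightarrow> ((1,i),(2,j)) \<in> E) \<and> (((5,i),(2,j)) \<in> E \<longleftrightarrow> ((1,i),(2,j)) \<in> E)"
    and hubs: "\<And>k. k < q \<Longrightarrow> ((0,0),(3,k)) \<in> E \<and> ((4,k),(0,1)) \<in> E \<and> ((0,0),(5,k)) \<in> E \<and> ((6,k),(0,1)) \<in> E"
    and balanced: "\<And>k i. k < q \<Longrightarrow> k \<noteq> r \<Longrightarrow> i < q \<Longrightarrow>
      (((1,i),(4,k)) \<in> E \<longleftrightarrow> ((3,k),(1,i)) \<in> E) \<and> (((3,k),(2,i)) \<in> E \<longleftrightarrow> ((2,i),(4,k)) \<in> E)"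
    and open_r: "\<And>i. ((1,i),(4,r)) \<notin> E \<and> ((3,r),(2,i)) \<notin> E"
    and mx: "is_max q (edge_graph Undirected q E) y"
  shows "if hit q E r then real y > V else real y = V"
proof -
  define h where "h = (\<lambda>w a b. undirected_flow q m f g r a b w)"
  define N where "N = (\<lambda>w a b u v. h w a b (dec q u) (dec q v) - h w a b (dec q v) (dec q u))"
  have le: "(\<Sum>l<q. \<phi> l) \<le> real q" if "\<And>l. \<phi> l \<le> 1" for \<phi> :: "nat \<Rightarrow> real"
    using sum_bounded_above[of "{..<q}" \<phi> 1] that by simp
  have m01: "0 \<le> m i j" "m i j \<le> 1" and f01: "0 \<le> f i j" "f i j \<le> 1" "f r j = 0"
    and g01: "0 \<le> g i j" "g i j \<le> 1" "g r j = 0" for i j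
    by (simp_all add: m_def f_def g_def)
  have ml: "(\<Sum>l<q. m i l) \<le> 2 * real q" "(\<Sum>l<q. m l i) \<le> 2 * real q" for i
    using le[of "m i"] le[of "\<lambda>l. m l i"] m01 by simp_all
  \<comment> \<open>A hub passes on at most \<open>q\<close> row units and \<open>q\<close> column
    units; this is the origin of the capacity \<open>2 * q\<close> at the terminals.\<close>
  have fg: "(\<Sum>l<q. f i l) + (\<Sum>l<q. g i l) \<le> 2 * real q" for i
    using le[of "f i"] le[of "g i"] f01 g01 by simp
  have nn: "0 \<le> (\<Sum>l<q. m i l)" "0 \<le> (\<Sum>l<q. m l i)" "0 \<le> (\<Sum>l<q. f i l) + (\<Sum>l<q. g i l)" for i
    by (simp_all add: sum_nonneg m01 f01 g01)
  have zero: "((1,i),(2,j)) \<notin> E \<Longrightarrow> m i j = 0" "((3,i),(1,j)) \<notin> E \<Longrightarrow> f i j = 0"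
    "((2,j),(4,i)) \<notin> E \<Longrightarrow> g i j = 0" for i j
    by (simp_all add: m_def f_def g_def)
  have zero': "((1,i),(4,k)) \<notin> E \<Longrightarrow> f k i = 0" "((3,k),(2,i)) \<notin> E \<Longrightarrow> g k i = 0"
    if "k < q" "i < q" for k i
    using that balanced by (auto simp: f_def g_def)
  have one: "((1,i),(2,j)) \<in> E \<Longrightarrow> m i j = 1" "((3,i),(1,j)) \<in> E \<Longrightarrow> i \<noteq> r \<Longrightarrow> f i j = 1"
    "((2,j),(4,i)) \<in> E \<Longrightarrow> i \<noteq> r \<Longrightarrow> g i j = 1" for i j
    by (simp_all add: m_def f_def g_def)
  have one2: "((3,i),(1,j)) \<in> E \<Longrightarrow> ((3,r),(1,j)) \<notin> E \<Longrightarrow> f i j = 1"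
    "((2,j),(4,i)) \<in> E \<Longrightarrow> ((2,j),(4,r)) \<notin> E \<Longrightarrow> g i j = 1" for i j
    by (auto simp: f_def g_def)
  have one': "((1,i),(4,k)) \<in> E \<Longrightarrow> f k i = 1" "((3,k),(2,i)) \<in> E \<Longrightarrow> g k i = 1"
    if "k < q" "i < q" for k i
    using that balanced open_r by (auto simp: f_def g_def)
  have cap: "0 \<le> h w a b x z \<and> h w a b x z \<le> real (edge_graph Undirected q E x z)"
    if w: "w = 0 \<or> w = 1 \<and> ((3,r),(1,a)) \<in> E \<and> ((1,a),(2,b)) \<in> E \<and> ((2,b),(4,r)) \<in> E"
      and v: "valid_node q x" "valid_node q z" for w a b x z
  proof (cases "w = 0")
    case True
    show ?thesis
      by (cases rule: class_cases[OF v(1)]; cases rule: class_cases[OF v(2)])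
        (auto simp: True edge_graph_def edge_cap_def h_def undirected_flow_def nn ml fg hubs
          copies m01 f01 g01 zero zero' simp del: One_nat_def)
  next
    case False
    then have *: "w = 1" "((3,r),(1,a)) \<in> E" "((1,a),(2,b)) \<in> E" "((2,b),(4,r)) \<in> E" using w by auto
    then have "m a b = 1" by (simp add: m_def)
    with * show ?thesis
      by (cases rule: class_cases[OF v(1)]; cases rule: class_cases[OF v(2)])
        (auto simp: edge_graph_def edge_cap_def h_def undirected_flow_def nn ml fg hubs q f01 g01
          copies m01 f01 g01 zero zero' simp del: One_nat_def)
  qed
  have flow: "is_flow (7 * q) (\<lambda>u v. edge_graph Undirected q E (dec q u) (dec q v)) 0 1 (N w a b)"
    "flow_value (7 * q) 0 (N w a b) = V + w"
    if w: "w = 0 \<or> w = 1 \<and> ((3,r),(1,a)) \<in> E \<and> ((1,a),(2,b)) \<in> E \<and> ((2,b),(4,r)) \<in> E"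
      and ab: "a < q" "b < q" for w a b
  proof -
    note cap[OF w]
    moreover have "node_sum q (h w a b x) = node_sum q (\<lambda>y. h w a b y x)"
      if "valid_node q x" "x \<noteq> (0,0)" "x \<noteq> (0,1)" for x
      using that(1)
      by (cases rule: class_cases)
        (use that ab r q in \<open>auto simp: node_sum_expand h_def undirected_flow_def sum_if_and
          sum.distrib sum_subtractf simp del: One_nat_def cong: if_cong\<close>)
    ultimately show "is_flow (7 * q) (\<lambda>u v. edge_graph Undirected q E (dec q u) (dec q v)) 0 1 (N w a b)"
      and "flow_value (7 * q) 0 (N w a b) = V + w"
      unfolding N_def using net_flow[OF q, of "h w a b" "edge_graph Undirected q E"] r
      by (auto simp: node_sum_expand h_def undirected_flow_def sum.distrib V_def)
  qed
  show ?thesis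
  proof (cases "hit q E r")
    case True
    then obtain a b where ab: "a < q" "b < q" "((3,r),(1,a)) \<in> E" "((1,a),(2,b)) \<in> E" "((2,b),(4,r)) \<in> E"
      by (auto simp: hit_def)
    then have "V + 1 \<le> real y"
      using is_max_lower[OF mx flow(1), of 1 a b] flow(2)[of 1 a b] by simp
    then show ?thesis using True by simp
  next
    case False
    \<comment> \<open>The rows are those joined to \<open>F r\<close>, the columns those not joined
      to \<open>E r\<close>. A matrix edge that leaves \<open>X\<close> from a row would be a hit;
      one that leaves \<open>X\<close> from a column is filled by its backward unit.\<close>
    define X where "X = (\<lambda>(c, i). c = 0 \<and> i = 0 \<or> c = 3 \<or> c = 5 \<or>
      c = 1 \<and> ((3,r),(1,i)) \<in> E \<or> c = (2::nat) \<and> ((2,i),(4,r)) \<notin> E)"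
    have "real y = flow_value (7 * q) 0 (N 0 0 0)"
    proof (rule is_max_saturated[OF mx q flow(1)])
      fix x z assume v: "valid_node q x" "valid_node q z" "X x" "\<not> X z"
      consider (fw) "(x, z) \<in> E" | (bw) "(z, x) \<in> E" | (none) "(x, z) \<notin> E" "(z, x) \<notin> E" by blast
      then show "real (edge_graph Undirected q E x z) \<le> h 0 0 0 x z - h 0 0 0 z x"
      proof cases
        case e: fw
        then have "undirected_edge q x z" using E by (auto simp: undirected_edges_def)
        then show ?thesis
          by cases (use v e False in \<open>auto simp: X_def hit_def edge_graph_def edge_cap_def h_def
            undirected_flow_def zero zero' one one' one2 copies open_r simp del: One_nat_def\<close>)
      next
        case e: bw
        then have "undirected_edge q z x" using E by (auto simp: undirected_edges_def)
        then show ?thesis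
          by cases (use v e False in \<open>auto simp: X_def hit_def edge_graph_def edge_cap_def h_def
            undirected_flow_def zero zero' one one' one2 copies open_r simp del: One_nat_def\<close>)
      next
        case none
        then have "edge_graph Undirected q E x z = 0" "edge_graph Undirected q E z x = 0"
          by (simp_all add: edge_graph_def)
        then show ?thesis using cap[OF disjI1[OF refl] v(1,2), of 0 0] cap[OF disjI1[OF refl] v(2,1), of 0 0] by simp
      qed
    qed (use q in \<open>auto simp: X_def N_def\<close>)
    then show ?thesis using flow(2)[of 0 0 0] q False by simp
  qed
qed

section \<open>The update scripts\<close>

text \<open>Edge lists are kept as data: a template denotes a list of pairs here and is compiled
  into code later, so that legality of the requests can be settled on lists.\<close>

datatype sel = Sel0 | Sel1 | Outer | Inner

text \<open>\<open>AtZero\<close> makes an edge that depends on the outer index alone appear once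
  per inner loop. The last three conditions consult the matrix, the vector and the rows already
  found.\<close>

datatype cnd = Always | AtZero | IfM bool | IfV bool | IfF bool

type_synonym port = "nat \<times> sel"
type_synonym template = "cnd \<times> port \<times> port"

fun port_node :: "nat \<Rightarrow> nat \<Rightarrow> port \<Rightarrow> node" where
  "port_node o' x (c, Sel0) = (c, 0)"
| "port_node o' x (c, Sel1) = (c, 1)"
| "port_node o' x (c, Outer) = (c, o')"
| "port_node o' x (c, Inner) = (c, x)"

fun cnd_holds :: "(nat \<Rightarrow> nat \<Rightarrow> bool) \<Rightarrow> (nat \<Rightarrow> bool) \<Rightarrow> (nat \<Rightarrow> bool) \<Rightarrow> nat \<Rightarrow> nat \<Rightarrow> cnd \<Rightarrow> bool" where
  "cnd_holds M V D o' x Always \<longleftrightarrow> True"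
| "cnd_holds M V D o' x AtZero \<longleftrightarrow> x = 0"
| "cnd_holds M V D o' x (IfM b) \<longleftrightarrow> M o' x = b"
| "cnd_holds M V D o' x (IfV b) \<longleftrightarrow> V x = b"
| "cnd_holds M V D o' x (IfF b) \<longleftrightarrow> D x = b"

definition pairs where
  "pairs M V D tms o' x = map (\<lambda>(c, u, v). (port_node o' x u, port_node o' x v))
     (filter (\<lambda>(c, u, v). cnd_holds M V D o' x c) tms)"

definition script where
  "script M V D tms o' q = concat (map (pairs M V D tms o') [0..<q])"

fun full_tms :: "orientation \<Rightarrow> template list" where
  "full_tms Directed = [(Always, (1,Outer), (2,Inner)), (Always, (3,Outer), (1,Inner)),
     (Always, (2,Inner), (4,Outer)), (AtZero, (0,Sel0), (3,Outer)), (AtZero, (4,Outer), (0,Sel1)),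
     (AtZero, (0,Sel0), (4,Outer)), (AtZero, (3,Outer), (0,Sel1))]"
| "full_tms Undirected = [(Always, (1,Outer), (2,Inner)), (Always, (1,Outer), (6,Inner)),
     (Always, (5,Outer), (2,Inner)), (Always, (3,Outer), (1,Inner)), (Always, (2,Inner), (4,Outer)),
     (Always, (1,Inner), (4,Outer)), (Always, (3,Outer), (2,Inner)),
     (AtZero, (0,Sel0), (3,Outer)), (AtZero, (4,Outer), (0,Sel1)),
     (AtZero, (0,Sel0), (5,Outer)), (AtZero, (6,Outer), (0,Sel1))]"

text \<open>The templates list edges to be toggled, that is, inserted or deleted according to the
  mode; hence the opposite conditions in the decremental case.\<close>

fun init_tms :: "mode \<Rightarrow> orientation \<Rightarrow> template list" where
  "init_tms Incremental Directed = [(IfM True, (1,Outer), (2,Inner))]"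
| "init_tms Decremental Directed = [(IfM False, (1,Outer), (2,Inner))]"
| "init_tms Incremental Undirected = [(IfM True, (1,Outer), (2,Inner)), (IfM True, (1,Outer), (6,Inner)),
     (IfM True, (5,Outer), (2,Inner)), (AtZero, (0,Sel0), (3,Outer)), (AtZero, (4,Outer), (0,Sel1)),
     (AtZero, (0,Sel0), (5,Outer)), (AtZero, (6,Outer), (0,Sel1))]"
| "init_tms Decremental Undirected = [(IfM False, (1,Outer), (2,Inner)),
     (IfM False, (1,Outer), (6,Inner)), (IfM False, (5,Outer), (2,Inner))]"

fun open_tms :: "mode \<Rightarrow> orientation \<Rightarrow> template list" where
  "open_tms Incremental Directed = [(AtZero, (0,Sel0), (3,Outer)), (AtZero, (4,Outer), (0,Sel1)),
     (IfV True, (2,Inner), (4,Outer))]"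
| "open_tms Decremental Directed = [(AtZero, (0,Sel0), (4,Outer)), (AtZero, (3,Outer), (0,Sel1)),
     (IfV False, (2,Inner), (4,Outer)), (IfF True, (3,Outer), (1,Inner))]"
| "open_tms Incremental Undirected = [(IfV True, (2,Inner), (4,Outer))]"
| "open_tms Decremental Undirected = [(IfV False, (2,Inner), (4,Outer)), (Always, (3,Outer), (2,Inner)),
     (Always, (1,Inner), (4,Outer)), (IfF True, (3,Outer), (1,Inner))]"

text \<open>Incrementally, the neutralising edges are added. Decrementally, the terminal edges of
  the pair or, in the undirected case, its last unit edges disappear; without unit edges it is
  trivially balanced.\<close>

fun close_tms :: "mode \<Rightarrow> orientation \<Rightarrow> template list" where
  "close_tms Incremental Directed = [(AtZero, (0,Sel0), (4,Outer)), (AtZero, (3,Outer), (0,Sel1))]"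
| "close_tms Decremental Directed = [(AtZero, (0,Sel0), (3,Outer)), (AtZero, (4,Outer), (0,Sel1))]"
| "close_tms Incremental Undirected = [(IfF False, (1,Inner), (4,Outer)), (IfV True, (3,Outer), (2,Inner))]"
| "close_tms Decremental Undirected = [(IfV True, (2,Inner), (4,Outer))]"

lemma pairs_mem: "e \<in> set (pairs M V D tms o' x) \<longleftrightarrow>
    (\<exists>(c, u, v) \<in> set tms. cnd_holds M V D o' x c \<and> e = (port_node o' x u, port_node o' x v))"
  unfolding pairs_def split_def by auto

lemma script_mem: "e \<in> set (script M V D tms o' q) \<longleftrightarrow>
    (\<exists>x<q. \<exists>(c, u, v) \<in> set tms. cnd_holds M V D o' x c \<and> e = (port_node o' x u, port_node o' x v))"
  unfolding script_def by (simp add: pairs_mem Bex_def)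

section \<open>The edges toggled by a round: freshness and detection\<close>

definition edges :: "orientation \<Rightarrow> nat \<Rightarrow> (node \<times> node) set" where
  "edges d q = (if d = Directed then directed_edges q else undirected_edges q)"

definition row_pairs :: "nat \<Rightarrow> nat set \<Rightarrow> (node \<times> node) set" where
  "row_pairs r X = (\<lambda>i. ((3,r),(1,i))) ` X"

definition init_script where
  "init_script md d M q = concat (map (\<lambda>o'. script M (\<lambda>_. False) (\<lambda>_. False) (init_tms md d) o' q) [0..<q])"

definition open_script where
  "open_script md d V D r q = script (\<lambda>_ _. False) V D (open_tms md d) r q"

definition close_script where
  "close_script md d V D r q = script (\<lambda>_ _. False) V D (close_tms md d) r q"

definition round_pairs where
  "round_pairs md d V D r q = set (open_script md d V D r q) \<union> row_pairs r {i. i < q \<and> \<not> D i} \<union>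
     set (close_script md d V D r q)"

text \<open>The pairs toggled once the rounds \<open>{r..<q}\<close> are closed; rounds are used in decreasing order.\<close>

definition closed_from where
  "closed_from md d M q r tg \<longleftrightarrow> (\<exists>V D. tg = set (init_script md d M q) \<union>
     (\<Union>k\<in>{r..<q}. round_pairs md d (V k) (D k) k q))"

text \<open>The toggled set grows in both modes; stating everything in terms of it lets them share
  their proofs.\<close>

definition current_edges where
  "current_edges md d q tg = (if md = Incremental then tg else edges d q - tg)"

text \<open>What it takes to issue the pairs of the list one after the other as legal
  requests.\<close>

definition fresh where
  "fresh d q ps tg \<longleftrightarrow> distinct ps \<and> set ps \<inter> tg = {} \<and> set ps \<subseteq> edges d q"

lemma fresh_append: "fresh d q (ps @ qs) tg \<longleftrightarrow> fresh d q ps tg \<and> fresh d q qs (tg \<union> set ps)"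
  by (auto simp: fresh_def)

lemma edges_directed_intros [simp]:
  "i < q \<Longrightarrow> j < q \<Longrightarrow> ((1,i),(2,j)) \<in> edges d q"
  "i < q \<Longrightarrow> j < q \<Longrightarrow> ((3,i),(1,j)) \<in> edges d q"
  "i < q \<Longrightarrow> j < q \<Longrightarrow> ((2,i),(4,j)) \<in> edges d q"
  "i < q \<Longrightarrow> ((0,0),(3,i)) \<in> edges d q"
  "i < q \<Longrightarrow> ((4,i),(0,1)) \<in> edges d q"
  "i < q \<Longrightarrow> ((0,0),(4,i)) \<in> edges Directed q"
  "i < q \<Longrightarrow> ((3,i),(0,1)) \<in> edges Directed q"
  "i < q \<Longrightarrow> j < q \<Longrightarrow> ((1,i),(6,j)) \<in> edges Undirected q"
  "i < q \<Longrightarrow> j < q \<Longrightarrow> ((5,i),(2,j)) \<in> edges Undirected q"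
  "i < q \<Longrightarrow> j < q \<Longrightarrow> ((1,i),(4,j)) \<in> edges Undirected q"
  "i < q \<Longrightarrow> j < q \<Longrightarrow> ((3,i),(2,j)) \<in> edges Undirected q"
  "i < q \<Longrightarrow> ((0,0),(5,i)) \<in> edges Undirected q"
  "i < q \<Longrightarrow> ((6,i),(0,1)) \<in> edges Undirected q"
  unfolding edges_def directed_edges_def undirected_edges_def
  by (simp_all add: directed_edge.intros undirected_edge.intros del: One_nat_def)

text \<open>Edges are stored in one orientation and join different classes. This excludes loops and
  makes an undirected update concern a single stored pair.\<close>

lemma edges_nodes:
  assumes "(x, y) \<in> edges d q" "q \<ge> 2"
  shows "valid_node q x \<and> valid_node q y \<and> fst x \<noteq> fst y \<and> (y, x) \<notin> edges d q"
proof (cases d)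
  case Directed
  then have "directed_edge q x y" using assms by (simp add: edges_def directed_edges_def)
  then show ?thesis using \<open>q \<ge> 2\<close> Directed
    by cases (simp_all add: valid_node_def edges_def directed_edges_def directed_edge.simps)
next
  case Undirected
  then have "undirected_edge q x y" using assms by (simp add: edges_def undirected_edges_def)
  then show ?thesis using \<open>q \<ge> 2\<close> Undirected
    by cases (simp_all add: valid_node_def edges_def undirected_edges_def undirected_edge.simps)
qed

lemma distinct_concat_upt:
  assumes "\<And>x. x < n \<Longrightarrow> distinct (f x)"
    and "\<And>x y. x < n \<Longrightarrow> y < n \<Longrightarrow> x \<noteq> y \<Longrightarrow> set (f x) \<inter> set (f y) = {}"
  shows "distinct (concat (map f [0..<n]))"
proof -
  have "distinct (concat (map f [0..<k]))" if "k \<le> n" for k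
    using that
  proof (induction k)
    case (Suc k)
    have "set (f x) \<inter> set (f k) = {}" if "x < k" for x
      using assms(2)[of x k] Suc.prems that by auto
    then have "(\<Union>x\<in>{0..<k}. set (f x)) \<inter> set (f k) = {}" by (fastforce simp: disjoint_iff)
    then show ?case using Suc assms(1)[of k] by simp
  qed simp
  then show ?thesis by simp
qed

lemmas distinct_script = distinct_concat_upt[of q "pairs M V D tms o'" for q M V D tms o', folded script_def]

lemma open_mem:
  "(e :: node \<times> node) \<in> set (open_script md d V D r q) \<longleftrightarrow>
     (\<exists>x<q. \<exists>(c, u, v) \<in> set (open_tms md d). cnd_holds (\<lambda>_ _. False) V D r x c \<and> e = (port_node r x u, port_node r x v))"
  by (simp add: open_script_def script_mem)

lemma close_mem:
  "(e :: node \<times> node) \<in> set (close_script md d V D r q) \<longleftrightarrow>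
     (\<exists>x<q. \<exists>(c, u, v) \<in> set (close_tms md d). cnd_holds (\<lambda>_ _. False) V D r x c \<and> e = (port_node r x u, port_node r x v))"
  by (simp add: close_script_def script_mem)

lemma init_mem:
  "(e :: node \<times> node) \<in> set (init_script md d M q) \<longleftrightarrow>
     (\<exists>o'<q. \<exists>x<q. \<exists>(c, u, v) \<in> set (init_tms md d). cnd_holds M (\<lambda>_. False) (\<lambda>_. False) o' x c \<and>
        e = (port_node o' x u, port_node o' x v))"
  by (simp add: init_script_def script_mem Bex_def)

lemma fresh_init: "q \<ge> 2 \<Longrightarrow> fresh d q (init_script md d M q) {}"
  unfolding fresh_def
proof (intro conjI)
  show "distinct (init_script md d M q)" unfolding init_script_def
    by (intro distinct_concat_upt distinct_script; cases md; cases d)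
       (auto simp: pairs_def disjoint_iff script_mem)
  show "q \<ge> 2 \<Longrightarrow> set (init_script md d M q) \<subseteq> edges d q"
    by (cases md; cases d) (auto simp: init_mem simp del: One_nat_def)
qed auto

lemma closed_from_init: "closed_from md d M q q (set (init_script md d M q))"
  by (auto simp: closed_from_def)

text \<open>No edge joins two hubs, so incidence with \<open>F r\<close> or \<open>E r\<close>
  assigns an edge to at most one round.\<close>

definition round_node :: "nat \<Rightarrow> node \<times> node \<Rightarrow> bool" where
  "round_node r e \<longleftrightarrow> fst e = (3,r) \<or> fst e = (4,r) \<or> snd e = (3,r) \<or> snd e = (4,r)"

lemma round_pairs_node: "e \<in> round_pairs md d V D r q \<Longrightarrow> round_node r e"
  by (cases md; cases d) (auto simp: round_pairs_def open_mem close_mem row_pairs_def round_node_def)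

lemma round_node_unique:
  "(x, y) \<in> edges d q \<Longrightarrow> round_node r (x, y) \<Longrightarrow> round_node k (x, y) \<Longrightarrow> r = k"
  unfolding edges_def directed_edges_def undirected_edges_def round_node_def
  by (auto split: if_splits simp: directed_edge.simps undirected_edge.simps)

lemma init_round_node:
  "e \<in> set (init_script md d M q) \<Longrightarrow> round_node r e \<Longrightarrow>
     md = Incremental \<and> d = Undirected \<and> (e = ((0,0),(3,r)) \<or> e = ((4,r),(0,1)))"
  by (cases md; cases d) (auto simp: init_mem round_node_def)

text \<open>Different rounds are separated by their hubs; the three stages of one round toggle edges
  of different kinds or under opposite conditions.\<close>

lemma fresh_round:
  assumes "q \<ge> 2" "r < q" "closed_from md d M q (Suc r) tg" "distinct rows" "set rows = {i. i < q \<and> \<not> D i}"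
  shows "fresh d q (open_script md d V D r q @ map (\<lambda>i. ((3,r),(1,i))) rows @ close_script md d V D r q) tg"
    and "closed_from md d M q r (tg \<union> round_pairs md d V D r q)"
proof -
  let ?ps = "open_script md d V D r q @ map (\<lambda>i. ((3,r),(1,i))) rows @ close_script md d V D r q"
  obtain V' D' where tg: "tg = set (init_script md d M q) \<union>
     (\<Union>k\<in>{Suc r..<q}. round_pairs md d (V' k) (D' k) k q)"
    using assms(3) by (auto simp: closed_from_def)
  have set_ps: "set ?ps = round_pairs md d V D r q"
    using assms(5) by (auto simp: round_pairs_def row_pairs_def)
  have sub: "set ?ps \<subseteq> edges d q"
    unfolding set_ps using assms(1,2)
    by (cases md; cases d) (auto simp: round_pairs_def open_mem close_mem row_pairs_def simp del: One_nat_def)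
  have dist: "distinct (open_script md d V D r q)" "distinct (close_script md d V D r q)"
    unfolding open_script_def close_script_def
    by (intro distinct_script; cases md; cases d; auto simp: pairs_def disjoint_iff)+
  have "inj (\<lambda>i. ((3,r),(1,i)) :: node \<times> node)" by (auto simp: inj_def)
  then have "distinct (map (\<lambda>i. ((3,r),(1,i)) :: node \<times> node) rows)"
    using assms(4) by (simp add: distinct_map inj_on_def)
  moreover have "set (open_script md d V D r q) \<inter> set (close_script md d V D r q) = {}"
    "set (open_script md d V D r q) \<inter> row_pairs r {i. i < q \<and> \<not> D i} = {}"
    "row_pairs r {i. i < q \<and> \<not> D i} \<inter> set (close_script md d V D r q) = {}"
    by (cases md; cases d; auto simp: open_mem close_mem row_pairs_def)+
  ultimately have "distinct ?ps"
    using dist assms(5) by (auto simp: row_pairs_def)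
  moreover have "round_pairs md d V D r q \<inter> tg = {}"
  proof -
    have "e \<notin> tg" if e: "e \<in> round_pairs md d V D r q" for e
    proof
      assume "e \<in> tg"
      then consider "e \<in> set (init_script md d M q)" | k where "Suc r \<le> k" "e \<in> round_pairs md d (V' k) (D' k) k q"
        unfolding tg using Suc_le_lessD by auto
      then show False
      proof cases
        case 1
        \<comment> \<open>The initial script meets hubs only in terminal edges, and only in the
          incremental undirected case, where a round toggles no terminal edge.\<close>
        then show False using init_round_node[OF 1 round_pairs_node[OF e]] e
          by (auto simp: round_pairs_def open_mem close_mem row_pairs_def)
      next
        case 2
        have "(fst e, snd e) \<in> edges d q" using sub e unfolding set_ps by auto
        then have "r = k"
          using round_node_unique[of "fst e" "snd e" d q r k] round_pairs_node[OF e]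
            round_pairs_node[OF 2(2)] by simp
        then show False using 2(1) by simp
      qed
    qed
    then show ?thesis by auto
  qed
  ultimately show "fresh d q ?ps tg" using sub unfolding fresh_def set_ps by blast
  have "{r..<q} = insert r {Suc r..<q}" using assms(2) by auto
  then show "closed_from md d M q r (tg \<union> round_pairs md d V D r q)"
    unfolding closed_from_def tg
    by (intro exI[of _ "V'(r := V)"] exI[of _ "D'(r := D)"]) auto
qed

text \<open>The threshold \<open>K\<close> is chosen before \<open>X\<close>: it stays the same
  throughout a scan, which makes consecutive answers comparable.\<close>

lemma round_detects:
  fixes M :: "nat \<Rightarrow> nat \<Rightarrow> bool" and V D :: "nat \<Rightarrow> bool"
  assumes "q \<ge> 2" "r < q" "closed_from md d M q (Suc r) tg" "tg \<subseteq> edges d q"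
  defines "U \<equiv> {i. i < q \<and> \<not> D i}"
  obtains K :: real where "\<And>X y. X \<subseteq> U \<Longrightarrow>
    is_max q (edge_graph d q (current_edges md d q (tg \<union> set (open_script md d V D r q) \<union> row_pairs r X))) y \<Longrightarrow>
    (if \<exists>i \<in> (if md = Incremental then X else U - X). \<exists>j<q. M i j \<and> V j then real y > K else real y = K)"
proof -
  define tg' where "tg' = (\<lambda>X. tg \<union> set (open_script md d V D r q) \<union> row_pairs r X)"
  define E where "E = (\<lambda>X. current_edges md d q (tg' X))"
  obtain V' D' where tg: "tg = set (init_script md d M q) \<union>
     (\<Union>k\<in>{Suc r..<q}. round_pairs md d (V' k) (D' k) k q)"
    using assms(3) by (auto simp: closed_from_def)
  have sub: "tg' X \<subseteq> edges d q" if "X \<subseteq> U" for X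
  proof -
    obtain rows where rows: "distinct rows" "set rows = U"
      using finite_distinct_list[of U] by (auto simp: U_def)
    have "round_pairs md d V D r q \<subseteq> edges d q"
      using fresh_round[OF assms(1-3) rows(1), of D V] rows(2)
      by (auto simp: fresh_def round_pairs_def row_pairs_def U_def)
    moreover have "row_pairs r X \<subseteq> row_pairs r U" using that by (auto simp: row_pairs_def)
    ultimately show ?thesis
      using assms(4) unfolding tg'_def round_pairs_def U_def by blast
  qed
  have Esub: "E X \<subseteq> edges d q" if "X \<subseteq> U" for X
    using sub[OF that] by (auto simp: E_def current_edges_def)
  have mem: "e \<in> tg' X \<longleftrightarrow> e \<in> set (init_script md d M q) \<or>
     (\<exists>k\<in>{Suc r..<q}. e \<in> round_pairs md d (V' k) (D' k) k q) \<or> e \<in> set (open_script md d V D r q) \<or>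
     e \<in> row_pairs r X" for e X
    by (auto simp: tg'_def tg)
  have Emem: "e \<in> edges d q \<Longrightarrow> e \<in> E X \<longleftrightarrow> (if md = Incremental then e \<in> tg' X else e \<notin> tg' X)" for e X
    using sub by (auto simp: E_def current_edges_def)
  have hit: "hit q (E X) r \<longleftrightarrow> (\<exists>i \<in> (if md = Incremental then X else U - X). \<exists>j<q. M i j \<and> V j)"
    if "X \<subseteq> U" for X
  proof -
    have 1: "((3,r),(1,i)) \<in> E X \<longleftrightarrow> i \<in> (if md = Incremental then X else U - X)" if "i < q" for i
      using that assms(2) \<open>X \<subseteq> U\<close>
      by (subst Emem; cases md; cases d)
        (auto simp: mem init_mem round_pairs_def open_mem close_mem row_pairs_def U_def simp del: One_nat_def)
    have 2: "((2,j),(4,r)) \<in> E X \<longleftrightarrow> V j" if "j < q" for j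
      using that assms(2)
      by (subst Emem; cases md; cases d)
        (auto simp: mem init_mem round_pairs_def open_mem close_mem row_pairs_def simp del: One_nat_def)
    have 3: "((1,i),(2,j)) \<in> E X \<longleftrightarrow> M i j" if "i < q" "j < q" for i j
      using that
      by (subst Emem; cases md; cases d)
        (auto simp: mem init_mem round_pairs_def open_mem close_mem row_pairs_def simp del: One_nat_def)
    have "hit q (E X) r \<longleftrightarrow> (\<exists>i<q. i \<in> (if md = Incremental then X else U - X) \<and> (\<exists>j<q. M i j \<and> V j))"
      unfolding hit_def using 1 2 3 by blast
    moreover have "i < q" if "i \<in> (if md = Incremental then X else U - X)" for i
      using that \<open>X \<subseteq> U\<close> by (auto simp: U_def split: if_splits)
    ultimately show ?thesis by blast
  qed
  show thesis
  proof (cases d)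
    case Directed
    define K where "K = (if md = Incremental then {Suc r..<q} else {..<r})"
    show thesis
    proof (rule that)
      fix X y assume X: "X \<subseteq> U"
        "is_max q (edge_graph d q (current_edges md d q (tg \<union> set (open_script md d V D r q) \<union> row_pairs r X))) y"
      have "if hit q (E X) r then real y > 2 * real (card K) else real y = 2 * real (card K)"
      proof (rule directed_gadget[OF assms(1,2)])
        show "E X \<subseteq> directed_edges q" using Esub[OF X(1)] Directed by (simp add: edges_def)
        show "K \<subseteq> {..<q} - {r}" using assms(2) by (auto simp: K_def)
        show "is_max q (edge_graph Directed q (E X)) y" using X(2) Directed by (simp add: E_def tg'_def)
        show "((0,0),(3,k)) \<in> E X \<and> ((4,k),(0,1)) \<in> E X \<and> ((0,0),(4,k)) \<in> E X \<and> ((3,k),(0,1)) \<in> E X"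
          if "k \<in> K" for k
          using that assms(1,2)
          by (cases md) (auto simp: Emem Directed mem init_mem round_pairs_def open_mem close_mem row_pairs_def K_def
              simp del: One_nat_def)
        show "((0,0),(3,k)) \<notin> E X \<and> ((4,k),(0,1)) \<notin> E X" if "k < q" "k \<noteq> r" "k \<notin> K" for k
          using that assms(1,2)
          by (cases md) (auto simp: Emem Directed mem init_mem round_pairs_def open_mem close_mem row_pairs_def K_def
              simp del: One_nat_def)
        show "((0,0),(3,r)) \<in> E X" "((4,r),(0,1)) \<in> E X" "((0,0),(4,r)) \<notin> E X" "((3,r),(0,1)) \<notin> E X"
          using assms(1,2)
          by (cases md; auto simp: Emem Directed mem init_mem round_pairs_def open_mem close_mem row_pairs_def
              simp del: One_nat_def)+
      qed
      then show "if \<exists>i \<in> (if md = Incremental then X else U - X). \<exists>j<q. M i j \<and> V j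
          then real y > 2 * real (card K) else real y = 2 * real (card K)"
        using hit[OF X(1)] by simp
    qed
  next
    case Undirected
    define K where "K = (\<lambda>F :: (node \<times> node) set. (\<Sum>i<q. \<Sum>j<q. of_bool (((1,i),(2,j)) \<in> F) :: real) +
      (\<Sum>k<q. (\<Sum>i<q. of_bool (k \<noteq> r \<and> ((3,k),(1,i)) \<in> F)) + (\<Sum>j<q. of_bool (k \<noteq> r \<and> ((2,j),(4,k)) \<in> F))))"
    show thesis
    proof (rule that)
      fix X y assume X: "X \<subseteq> U"
        "is_max q (edge_graph d q (current_edges md d q (tg \<union> set (open_script md d V D r q) \<union> row_pairs r X))) y"
      \<comment> \<open>The row edges toggled in a scan are all at \<open>F r\<close>, which
        \<open>K\<close> leaves out.\<close>
      have "K (E X) = K (E {})"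
      proof -
        have "((1,i),(2,j)) \<in> E X \<longleftrightarrow> ((1,i),(2,j)) \<in> E {}"
          "k \<noteq> r \<Longrightarrow> ((3,k),(1,i)) \<in> E X \<longleftrightarrow> ((3,k),(1,i)) \<in> E {}"
          "((2,j),(4,k)) \<in> E X \<longleftrightarrow> ((2,j),(4,k)) \<in> E {}" for i j k
          by (auto simp: E_def tg'_def current_edges_def row_pairs_def)
        then show ?thesis by (simp add: K_def cong: conj_cong)
      qed
      moreover have "if hit q (E X) r then real y > K (E X) else real y = K (E X)"
        unfolding K_def
      proof (rule undirected_gadget[OF assms(1,2)])
        show "E X \<subseteq> undirected_edges q" using Esub[OF X(1)] Undirected by (simp add: edges_def)
        show "is_max q (edge_graph Undirected q (E X)) y" using X(2) Undirected by (simp add: E_def tg'_def)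
        show "(((1,i),(6,j)) \<in> E X \<longleftrightarrow> ((1,i),(2,j)) \<in> E X) \<and> (((5,i),(2,j)) \<in> E X \<longleftrightarrow> ((1,i),(2,j)) \<in> E X)"
          if "i < q" "j < q" for i j
          using that
          by (cases md) (auto simp: Emem Undirected mem init_mem round_pairs_def open_mem close_mem row_pairs_def
              simp del: One_nat_def)
        show "((0,0),(3,k)) \<in> E X \<and> ((4,k),(0,1)) \<in> E X \<and> ((0,0),(5,k)) \<in> E X \<and> ((6,k),(0,1)) \<in> E X"
          if "k < q" for k
          using that assms(1)
          by (cases md) (auto simp: Emem Undirected mem init_mem round_pairs_def open_mem close_mem row_pairs_def
              simp del: One_nat_def)
        show "(((1,i),(4,k)) \<in> E X \<longleftrightarrow> ((3,k),(1,i)) \<in> E X) \<and> (((3,k),(2,i)) \<in> E X \<longleftrightarrow> ((2,i),(4,k)) \<in> E X)"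
          if "k < q" "k \<noteq> r" "i < q" for k i
          using that assms(2)
          by (cases md) (auto simp: Emem Undirected mem init_mem round_pairs_def open_mem close_mem row_pairs_def
              simp del: One_nat_def)
        show "((1,i),(4,r)) \<notin> E X \<and> ((3,r),(2,i)) \<notin> E X" for i
        proof (cases "i < q")
          case True
          then show ?thesis using assms(2)
            by (cases md) (auto simp: Emem Undirected mem init_mem round_pairs_def open_mem close_mem row_pairs_def
              simp del: One_nat_def)
        next
          case False
          then show ?thesis using Esub[OF X(1)] edges_nodes[OF _ assms(1)] by (auto simp: valid_node_def)
        qed
      qed
      ultimately have "if hit q (E X) r then real y > K (E {}) else real y = K (E {})"
        by (simp split: if_splits)
      then show "if \<exists>i \<in> (if md = Incremental then X else U - X). \<exists>j<q. M i j \<and> V j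
          then real y > K (E {}) else real y = K (E {})"
        unfolding hit[OF X(1)] .
    qed
  qed
qed

section \<open>Executions\<close>

inductive_cases exec_Skip: "exec B Skip s t s'"
inductive_cases exec_Assign: "exec B (Assign a e) s t s'"
inductive_cases exec_Read: "exec B (Read a) s t s'"
inductive_cases exec_Write: "exec B (Write e) s t s'"
inductive_cases exec_Seq: "exec B (Seq p q) s t s'"
inductive_cases exec_Cond: "exec B (Cond e p q) (m, xs, ys) t s'"
inductive_cases exec_While: "exec B (While e p) (m, xs, ys) t s'"

text \<open>Determinism turns the existence of a session into a fact about the state that is
  actually reached.\<close>

lemma exec_det: "exec B p s t s' \<Longrightarrow> exec B p s u s'' \<Longrightarrow> u = t \<and> s'' = s'"
proof (induction arbitrary: u s'' rule: exec.induct)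
  case (Skip s)
  then show ?case by (elim exec_Skip) simp
next
  case (Assign m a e xs ys)
  from Assign.prems show ?case by (elim exec_Assign) simp
next
  case (Read m a x xs ys)
  from Read.prems show ?case by (elim exec_Read) simp
next
  case (Write m e xs ys)
  from Write.prems show ?case by (elim exec_Write) simp
next
  case (Seq p s t s' q t' s3)
  from Seq.prems obtain t1 s1 t2 where *: "exec B p s t1 s1" "exec B q s1 t2 s''" "u = t1 + t2"
    by (elim exec_Seq)
  from Seq.IH(1)[OF *(1)] have "t1 = t" "s1 = s'" by auto
  with Seq.IH(2) *(2,3) show ?case by auto
next
  case (CondTrue m e p xs ys t s' q)
  from CondTrue.prems obtain t1 where "exec B p (m, xs, ys) t1 s''" "u = 1 + acost e + t1"
    by (elim exec_Cond) (use CondTrue.hyps in auto)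
  with CondTrue.IH show ?case by auto
next
  case (CondFalse m e q xs ys t s' p)
  from CondFalse.prems obtain t1 where "exec B q (m, xs, ys) t1 s''" "u = 1 + acost e + t1"
    by (elim exec_Cond) (use CondFalse.hyps in auto)
  with CondFalse.IH show ?case by auto
next
  case (WhileTrue m e p xs ys t s' t' s3)
  from WhileTrue.prems obtain t1 s1 t2 where *: "exec B p (m, xs, ys) t1 s1"
    "exec B (While e p) s1 t2 s''" "u = 1 + acost e + t1 + t2"
    by (elim exec_While) (use WhileTrue.hyps in auto)
  from WhileTrue.IH(1)[OF *(1)] have "t1 = t" "s1 = s'" by auto
  with WhileTrue.IH(2) *(2,3) show ?case by auto
next
  case (WhileFalse m e p xs ys)
  from WhileFalse.prems show ?case by (elim exec_While) (use WhileFalse.hyps in auto)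
qed

text \<open>\<open>session\<close> hides the memory in which it ends; here it is exposed, because an
  instance is continued request by request.\<close>

inductive run ::
    "nat \<Rightarrow> com \<Rightarrow> memory \<Rightarrow> nat list list \<Rightarrow> nat list list \<Rightarrow> nat \<Rightarrow> memory \<Rightarrow> bool" for B p where
  Nil: "run B p m [] [] 0 m"
| Cons: "exec B p (m, xs, []) t (m', xs', ys) \<Longrightarrow> run B p m' xss yss t' m'' \<Longrightarrow>
    run B p m (xs # xss) (ys # yss) (t + t') m''"

inductive_cases run_Nil: "run B p m [] yss t m'"
inductive_cases run_Cons: "run B p m (xs # xss) yss t m'"

lemma session_run: "session B p m xss yss t \<Longrightarrow> \<exists>m'. run B p m xss yss t m'"
  by (induction rule: session.induct) (blast intro: run.intros)+

lemma run_det: "run B p m xss yss t m' \<Longrightarrow> run B p m xss yss' u m'' \<Longrightarrow> yss' = yss \<and> u = t \<and> m'' = m'"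
proof (induction arbitrary: yss' u m'' rule: run.induct)
  case (Cons m xs t m' xs' ys xss yss t' m3)
  from Cons.prems obtain t1 m1 xs1 ys1 yss1 t2 where *: "exec B p (m, xs, []) t1 (m1, xs1, ys1)"
    "run B p m1 xss yss1 t2 m''" "yss' = ys1 # yss1" "u = t1 + t2"
    by (rule run_Cons) blast
  have "t1 = t \<and> (m1, xs1, ys1) = (m', xs', ys)" using exec_det[OF Cons.hyps(1) *(1)] .
  then show ?case using Cons.IH *(2-4) by auto
qed (auto elim: run_Nil)

lemma run_appendD:
  "run B p m (xss @ zss) yss t m'' \<Longrightarrow>
     \<exists>ys1 ys2 t1 t2 m'. run B p m xss ys1 t1 m' \<and> run B p m' zss ys2 t2 m'' \<and> yss = ys1 @ ys2 \<and> t = t1 + t2"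
proof (induction xss arbitrary: m yss t)
  case Nil
  then show ?case using run.Nil by fastforce
next
  case (Cons xs xss)
  then obtain t1 m1 xs1 ys1 yss1 t2 where *: "exec B p (m, xs, []) t1 (m1, xs1, ys1)"
    "run B p m1 (xss @ zss) yss1 t2 m''" "yss = ys1 # yss1" "t = t1 + t2"
    by (auto elim: run_Cons)
  from Cons.IH[OF *(2)] obtain a b c' d' m' where
    "run B p m1 xss a c' m'" "run B p m' zss b d' m''" "yss1 = a @ b" "t2 = c' + d'" by blast
  then show ?case using run.Cons[OF *(1)] *(3,4)
    by (metis add.assoc append_Cons)
qed

lemma run_snocD:
  assumes "run B p m (xss @ [xs]) yss t m''"
  obtains ys1 ys t1 t2 m' xs' where "run B p m xss ys1 t1 m'" "exec B p (m', xs, []) t2 (m'', xs', ys)"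
    "yss = ys1 @ [ys]" "t = t1 + t2"
proof -
  from run_appendD[OF assms] obtain ys1 ys2 t1 t2 m' where
    *: "run B p m xss ys1 t1 m'" "run B p m' [xs] ys2 t2 m''" "yss = ys1 @ ys2" "t = t1 + t2" by blast
  from *(2) show thesis
    by (rule run_Cons) (use * that in \<open>auto elim!: run_Nil\<close>)
qed

lemma correct_answers_snoc:
  "correct_answers d n s t g (rs @ [r]) (outs @ [ys]) \<Longrightarrow> length rs = length outs \<Longrightarrow>
     r = Query \<Longrightarrow> \<exists>y. ys = [y] \<and> is_max_flow_value n (fold (update d) rs g) s t (real y)"
  by (induction rs outs arbitrary: g rule: list_induct2') auto

lemma run_length: "run B p m xss yss t m' \<Longrightarrow> length yss = length xss"
  by (induction rule: run.induct) auto

section \<open>Request histories\<close>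

lemma legal_snoc:
  "legal md d n W g (rs @ [r]) \<longleftrightarrow> legal md d n W g rs \<and> legal_request md n W (fold (update d) rs g) r"
  by (induction rs arbitrary: g) auto

abbreviation node_graph :: "orientation \<Rightarrow> nat \<Rightarrow> (node \<times> node) set \<Rightarrow> graph" where
  "node_graph d q E \<equiv> \<lambda>u v. edge_graph d q E (dec q u) (dec q v)"

lemma enc_eq: "valid_node q x \<Longrightarrow> u = enc q x \<longleftrightarrow> dec q u = x"
  by (cases x) (auto simp: valid_node_def)

lemma dec_enc [simp]: "valid_node q x \<Longrightarrow> dec q (enc q x) = x"
  using enc_eq by blast

lemma enc_less: "valid_node q x \<Longrightarrow> enc q x < 7 * q"
proof -
  assume "valid_node q x"
  then have "fst x \<le> 6" "snd x < q" by (auto simp: valid_node_def)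
  then have "fst x * q \<le> 6 * q" "snd x < q" by auto
  then show ?thesis by linarith
qed

definition toggle :: "mode \<Rightarrow> orientation \<Rightarrow> nat \<Rightarrow> node \<times> node \<Rightarrow> request" where
  "toggle md d q e = (case e of (x, y) \<Rightarrow>
     if md = Incremental then Insert (enc q x) (enc q y) (edge_cap d q x y) else Delete (enc q x) (enc q y))"

lemma edge_graph_insert: "(y, x) \<notin> E \<Longrightarrow>
    edge_graph d q (insert (x, y) E) a b =
      (if (a = x \<and> b = y) \<or> (d = Undirected \<and> a = y \<and> b = x) then edge_cap d q x y else edge_graph d q E a b)"
  by (auto simp: edge_graph_def edge_cap_def)

lemma edge_graph_remove: "(y, x) \<notin> E \<Longrightarrow>
    edge_graph d q (E - {(x, y)}) a b =
      (if (a = x \<and> b = y) \<or> (d = Undirected \<and> a = y \<and> b = x) then 0 else edge_graph d q E a b)"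
  by (auto simp: edge_graph_def)

lemma insert_edge:
  assumes "(x, y) \<in> edges d q" "(x, y) \<notin> E" "E \<subseteq> edges d q" "q \<ge> 2" "edge_cap d q x y \<le> W"
  shows "legal_request Incremental (7 * q) W (node_graph d q E) (Insert (enc q x) (enc q y) (edge_cap d q x y))"
    and "update d (Insert (enc q x) (enc q y) (edge_cap d q x y)) (node_graph d q E) = node_graph d q (insert (x, y) E)"
proof -
  note xy = edges_nodes[OF assms(1,4)]
  have vx: "valid_node q x" and vy: "valid_node q y" using xy by auto
  have "x \<noteq> y" using xy by auto
  then have "enc q x \<noteq> enc q y" using dec_enc[OF vx] dec_enc[OF vy] by metis
  moreover have yx: "(y, x) \<notin> E" using xy assms(3) by auto
  moreover have "edge_cap d q x y > 0" using assms(4) by (simp add: edge_cap_def)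
  ultimately show "legal_request Incremental (7 * q) W (node_graph d q E) (Insert (enc q x) (enc q y) (edge_cap d q x y))"
    unfolding legal_request.simps dec_enc[OF vx] dec_enc[OF vy]
    using assms enc_less[OF vx] enc_less[OF vy] by (simp add: edge_graph_def)
  show "update d (Insert (enc q x) (enc q y) (edge_cap d q x y)) (node_graph d q E) = node_graph d q (insert (x, y) E)"
    by (simp only: update.simps set_capacity_def enc_eq[OF vx] enc_eq[OF vy] edge_graph_insert[OF yx])
qed

lemma delete_edge:
  assumes "(x, y) \<in> E" "E \<subseteq> edges d q" "q \<ge> 2"
  shows "legal_request Decremental (7 * q) W (node_graph d q E) (Delete (enc q x) (enc q y))"
    and "update d (Delete (enc q x) (enc q y)) (node_graph d q E) = node_graph d q (E - {(x, y)})"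
proof -
  have e: "(x, y) \<in> edges d q" using assms by auto
  note xy = edges_nodes[OF e assms(3)]
  have vx: "valid_node q x" and vy: "valid_node q y" using xy by auto
  have "edge_cap d q x y > 0" using assms(3) by (simp add: edge_cap_def)
  then show "legal_request Decremental (7 * q) W (node_graph d q E) (Delete (enc q x) (enc q y))"
    unfolding legal_request.simps dec_enc[OF vx] dec_enc[OF vy]
    using assms enc_less[OF vx] enc_less[OF vy] by (simp add: edge_graph_def)
  have yx: "(y, x) \<notin> E" using xy assms(2) by auto
  show "update d (Delete (enc q x) (enc q y)) (node_graph d q E) = node_graph d q (E - {(x, y)})"
    by (simp only: update.simps set_capacity_def enc_eq[OF vx] enc_eq[OF vy] edge_graph_remove[OF yx])
qed

definition full_script :: "orientation \<Rightarrow> nat \<Rightarrow> (node \<times> node) list" where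
  "full_script d q = concat (map (\<lambda>o'. script (\<lambda>_ _. False) (\<lambda>_. False) (\<lambda>_. False) (full_tms d) o' q) [0..<q])"

lemma full_mem:
  "(e :: node \<times> node) \<in> set (full_script d q) \<longleftrightarrow>
     (\<exists>o'<q. \<exists>x<q. \<exists>(c, u, v) \<in> set (full_tms d). cnd_holds (\<lambda>_ _. False) (\<lambda>_. False) (\<lambda>_. False) o' x c \<and>
        e = (port_node o' x u, port_node o' x v))"
  by (simp add: full_script_def script_mem Bex_def)

lemma set_full_script:
  assumes "q \<ge> 2"
  shows "set (full_script d q) = edges d q"
proof
  show "set (full_script d q) \<subseteq> edges d q"
    using assms by (cases d) (auto simp: full_mem simp del: One_nat_def)
  show "edges d q \<subseteq> set (full_script d q)"
  proof
    fix e assume e: "e \<in> edges d q"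
    obtain x y where xy: "e = (x, y)" by (cases e) blast
    show "e \<in> set (full_script d q)"
    proof (cases d)
      case Directed
      then have "directed_edge q x y" using e xy by (simp add: edges_def directed_edges_def)
      then show ?thesis using assms unfolding xy Directed full_mem by cases (auto simp del: One_nat_def)
    next
      case Undirected
      then have "undirected_edge q x y" using e xy by (simp add: edges_def undirected_edges_def)
      then show ?thesis using assms unfolding xy Undirected full_mem by cases (auto simp del: One_nat_def)
    qed
  qed
qed

lemma distinct_full_script: "distinct (full_script d q)"
  unfolding full_script_def
  by (intro distinct_concat_upt distinct_script; cases d)
     (auto simp: pairs_def disjoint_iff script_mem)

definition initial_edges :: "mode \<Rightarrow> orientation \<Rightarrow> nat \<Rightarrow> (nat \<times> nat \<times> nat) list" where
  "initial_edges md d q = (if md = Incremental then []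
     else map (\<lambda>(x, y). (enc q x, enc q y, edge_cap d q x y)) (full_script d q))"

lemma legal_insertions:
  assumes q: "q \<ge> 2" and W: "\<And>x y. edge_cap d q x y \<le> W"
    and "E \<subseteq> edges d q" "distinct ps" "set ps \<inter> E = {}" "set ps \<subseteq> edges d q"
  defines "rs \<equiv> insertions (map (\<lambda>(x, y). (enc q x, enc q y, edge_cap d q x y)) ps)"
  shows "legal Incremental d (7 * q) W (node_graph d q E) rs \<and>
    fold (update d) rs (node_graph d q E) = node_graph d q (E \<union> set ps)"
  using assms(3-6) unfolding rs_def
proof (induction ps arbitrary: E)
  case Nil
  then show ?case by (simp add: insertions_def)
next
  case (Cons e ps)
  obtain x y where e: "e = (x, y)" by (cases e) blast
  have *: "(x, y) \<in> edges d q" "(x, y) \<notin> E" using Cons.prems e by auto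
  have "insert (x, y) E \<subseteq> edges d q" "distinct ps" "set ps \<inter> insert (x, y) E = {}" "set ps \<subseteq> edges d q"
    using Cons.prems e by auto
  from Cons.IH[OF this] show ?case
    using insert_edge[OF * Cons.prems(1) q W] by (simp add: e insertions_def del: update.simps legal_request.simps)
qed

text \<open>A request list is abstracted to its effect: legality of further requests and the current
  graph depend on \<open>tg\<close> alone.\<close>

definition history where
  "history md d q W rs tg \<longleftrightarrow> tg \<subseteq> edges d q \<and>
     legal md d (7 * q) W (node_graph d q (current_edges md d q {})) rs \<and>
     fold (update d) rs (node_graph d q (current_edges md d q {})) = node_graph d q (current_edges md d q tg)"

lemma history_Nil: "history md d q W [] {}"
  by (simp add: history_def)

lemma history_Query: "history md d q W rs tg \<Longrightarrow> history md d q W (rs @ [Query]) tg"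
  by (simp add: history_def legal_snoc)

lemma history_toggle:
  assumes "history md d q W rs tg" "e \<in> edges d q" "e \<notin> tg" "q \<ge> 2" "\<And>x y. edge_cap d q x y \<le> W"
  shows "history md d q W (rs @ [toggle md d q e]) (insert e tg)"
proof -
  obtain x y where e: "e = (x, y)" by (cases e) blast
  have sub: "current_edges md d q tg \<subseteq> edges d q" using assms(1) by (auto simp: history_def current_edges_def)
  show ?thesis
  proof (cases md)
    case Incremental
    then show ?thesis
      using assms insert_edge[of x y d q tg W]
      by (simp add: history_def legal_snoc toggle_def e current_edges_def del: update.simps legal_request.simps)
  next
    case Decremental
    have "current_edges md d q (insert e tg) = current_edges md d q tg - {(x, y)}"
      using Decremental by (auto simp: current_edges_def e)
    then show ?thesis
      using assms sub delete_edge(1)[of x y "current_edges md d q tg" d q W]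
        delete_edge(2)[of x y "current_edges md d q tg" d q] Decremental
      by (auto simp: history_def legal_snoc toggle_def e current_edges_def simp del: update.simps legal_request.simps)
  qed
qed

text \<open>The hypothesis at one size, \<open>7 * q\<close> nodes, with the terminals and the
  initial graph of the construction. \<open>T\<close> is the number that the time bound takes at
  this size.\<close>

locale flow_algorithm =
  fixes md :: mode and d :: orientation and q W c :: nat and p :: com and T :: real
  assumes q2: "q \<ge> 2" and cap_le: "\<And>x y. edge_cap d q x y \<le> W"
    and algorithm: "\<And>rs. legal md d (7 * q) W
        (fold (update d) (insertions (initial_edges md d q)) empty_graph) rs \<Longrightarrow>
      \<exists>out0 outs \<tau>. session ((7 * q + 2) ^ c) p initial_memory
          (enc_init (7 * q) 0 1 (initial_edges md d q) # map enc_request rs) (out0 # outs) \<tau> \<and>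
        correct_answers d (7 * q) 0 1 (fold (update d) (insertions (initial_edges md d q)) empty_graph) rs outs \<and>
        real \<tau> \<le> real (7 * q + length (initial_edges md d q) + length rs) * T"
begin

abbreviation S where "S \<equiv> (7 * q + 2) ^ c"

abbreviation initial_request where
  "initial_request \<equiv> enc_init (7 * q) 0 1 (initial_edges md d q)"

abbreviation graph_of where
  "graph_of tg \<equiv> node_graph d q (current_edges md d q tg)"

abbreviation hist where "hist \<equiv> history md d q W"

lemma initial_graph:
  "legal Incremental d (7 * q) W empty_graph (insertions (initial_edges md d q))"
  "fold (update d) (insertions (initial_edges md d q)) empty_graph = graph_of {}"
proof -
  have empty: "empty_graph = node_graph d q {}" by (simp add: edge_graph_def)
  have "legal Incremental d (7 * q) W empty_graph (insertions (initial_edges md d q)) \<and>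
    fold (update d) (insertions (initial_edges md d q)) empty_graph = graph_of {}"
  proof (cases "md = Incremental")
    case True
    then show ?thesis unfolding empty by (simp add: initial_edges_def insertions_def current_edges_def)
  next
    case False
    then show ?thesis unfolding empty
      using legal_insertions[OF q2 cap_le, of "{}" "full_script d q"] set_full_script[OF q2, of d]
        distinct_full_script[of d q]
      by (simp add: initial_edges_def current_edges_def)
  qed
  then show "legal Incremental d (7 * q) W empty_graph (insertions (initial_edges md d q))"
    "fold (update d) (insertions (initial_edges md d q)) empty_graph = graph_of {}" by auto
qed

text \<open>By determinism, \<open>rs\<close> fixes both the memory and the time.\<close>

definition inst :: "request list \<Rightarrow> nat \<Rightarrow> memory \<Rightarrow> bool" where
  "inst rs \<tau> pm \<longleftrightarrow> (\<exists>outs. run S p initial_memory (initial_request # map enc_request rs) outs \<tau> pm)"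

lemma inst_exists:
  assumes "hist rs tg"
  obtains out0 outs \<tau> pm where
    "run S p initial_memory (initial_request # map enc_request rs) (out0 # outs) \<tau> pm"
    "correct_answers d (7 * q) 0 1 (graph_of {}) rs outs"
    "real \<tau> \<le> real (7 * q + length (initial_edges md d q) + length rs) * T"
proof -
  have "legal md d (7 * q) W (graph_of {}) rs" using assms by (simp add: history_def)
  then obtain out0 outs \<tau> where *: "session S p initial_memory
      (initial_request # map enc_request rs) (out0 # outs) \<tau>"
    "correct_answers d (7 * q) 0 1 (graph_of {}) rs outs"
    "real \<tau> \<le> real (7 * q + length (initial_edges md d q) + length rs) * T"
    using algorithm[of rs] unfolding initial_graph(2) by blast
  from session_run[OF *(1)] *(2,3) that show thesis by blast
qed

text \<open>The time bound is an arbitrary real function, but the session without requests is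
  bounded by a positive multiple of \<open>T\<close>.\<close>

lemma T_nonneg: "T \<ge> 0"
proof -
  obtain out0 outs pm and \<tau> :: nat
    where "real \<tau> \<le> real (7 * q + length (initial_edges md d q) + length ([] :: request list)) * T"
    by (rule inst_exists[OF history_Nil])
  then have "0 \<le> real (7 * q + length (initial_edges md d q)) * T"
    by (simp add: order.trans[OF of_nat_0_le_iff])
  moreover have "real (7 * q + length (initial_edges md d q)) > 0" using q2 by simp
  ultimately show ?thesis by (simp only: zero_le_mult_iff) linarith
qed

text \<open>The amortized bound is applied to the history as a whole, with its length replaced by an
  a priori bound \<open>L\<close>.\<close>

lemma inst_time:
  assumes "inst rs \<tau> pm" "hist rs tg" "length rs \<le> L"
  shows "real \<tau> \<le> real (7 * q + length (initial_edges md d q) + L) * T"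
proof -
  obtain out0 outs \<tau>' pm' where *: "run S p initial_memory (initial_request # map enc_request rs) (out0 # outs) \<tau>' pm'"
    "real \<tau>' \<le> real (7 * q + length (initial_edges md d q) + length rs) * T"
    by (rule inst_exists[OF assms(2)])
  have "\<tau>' = \<tau>" using assms(1) *(1) run_det unfolding inst_def by blast
  moreover have "real (7 * q + length (initial_edges md d q) + length rs) * T
      \<le> real (7 * q + length (initial_edges md d q) + L) * T"
    using assms(3) T_nonneg by (intro mult_right_mono) auto
  ultimately show ?thesis using *(2) by simp
qed

lemma inst_Nil:
  obtains t pm xs ys where "exec S p (initial_memory, initial_request, []) t (pm, xs, ys)" "inst [] t pm"
proof -
  obtain out0 outs \<tau> pm where *: "run S p initial_memory [initial_request] (out0 # outs) \<tau> pm"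
    by (rule inst_exists[OF history_Nil]) simp
  from * obtain t pm' xs ys where "exec S p (initial_memory, initial_request, []) t (pm', xs, ys)"
    by (elim run_Cons)
  moreover from this have "inst [] t pm'"
    unfolding inst_def using run.Cons[OF _ run.Nil] by fastforce
  ultimately show thesis using that by blast
qed

text \<open>The hypothesis yields a session for each fixed sequence, while \<open>r\<close> may
  depend on earlier answers. By determinism the session for \<open>rs @ [r]\<close> passes through
  the state reached after \<open>rs\<close>, so it continues the run at hand and answers
  \<open>r\<close> correctly.\<close>

lemma inst_snoc:
  assumes "inst rs \<tau> pm" "hist (rs @ [r]) tg"
  obtains t pm' xs ys where "exec S p (pm, enc_request r, []) t (pm', xs, ys)" "inst (rs @ [r]) (\<tau> + t) pm'"
    "r = Query \<Longrightarrow> \<exists>y. ys = [y] \<and> is_max q (edge_graph d q (current_edges md d q tg)) y"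
proof -
  obtain out0 outs \<tau>' pm1 where *: "run S p initial_memory (initial_request # map enc_request (rs @ [r])) (out0 # outs) \<tau>' pm1"
    "correct_answers d (7 * q) 0 1 (graph_of {}) (rs @ [r]) outs"
    by (rule inst_exists[OF assms(2)])
  have "run S p initial_memory ((initial_request # map enc_request rs) @ [enc_request r]) (out0 # outs) \<tau>' pm1"
    using *(1) by simp
  then obtain ys1 ys t1 t2 m' xs' where **: "run S p initial_memory (initial_request # map enc_request rs) ys1 t1 m'"
    "exec S p (m', enc_request r, []) t2 (pm1, xs', ys)" "out0 # outs = ys1 @ [ys]" "\<tau>' = t1 + t2"
    by (rule run_snocD)
  have m': "m' = pm" "t1 = \<tau>" using assms(1) **(1) run_det unfolding inst_def by blast+
  have "length ys1 = Suc (length rs)" using run_length[OF **(1)] by simp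
  then obtain outs' where outs: "ys1 = out0 # outs'" "outs = outs' @ [ys]" "length outs' = length rs"
    using **(3) by (cases ys1) auto
  show thesis
  proof (rule that)
    show "exec S p (pm, enc_request r, []) t2 (pm1, xs', ys)" using **(2) m' by simp
    show "inst (rs @ [r]) (\<tau> + t2) pm1" using *(1) **(4) m' unfolding inst_def by blast
    assume r: "r = Query"
    from correct_answers_snoc[OF *(2)[unfolded outs(2)] outs(3)[symmetric] r]
    obtain y where y: "ys = [y]" "is_max_flow_value (7 * q) (fold (update d) rs (graph_of {})) 0 1 (real y)" by blast
    have "fold (update d) rs (graph_of {}) = graph_of tg"
      using assms(2) r by (simp add: history_def)
    then show "\<exists>y. ys = [y] \<and> is_max q (edge_graph d q (current_edges md d q tg)) y"
      using y by (simp add: is_max_def)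
  qed
qed

end

section \<open>Weakest preconditions with a time budget\<close>

text \<open>
  The cells from 40 on are eight interleaved arrays: matrix 0, vector 1, found rows 2, generations 3,
  remaining rounds 4, edge buffer 5, memories of the instances 6.  The cells below 40 are variables:
  11 is \<open>q\<close>, 12 is \<open>n\<close>, 13 and 14 are the coordinates of the current block, 16 is the next
  generation, 17 is the index of the current block.
\<close>

definition ad :: "nat \<Rightarrow> nat \<Rightarrow> nat" where "ad k j = 40 + k + 8 * j"

definition AD :: "nat \<Rightarrow> aexp \<Rightarrow> aexp" where "AD k e = Op Plus (Lit (40 + k)) (Op Times (Lit 8) e)"

abbreviation V :: "nat \<Rightarrow> aexp" where "V v \<equiv> Cell (Lit v)"

lemma ad_eq [simp]: "k < 8 \<Longrightarrow> k' < 8 \<Longrightarrow> ad k j = ad k' j' \<longleftrightarrow> k = k' \<and> j = j'"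
proof
  assume k: "k < 8" "k' < 8" and "ad k j = ad k' j'"
  then have eq: "k + 8 * j = k' + 8 * j'" by (simp add: ad_def)
  then have "(k + 8 * j) mod 8 = (k' + 8 * j') mod 8" by simp
  then have "k = k'" using k by simp
  then show "k = k' \<and> j = j'" using eq by simp
qed auto

lemma ad_ge [simp]: "v < 40 \<Longrightarrow> ad k j \<noteq> v" "v < 40 \<Longrightarrow> v \<noteq> ad k j"
  by (simp_all add: ad_def)

lemma aval_AD [simp]: "aval m (AD k e) = ad k (aval m e)"
  by (simp add: AD_def ad_def)

lemma acost_AD [simp]: "acost (AD k e) = 4 + acost e"
  by (simp add: AD_def)

text \<open>An upper bound of the degree of an expression as a polynomial in the cells it reads.\<close>

fun esz :: "aexp \<Rightarrow> nat" where
  "esz (Lit k) = (if k < 100 then 1 else 1000)"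
| "esz (Cell a) = 1 + esz a"
| "esz (Op b x y) = (if b \<in> {Plus, Minus, Times, Div, Mod, Less, Eq} then 1 + esz x + esz y else 1000)"

lemma esz_AD [simp]: "k < 8 \<Longrightarrow> esz (AD k e) = 4 + esz e"
  by (simp add: AD_def)

declare esz.simps(3) [simp del]

lemma esz_Op [simp]:
  "esz (Op Plus x y) = 1 + esz x + esz y" "esz (Op Minus x y) = 1 + esz x + esz y"
  "esz (Op Times x y) = 1 + esz x + esz y" "esz (Op Less x y) = 1 + esz x + esz y"
  "esz (Op Eq x y) = 1 + esz x + esz y" "esz (Op Div x y) = 1 + esz x + esz y"
  "esz (Op Mod x y) = 1 + esz x + esz y"
  by (simp_all add: esz.simps(3))

text \<open>Cells hold values below \<open>X\<close>; expressions of size at most 64 then have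
  values below \<open>X ^ 64\<close>, for which \<open>B\<close> leaves room.\<close>

locale machine =
  fixes B X :: nat
  assumes X100: "X \<ge> 100" and XB: "X ^ 64 \<le> B"
begin

definition small :: "memory \<Rightarrow> bool" where "small m \<longleftrightarrow> (\<forall>a. m a < X)"

lemma smallD: "small m \<Longrightarrow> m a < X"
  by (simp add: small_def)

lemma small_upd: "small m \<Longrightarrow> v < X \<Longrightarrow> small (m(a := v))"
  by (simp add: small_def)

lemma X_pow: "1 \<le> k \<Longrightarrow> X \<le> X ^ k"
  using X100 by (simp add: self_le_power)

lemma X_le_B: "k \<le> 64 \<Longrightarrow> X ^ k \<le> B"
  using XB X100 power_increasing[of k 64 X] by linarith

text \<open>The bounds of the operands multiply, and the extra factor \<open>X\<close> of an
  operator absorbs sums and truth values; a lookup brings the value back below \<open>X\<close>.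
  Bitwise operations and large literals have size 1000 and are thereby excluded.\<close>

lemma fits_small:
  assumes "small m"
  shows "esz e \<le> 64 \<Longrightarrow> fits B m e \<and> aval m e < X ^ esz e \<and> acost e \<le> esz e"
proof (induction e)
  case (Lit k)
  then show ?case using X100 X_le_B[of 1] by (simp split: if_splits)
next
  case (Cell a)
  have "m (aval m a) < X" using assms by (rule smallD)
  moreover have "X \<le> X ^ (1 + esz a)" by (rule X_pow) simp
  moreover have "X \<le> B" using X_le_B[of 1] by simp
  ultimately have "m (aval m a) < X ^ (1 + esz a)" "m (aval m a) < B" by linarith+
  then show ?case using Cell by auto
next
  case (Op b x y)
  have b: "b \<in> {Plus, Minus, Times, Div, Mod, Less, Eq}" using Op.prems by (auto simp: esz.simps(3) split: if_splits)
  then have sz: "esz (Op b x y) = 1 + esz x + esz y" by (simp add: esz.simps(3))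
  let ?x = "aval m x" and ?y = "aval m y" and ?a = "X ^ esz x" and ?b = "X ^ esz y"
  have IH: "fits B m x" "fits B m y" "?x < ?a" "?y < ?b" "acost x \<le> esz x" "acost y \<le> esz y"
    using Op sz by auto
  have a1: "1 \<le> ?a" "1 \<le> ?b" using X100 by simp_all
  have big: "X ^ (1 + esz x + esz y) = X * (?a * ?b)" by (simp add: power_add)
  have ab: "?a \<le> ?a * ?b" "?b \<le> ?a * ?b" using a1 by simp_all
  then have "?x + ?y < 2 * (?a * ?b)" "?x < ?a * ?b" using IH(3,4) by linarith+
  moreover have "?x * ?y < ?a * ?b" using IH(3,4) by (intro mult_strict_mono') auto
  moreover have "100 * (?a * ?b) \<le> X * (?a * ?b)" using X100 by (simp only: mult_le_mono1)
  moreover have "1 \<le> ?a * ?b" using a1 by simp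
  ultimately have "?x + ?y < X * (?a * ?b)" "?x < X * (?a * ?b)" "?x * ?y < X * (?a * ?b)" "1 < X * (?a * ?b)"
    by linarith+
  moreover from this have "?x div ?y < X * (?a * ?b)" "?x mod ?y < X * (?a * ?b)"
    by (meson div_le_dividend mod_less_eq_dividend le_less_trans)+
  ultimately have "binop_val b ?x ?y < X * (?a * ?b)"
    using b X100 by (auto simp: of_bool_def)
  then have "aval m (Op b x y) < X ^ esz (Op b x y)" unfolding sz big by simp
  moreover have "X ^ esz (Op b x y) \<le> B" using Op.prems by (rule X_le_B)
  ultimately show ?case using IH sz by simp
qed

lemma ad_less_B: "k < 8 \<Longrightarrow> j \<le> 2 * X \<Longrightarrow> ad k j < B"
proof -
  assume "k < 8" "j \<le> 2 * X"
  then have "ad k j < 100 * X" using X100 by (simp add: ad_def)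
  also have "\<dots> \<le> X * X" using X100 by simp
  also have "\<dots> \<le> B" using X_le_B[of 2] by (simp add: power2_eq_square)
  finally show ?thesis .
qed

text \<open>\<open>t\<close> and \<open>t'\<close> are readings of a clock that may run ahead of the
  true time, so that every rule can charge a rounded constant. \<open>small\<close> is a standing
  invariant.\<close>

definition wpx where
  "wpx c m xs ys t Q \<longleftrightarrow> (small m \<longrightarrow> (\<exists>u m' xs' ys' t'.
     exec B c (m, xs, ys) u (m', xs', ys') \<and> t + u \<le> t' \<and> small m' \<and> Q m' xs' ys' t'))"

lemma wpx_conseq:
  "wpx c m xs ys t Q \<Longrightarrow> (\<And>m' xs' ys' t'. small m' \<Longrightarrow> Q m' xs' ys' t' \<Longrightarrow> R m' xs' ys' t') \<Longrightarrow> wpx c m xs ys t R"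
  unfolding wpx_def by blast

lemma wpx_time: "wpx c m xs ys t' Q \<Longrightarrow> t \<le> t' \<Longrightarrow> wpx c m xs ys t Q"
  unfolding wpx_def by (meson add_le_mono1 order_trans)

lemma wpx_Skip: "Q m xs ys (t + 1) \<Longrightarrow> wpx Skip m xs ys t Q"
  unfolding wpx_def using exec.Skip by blast

text \<open>The charge 150 covers \<open>1 + 64 + 64\<close>; likewise 70 covers a test,
  \<open>1 + 64\<close>.\<close>

lemma wpx_Assign:
  assumes "esz a \<le> 64" "esz e \<le> 64" "small m \<Longrightarrow> aval m e < X"
    "Q (m(aval m a := aval m e)) xs ys (t + 150)"
  shows "wpx (Assign a e) m xs ys t Q"
  unfolding wpx_def
proof
  assume s: "small m"
  note a = fits_small[OF s assms(1)] and e = fits_small[OF s assms(2)]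
  have "exec B (Assign a e) (m, xs, ys) (1 + acost a + acost e) (m(aval m a := aval m e), xs, ys)"
    using a e by (intro exec.Assign) auto
  moreover have "t + (1 + acost a + acost e) \<le> t + 150" using a e assms(1,2) by linarith
  ultimately show "\<exists>u m' xs' ys' t'. exec B (Assign a e) (m, xs, ys) u (m', xs', ys') \<and> t + u \<le> t' \<and> small m' \<and> Q m' xs' ys' t'"
    using assms(4) small_upd[OF s assms(3)[OF s]] by blast
qed

lemma wpx_Read:
  assumes "esz a \<le> 64" "xs = x # xs'" "x < X" "Q (m(aval m a := x)) xs' ys (t + 150)"
  shows "wpx (Read a) m xs ys t Q"
  unfolding wpx_def
proof
  assume s: "small m"
  note a = fits_small[OF s assms(1)]
  have "x < B" using assms(3) X_le_B[of 1] by simp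
  then have "exec B (Read a) (m, xs, ys) (1 + acost a) (m(aval m a := x), xs', ys)"
    unfolding assms(2) using a by (intro exec.Read) auto
  moreover have "t + (1 + acost a) \<le> t + 150" using a assms(1) by linarith
  ultimately show "\<exists>u m' xs' ys' t'. exec B (Read a) (m, xs, ys) u (m', xs', ys') \<and> t + u \<le> t' \<and> small m' \<and> Q m' xs' ys' t'"
    using assms(4) small_upd[OF s assms(3)] by blast
qed

lemma wpx_Write:
  assumes "esz e \<le> 64" "Q m xs (ys @ [aval m e]) (t + 150)"
  shows "wpx (Write e) m xs ys t Q"
  unfolding wpx_def
proof
  assume s: "small m"
  note e = fits_small[OF s assms(1)]
  have "exec B (Write e) (m, xs, ys) (1 + acost e) (m, xs, ys @ [aval m e])"
    using e by (intro exec.Write) auto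
  moreover have "t + (1 + acost e) \<le> t + 150" using e assms(1) by linarith
  ultimately show "\<exists>u m' xs' ys' t'. exec B (Write e) (m, xs, ys) u (m', xs', ys') \<and> t + u \<le> t' \<and> small m' \<and> Q m' xs' ys' t'"
    using assms(2) s by blast
qed

lemma wpx_Seq:
  assumes "wpx c m xs ys t (\<lambda>m' xs' ys' t'. wpx c' m' xs' ys' t' Q)"
  shows "wpx (Seq c c') m xs ys t Q"
  unfolding wpx_def
proof
  assume "small m"
  then obtain u m1 xs1 ys1 t1 where 1: "exec B c (m, xs, ys) u (m1, xs1, ys1)" "t + u \<le> t1" "small m1"
    "wpx c' m1 xs1 ys1 t1 Q" using assms unfolding wpx_def by blast
  then obtain u' m2 xs2 ys2 t2 where 2: "exec B c' (m1, xs1, ys1) u' (m2, xs2, ys2)" "t1 + u' \<le> t2" "small m2"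
    "Q m2 xs2 ys2 t2" unfolding wpx_def by blast
  have "exec B (Seq c c') (m, xs, ys) (u + u') (m2, xs2, ys2)" using 1(1) 2(1) by (rule exec.Seq)
  moreover have "t + (u + u') \<le> t2" using 1(2) 2(2) by simp
  ultimately show "\<exists>u m' xs' ys' t'. exec B (Seq c c') (m, xs, ys) u (m', xs', ys') \<and> t + u \<le> t' \<and> small m' \<and> Q m' xs' ys' t'"
    using 2(3,4) by blast
qed

lemma wpx_Cond:
  assumes "esz e \<le> 64" "aval m e \<noteq> 0 \<Longrightarrow> wpx c m xs ys (t + 70) Q" "aval m e = 0 \<Longrightarrow> wpx c' m xs ys (t + 70) Q"
  shows "wpx (Cond e c c') m xs ys t Q"
  unfolding wpx_def
proof
  assume s: "small m"
  note e = fits_small[OF s assms(1)]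
  show "\<exists>u m' xs' ys' t'. exec B (Cond e c c') (m, xs, ys) u (m', xs', ys') \<and> t + u \<le> t' \<and> small m' \<and> Q m' xs' ys' t'"
  proof (cases "aval m e = 0")
    case True
    then obtain u m1 xs1 ys1 t1 where 1: "exec B c' (m, xs, ys) u (m1, xs1, ys1)" "t + 70 + u \<le> t1" "small m1"
      "Q m1 xs1 ys1 t1" using assms(3) s unfolding wpx_def by blast
    moreover have "exec B (Cond e c c') (m, xs, ys) (1 + acost e + u) (m1, xs1, ys1)"
      using e True 1(1) by (intro exec.CondFalse) auto
    moreover have "t + (1 + acost e + u) \<le> t1" using e assms(1) 1(2) by linarith
    ultimately show ?thesis by blast
  next
    case False
    then obtain u m1 xs1 ys1 t1 where 1: "exec B c (m, xs, ys) u (m1, xs1, ys1)" "t + 70 + u \<le> t1" "small m1"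
      "Q m1 xs1 ys1 t1" using assms(2) s unfolding wpx_def by blast
    moreover have "exec B (Cond e c c') (m, xs, ys) (1 + acost e + u) (m1, xs1, ys1)"
      using e False 1(1) by (intro exec.CondTrue) auto
    moreover have "t + (1 + acost e + u) \<le> t1" using e assms(1) 1(2) by linarith
    ultimately show ?thesis by blast
  qed
qed

text \<open>The index \<open>i\<close> of the invariant is at the same time the termination
  measure.\<close>

lemma wpx_While:
  fixes i :: nat
  assumes e: "esz e \<le> 64" and I: "I i m xs ys t"
    and step: "\<And>i m xs ys t. I i m xs ys t \<Longrightarrow> small m \<Longrightarrow> aval m e \<noteq> 0 \<Longrightarrow>
      wpx c m xs ys (t + 70) (\<lambda>m' xs' ys' t'. \<exists>j<i. I j m' xs' ys' t')"
    and exit: "\<And>i m xs ys t. I i m xs ys t \<Longrightarrow> aval m e = 0 \<Longrightarrow> Q m xs ys (t + 70)"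
  shows "wpx (While e c) m xs ys t Q"
  using I
proof (induction i arbitrary: m xs ys t rule: less_induct)
  case (less i)
  show ?case unfolding wpx_def
  proof
    assume s: "small m"
    note fe = fits_small[OF s e]
    show "\<exists>u m' xs' ys' t'. exec B (While e c) (m, xs, ys) u (m', xs', ys') \<and> t + u \<le> t' \<and> small m' \<and> Q m' xs' ys' t'"
    proof (cases "aval m e = 0")
      case True
      then have "exec B (While e c) (m, xs, ys) (1 + acost e) (m, xs, ys)"
        using fe by (intro exec.WhileFalse) auto
      moreover have "t + (1 + acost e) \<le> t + 70" using fe e by linarith
      ultimately show ?thesis using exit[OF less.prems True] s by blast
    next
      case False
      obtain u m1 xs1 ys1 t1 j where 1: "exec B c (m, xs, ys) u (m1, xs1, ys1)" "t + 70 + u \<le> t1" "small m1"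
        "j < i" "I j m1 xs1 ys1 t1" using step[OF less.prems s False] s unfolding wpx_def by blast
      obtain u' m2 xs2 ys2 t2 where 2: "exec B (While e c) (m1, xs1, ys1) u' (m2, xs2, ys2)" "t1 + u' \<le> t2"
        "small m2" "Q m2 xs2 ys2 t2" using less.IH[OF 1(4,5)] 1(3) unfolding wpx_def by blast
      have "exec B (While e c) (m, xs, ys) (1 + acost e + u + u') (m2, xs2, ys2)"
        using fe False 1(1) 2(1) by (intro exec.WhileTrue) auto
      moreover have "t + (1 + acost e + u + u') \<le> t2" using fe e 1(2) 2(2) by linarith
      ultimately show ?thesis using 2(3,4) by blast
    qed
  qed
qed

definition FOR :: "nat \<Rightarrow> aexp \<Rightarrow> com \<Rightarrow> com" where
  "FOR v e c = Seq (Assign (Lit v) (Lit 0))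
     (While (Op Less (V v) e) (Seq c (Assign (Lit v) (Op Plus (V v) (Lit 1)))))"

text \<open>The limit is evaluated anew at every test, so the invariant has to fix its value. Size
  60 leaves room for the comparison; 70 is the test and 150 the increment.\<close>

lemma wpx_FOR:
  assumes "v < 100" "esz e \<le> 60" "n < X"
    and I0: "I 0 (m(v := 0)) xs ys (t + 150)"
    and Ie: "\<And>k m xs ys t. k \<le> n \<Longrightarrow> I k m xs ys t \<Longrightarrow> m v = k \<and> aval m e = n"
    and body: "\<And>k m xs ys t. k < n \<Longrightarrow> I k m xs ys t \<Longrightarrow> small m \<Longrightarrow>
      wpx c m xs ys (t + 70) (\<lambda>m' xs' ys' t'. m' v = k \<and> I (Suc k) (m'(v := Suc k)) xs' ys' (t' + 150))"
    and Q: "\<And>m xs ys t. I n m xs ys t \<Longrightarrow> Q m xs ys (t + 70)"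
  shows "wpx (FOR v e c) m xs ys t Q"
  unfolding FOR_def
proof (intro wpx_Seq wpx_Assign)
  show "wpx (While (Op Less (V v) e) (Seq c (Assign (Lit v) (Op Plus (V v) (Lit 1)))))
     (m(aval m (Lit v) := aval m (Lit 0))) xs ys (t + 150) Q"
  proof (rule wpx_While[where I = "\<lambda>i m xs ys t. i \<le> n \<and> I (n - i) m xs ys t" and i = n])
    fix i m xs ys t assume I: "i \<le> n \<and> I (n - i) m xs ys t" and s: "small m" and c: "aval m (Op Less (V v) e) \<noteq> 0"
    have *: "m v = n - i" "aval m e = n" using Ie[of "n - i"] I by auto
    with c have i: "n - i < n" by (auto split: if_splits)
    show "wpx (Seq c (Assign (Lit v) (Op Plus (V v) (Lit 1)))) m xs ys (t + 70)
        (\<lambda>m' xs' ys' t'. \<exists>j<i. j \<le> n \<and> I (n - j) m' xs' ys' t')"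
    proof (rule wpx_Seq, rule wpx_conseq[OF body[OF i _ s]])
      show "I (n - i) m xs ys t" using I by simp
      fix m' xs' ys' t' assume "m' v = n - i \<and> I (Suc (n - i)) (m'(v := Suc (n - i))) xs' ys' (t' + 150)"
      moreover from this have "I (n - (i - 1)) (m'(v := Suc (n - i))) xs' ys' (t' + 150)"
        using i I by (simp add: Suc_diff_le)
      ultimately show "wpx (Assign (Lit v) (Op Plus (V v) (Lit 1))) m' xs' ys' t'
          (\<lambda>m' xs' ys' t'. \<exists>j<i. j \<le> n \<and> I (n - j) m' xs' ys' t')"
        using i I \<open>v < 100\<close> \<open>n < X\<close> by (intro wpx_Assign) (auto intro!: exI[of _ "i - 1"])
    qed
  next
    fix i m xs ys t assume I: "i \<le> n \<and> I (n - i) m xs ys t" and c: "aval m (Op Less (V v) e) = 0"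
    have *: "m v = n - i" "aval m e = n" using Ie[of "n - i"] I by auto
    with c I have "i = 0" by (auto split: if_splits)
    then show "Q m xs ys (t + 70)" using I Q by auto
  qed (use assms(1,2) I0 in auto)
qed (use assms(1) X100 in auto)

text \<open>The calculus for code without input and output; quantifying over both lists makes its
  results usable at any point of a request.\<close>

definition wp where
  "wp c m t Q \<longleftrightarrow> (\<forall>xs ys. wpx c m xs ys t (\<lambda>m' xs' ys' t'. xs' = xs \<and> ys' = ys \<and> Q m' t'))"

lemma wpD: "wp c m t Q \<Longrightarrow> wpx c m xs ys t (\<lambda>m' xs' ys' t'. xs' = xs \<and> ys' = ys \<and> Q m' t')"
  unfolding wp_def by blast

lemma wp_wpx: "wp c m t (\<lambda>m' t'. Q m' xs ys t') \<Longrightarrow> wpx c m xs ys t Q"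
  by (erule wpD[THEN wpx_conseq]) simp

lemma wp_conseq:
  assumes "wp c m t Q" "\<And>m' t'. small m' \<Longrightarrow> Q m' t' \<Longrightarrow> R m' t'"
  shows "wp c m t R"
  unfolding wp_def
proof (intro allI)
  fix xs ys
  show "wpx c m xs ys t (\<lambda>m' xs' ys' t'. xs' = xs \<and> ys' = ys \<and> R m' t')"
    by (rule wpx_conseq[OF wpD[OF assms(1)]]) (use assms(2) in auto)
qed

lemma wp_time: "wp c m t' Q \<Longrightarrow> t \<le> t' \<Longrightarrow> wp c m t Q"
  unfolding wp_def by (blast intro: wpx_time)

lemma wp_Skip: "Q m (t + 1) \<Longrightarrow> wp Skip m t Q"
  unfolding wp_def by (auto intro: wpx_Skip)

lemma wp_Assign:
  "esz a \<le> 64 \<Longrightarrow> esz e \<le> 64 \<Longrightarrow> (small m \<Longrightarrow> aval m e < X) \<Longrightarrow>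
    Q (m(aval m a := aval m e)) (t + 150) \<Longrightarrow> wp (Assign a e) m t Q"
  unfolding wp_def by (auto intro: wpx_Assign)

lemma wp_Seq:
  assumes "wp c m t (\<lambda>m' t'. wp c' m' t' Q)"
  shows "wp (Seq c c') m t Q"
  unfolding wp_def
proof (intro allI wpx_Seq)
  fix xs ys
  show "wpx c m xs ys t (\<lambda>m' xs' ys' t'. wpx c' m' xs' ys' t' (\<lambda>m' xs' ys' t'. xs' = xs \<and> ys' = ys \<and> Q m' t'))"
    by (rule wpx_conseq[OF wpD[OF assms]]) (simp add: wpD)
qed

lemma wp_Cond:
  "esz e \<le> 64 \<Longrightarrow> (aval m e \<noteq> 0 \<Longrightarrow> wp c m (t + 70) Q) \<Longrightarrow> (aval m e = 0 \<Longrightarrow> wp c' m (t + 70) Q) \<Longrightarrow>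
    wp (Cond e c c') m t Q"
  unfolding wp_def by (auto intro: wpx_Cond)

lemma wp_While:
  fixes i :: nat
  assumes e: "esz e \<le> 64" and I: "I i m t"
    and step: "\<And>i m t. I i m t \<Longrightarrow> small m \<Longrightarrow> aval m e \<noteq> 0 \<Longrightarrow> wp c m (t + 70) (\<lambda>m' t'. \<exists>j<i. I j m' t')"
    and exit: "\<And>i m t. I i m t \<Longrightarrow> aval m e = 0 \<Longrightarrow> Q m (t + 70)"
  shows "wp (While e c) m t Q"
  unfolding wp_def
proof (intro allI)
  fix xs ys
  show "wpx (While e c) m xs ys t (\<lambda>m' xs' ys' t'. xs' = xs \<and> ys' = ys \<and> Q m' t')"
  proof (rule wpx_While[where I = "\<lambda>i m xs' ys' t. xs' = xs \<and> ys' = ys \<and> I i m t", OF e])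
    fix i m xs' ys' t assume "xs' = xs \<and> ys' = ys \<and> I i m t" "small m" "aval m e \<noteq> 0"
    then show "wpx c m xs' ys' (t + 70) (\<lambda>m' xs' ys' t'. \<exists>j<i. xs' = xs \<and> ys' = ys \<and> I j m' t')"
      by (intro wpx_conseq[OF wpD[OF step]]) auto
  qed (use I exit in auto)
qed

lemma wp_FOR:
  assumes "v < 100" "esz e \<le> 60" "n < X"
    and I0: "I 0 (m(v := 0)) (t + 150)"
    and Ie: "\<And>k m t. k \<le> n \<Longrightarrow> I k m t \<Longrightarrow> m v = k \<and> aval m e = n"
    and body: "\<And>k m t. k < n \<Longrightarrow> I k m t \<Longrightarrow> small m \<Longrightarrow>
      wp c m (t + 70) (\<lambda>m' t'. m' v = k \<and> I (Suc k) (m'(v := Suc k)) (t' + 150))"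
    and Q: "\<And>m t. I n m t \<Longrightarrow> Q m (t + 70)"
  shows "wp (FOR v e c) m t Q"
  unfolding wp_def
proof (intro allI)
  fix xs ys
  show "wpx (FOR v e c) m xs ys t (\<lambda>m' xs' ys' t'. xs' = xs \<and> ys' = ys \<and> Q m' t')"
  proof (rule wpx_FOR[where I = "\<lambda>k m xs' ys' t. xs' = xs \<and> ys' = ys \<and> I k m t" and n = n, OF assms(1-3)])
    fix k m xs' ys' t assume "k < n" "xs' = xs \<and> ys' = ys \<and> I k m t" "small m"
    then show "wpx c m xs' ys' (t + 70) (\<lambda>m' xs' ys' t'. m' v = k \<and>
        xs' = xs \<and> ys' = ys \<and> I (Suc k) (m'(v := Suc k)) (t' + 150))"
      by (intro wpx_conseq[OF wpD[OF body]]) auto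
  qed (use I0 Ie Q in auto)
qed

end

section \<open>Simulation of the flow algorithm\<close>

text \<open>
  Cell 0 points into the input buffer (array 5), cell 1 receives the last output, and array 6 from
  the offset in cell 10 holds the memory of the simulated program.
\<close>

definition inst_addr :: "aexp \<Rightarrow> aexp" where "inst_addr e = AD 6 (Op Plus (V 10) e)"

fun trE :: "aexp \<Rightarrow> aexp" where
  "trE (Lit k) = Lit k"
| "trE (Cell a) = Cell (inst_addr (trE a))"
| "trE (Op b x y) = Op b (trE x) (trE y)"

text \<open>Keeping the last output is enough: a query is answered by a single number, and the
  output for an update is ignored.\<close>

fun trC :: "com \<Rightarrow> com" where
  "trC Skip = Skip"
| "trC (Assign a e) = Assign (inst_addr (trE a)) (trE e)"
| "trC (Read a) = Seq (Assign (inst_addr (trE a)) (Cell (AD 5 (V 0)))) (Assign (Lit 0) (Op Plus (V 0) (Lit 1)))"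
| "trC (Write e) = Assign (Lit 1) (trE e)"
| "trC (Seq p q) = Seq (trC p) (trC q)"
| "trC (Cond e p q) = Cond (trE e) (trC p) (trC q)"
| "trC (While e p) = While (trE e) (trC p)"

text \<open>The frame condition: variables from \<open>l\<close> on survive, and so do all arrays
  except the buffer and the area from \<open>b\<close> to \<open>b + S\<close> of one instance.
  Outer layers of the program have more scratch variables and thus a larger
  \<open>l\<close>.\<close>

definition same_above :: "nat \<Rightarrow> nat \<Rightarrow> nat \<Rightarrow> memory \<Rightarrow> memory \<Rightarrow> bool" where
  "same_above l b S m m' \<longleftrightarrow> (\<forall>a. l \<le> a \<and> a < 40 \<longrightarrow> m' a = m a) \<and>
     (\<forall>k j. k < 8 \<and> k \<noteq> 5 \<and> (k = 6 \<longrightarrow> j < b \<or> b + S \<le> j) \<longrightarrow> m' (ad k j) = m (ad k j))"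

lemma same_above_refl: "same_above l b S m m"
  by (simp add: same_above_def)

lemma same_above_trans: "same_above l b S m m' \<Longrightarrow> same_above l b S m' m'' \<Longrightarrow> same_above l b S m m''"
  by (simp add: same_above_def)

lemma same_above_mono: "same_above l b S m m' \<Longrightarrow> l \<le> l' \<Longrightarrow> same_above l' b S m m'"
  by (simp add: same_above_def)

lemma same_above_var: "same_above l b S m m' \<Longrightarrow> l \<le> a \<Longrightarrow> a < 40 \<Longrightarrow> m' a = m a"
  by (simp add: same_above_def)

lemma same_above_arr: "same_above l b S m m' \<Longrightarrow> k < 5 \<Longrightarrow> m' (ad k j) = m (ad k j)"
  by (simp add: same_above_def)

lemma same_above_inst: "same_above l b S m m' \<Longrightarrow> j < b \<or> b + S \<le> j \<Longrightarrow> m' (ad 6 j) = m (ad 6 j)"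
  by (simp add: same_above_def)

lemma same_above_upd_var: "v < l \<Longrightarrow> l \<le> 40 \<Longrightarrow> same_above l b S m m' \<Longrightarrow> same_above l b S m (m'(v := x))"
  by (simp add: same_above_def)

lemma same_above_upd_buf: "l \<le> 40 \<Longrightarrow> same_above l b S m m' \<Longrightarrow> same_above l b S m (m'(ad 5 j := x))"
  by (auto simp: same_above_def)

lemma same_above_upd_inst:
  "l \<le> 40 \<Longrightarrow> b \<le> j \<Longrightarrow> j < b + S \<Longrightarrow> same_above l b S m m' \<Longrightarrow> same_above l b S m (m'(ad 6 j := x))"
  by (auto simp: same_above_def)

lemma fits_val: "fits B m e \<Longrightarrow> aval m e < B"
  by (cases e) auto

definition holds_mem :: "nat \<Rightarrow> nat \<Rightarrow> memory \<Rightarrow> memory \<Rightarrow> bool" where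
  "holds_mem b S m pm \<longleftrightarrow> (\<forall>a<S. m (ad 6 (b + a)) = pm a)"

context machine
begin

text \<open>Addresses of the simulated program are words below \<open>S\<close>, so \<open>S\<close>
  cells represent all of its memory. \<open>L\<close> keeps the buffer pointer within range.\<close>

definition sim :: "nat \<Rightarrow> nat \<Rightarrow> nat \<Rightarrow> memory \<Rightarrow> state \<Rightarrow> bool" where
  "sim b S L m s \<longleftrightarrow> (case s of (pm, xs, ys) \<Rightarrow> small m \<and> m 10 = b \<and> holds_mem b S m pm \<and>
     (\<forall>k<length xs. m (ad 5 (m 0 + k)) = xs ! k) \<and> m 0 + length xs \<le> L \<and>
     (ys \<noteq> [] \<longrightarrow> m 1 = last ys))"

text \<open>Translating an address adds 7 to the cost of each lookup; the factor 9 absorbs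
  this.\<close>

lemma trE:
  assumes "holds_mem b S m pm" "m 10 = b" "b + S \<le> X"
  shows "fits S pm e \<Longrightarrow> aval m (trE e) = aval pm e \<and> fits B m (trE e) \<and> acost (trE e) \<le> 9 * acost e"
proof (induction e)
  case (Lit k)
  then show ?case using assms X_le_B[of 1] by simp
next
  case (Cell a)
  have XB: "X \<le> B" using X_le_B[of 1] by simp
  have a: "aval pm a < S" using Cell.prems fits_val by auto
  have "ad 6 (b + aval pm a) < B" by (rule ad_less_B) (use a assms in auto)
  then have "46 + 8 * (b + aval pm a) < B" by (simp add: ad_def)
  then show ?case using Cell a assms XB
    by (auto simp: inst_addr_def AD_def ad_def holds_mem_def)
next
  case (Op bo x y)
  moreover have "X \<le> B" using X_le_B[of 1] by simp
  ultimately show ?case using assms by auto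
qed

lemma inst_addr:
  assumes "holds_mem b S m pm" "m 10 = b" "b + S \<le> X" "fits S pm e"
  shows "aval m (inst_addr (trE e)) = ad 6 (b + aval pm e) \<and> fits B m (inst_addr (trE e)) \<and>
    acost (inst_addr (trE e)) \<le> 9 * acost e + 7"
proof -
  have XB: "X \<le> B" using X_le_B[of 1] by simp
  have a: "aval pm e < S" using fits_val[OF assms(4)] .
  have "ad 6 (b + aval pm e) < B" by (rule ad_less_B) (use a assms in auto)
  then have "46 + 8 * (b + aval pm e) < B" by (simp add: ad_def)
  then show ?thesis using trE[OF assms(1-4)] a assms XB
    by (auto simp: inst_addr_def AD_def ad_def)
qed

definition silent where
  "silent c m u m' \<longleftrightarrow> (\<forall>xs ys. exec B c (m, xs, ys) u (m', xs, ys))"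

text \<open>The largest overhead is that of \<open>Read\<close>, which becomes two assignments of
  total cost at most \<open>9 * acost a + 21\<close>; the factor 40 is ample.\<close>

lemma simulation:
  "exec S p s u s' \<Longrightarrow> sim b S L m s \<Longrightarrow> b + S \<le> X \<Longrightarrow> L < X \<Longrightarrow>
     \<exists>u' m'. silent (trC p) m u' m' \<and> u' \<le> 40 * u \<and> sim b S L m' s' \<and> same_above 2 b S m m'"
proof (induction arbitrary: m rule: exec.induct)
  case (Skip s)
  have "silent (trC Skip) m 1 m" unfolding silent_def trC.simps by (intro allI exec.Skip)
  then show ?case using Skip same_above_refl by (intro exI[of _ 1] exI[of _ m]) auto
next
  case (Assign pm a e xs ys)
  have sm: "small m" "m 10 = b" "holds_mem b S m pm" using Assign.prems by (auto simp: sim_def)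
  note a = inst_addr[OF sm(3,2) Assign.prems(2) Assign.hyps(1)]
  note e = trE[OF sm(3,2) Assign.prems(2) Assign.hyps(2)]
  have v: "aval pm a < S" "aval pm e < S" using Assign.hyps fits_val by auto
  let ?m = "m(ad 6 (b + aval pm a) := aval pm e)"
  have "silent (trC (Assign a e)) m (1 + acost (inst_addr (trE a)) + acost (trE e)) ?m"
    unfolding silent_def
    using exec.Assign[of B m "inst_addr (trE a)" "trE e"] a e by auto
  moreover have "sim b S L ?m (pm(aval pm a := aval pm e), xs, ys)"
    using Assign.prems v by (auto simp: sim_def holds_mem_def intro: small_upd)
  moreover have "same_above 2 b S m ?m" using v by (intro same_above_upd_inst same_above_refl) auto
  moreover have "1 + acost (inst_addr (trE a)) + acost (trE e) \<le> 40 * (1 + acost a + acost e)"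
    using a e by auto
  ultimately show ?case by blast
next
  case (Read pm a x xs ys)
  have sm: "small m" "m 10 = b" "holds_mem b S m pm" using Read.prems by (auto simp: sim_def)
  note a = inst_addr[OF sm(3,2) Read.prems(2) Read.hyps(1)]
  have v: "aval pm a < S" using Read.hyps fits_val by auto
  have len: "m 0 + length (x # xs) \<le> L" and buf: "\<forall>k<length (x # xs). m (ad 5 (m 0 + k)) = (x # xs) ! k"
    using Read.prems by (auto simp: sim_def)
  have x: "m (ad 5 (m 0)) = x" using buf by auto
  let ?m1 = "m(ad 6 (b + aval pm a) := x)"
  let ?m = "?m1(0 := m 0 + 1)"
  have XB: "X \<le> B" using X_le_B[of 1] by simp
  have "ad 5 (m 0) < B" by (rule ad_less_B) (use len Read.prems(3) in auto)
  then have f: "fits B m (Cell (AD 5 (V 0)))"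
    using len Read.prems(3) Read.prems(2) XB X100 x Read.hyps(2) by (auto simp: AD_def ad_def)
  have "silent (trC (Read a)) m ((1 + acost (inst_addr (trE a)) + acost (Cell (AD 5 (V 0)))) +
      (1 + acost (Lit 0) + acost (Op Plus (V 0) (Lit 1)))) ?m"
    unfolding silent_def trC.simps
  proof (intro allI exec.Seq)
    fix ins outs
    show "exec B (Assign (inst_addr (trE a)) (Cell (AD 5 (V 0)))) (m, ins, outs)
       (1 + acost (inst_addr (trE a)) + acost (Cell (AD 5 (V 0)))) (?m1, ins, outs)"
      using exec.Assign[of B m "inst_addr (trE a)" "Cell (AD 5 (V 0))"] a f x by auto
    have "fits B ?m1 (Op Plus (V 0) (Lit 1))"
      using len Read.prems(3) XB X100 by auto
    then show "exec B (Assign (Lit 0) (Op Plus (V 0) (Lit 1))) (?m1, ins, outs)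
       (1 + acost (Lit 0) + acost (Op Plus (V 0) (Lit 1))) (?m, ins, outs)"
      using exec.Assign[of B ?m1 "Lit 0" "Op Plus (V 0) (Lit 1)" ins outs] XB X100 by auto
  qed
  moreover have "sim b S L ?m (pm(aval pm a := x), xs, ys)"
  proof -
    have "?m (ad 5 (?m 0 + k)) = xs ! k" if "k < length xs" for k
      using buf[rule_format, of "Suc k"] that by simp
    moreover have "small ?m" using sm(1) len Read.prems(3) Read.hyps(2) Read.prems(2)
      by (intro small_upd) auto
    ultimately show ?thesis using Read.prems len by (auto simp: sim_def holds_mem_def)
  qed
  moreover have "same_above 2 b S m ?m"
    using v by (intro same_above_upd_inst same_above_upd_var same_above_refl) auto
  moreover have "(1 + acost (inst_addr (trE a)) + acost (Cell (AD 5 (V 0)))) +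
      (1 + acost (Lit 0) + acost (Op Plus (V 0) (Lit 1))) \<le> 40 * (1 + acost a)"
    using a by simp
  ultimately show ?case by blast
next
  case (Write pm e xs ys)
  have sm: "small m" "m 10 = b" "holds_mem b S m pm" using Write.prems by (auto simp: sim_def)
  note e = trE[OF sm(3,2) Write.prems(2) Write.hyps(1)]
  have v: "aval pm e < S" using Write.hyps fits_val by auto
  let ?m = "m(1 := aval pm e)"
  have "silent (trC (Write e)) m (1 + acost (Lit 1) + acost (trE e)) ?m"
    unfolding silent_def
    using exec.Assign[of B m "Lit 1" "trE e"] e X_le_B[of 1] X100 by auto
  moreover have "sim b S L ?m (pm, xs, ys @ [aval pm e])"
    using Write.prems v by (auto simp: sim_def holds_mem_def intro: small_upd)
  moreover have "same_above 2 b S m ?m" by (intro same_above_upd_var same_above_refl) auto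
  moreover have "1 + acost (Lit 1) + acost (trE e) \<le> 40 * (1 + acost e)" using e by simp
  ultimately show ?case by blast
next
  case (Seq p s t s' q t' s'')
  obtain u1 m1 where 1: "silent (trC p) m u1 m1" "u1 \<le> 40 * t" "sim b S L m1 s'" "same_above 2 b S m m1"
    using Seq.IH(1)[OF Seq.prems] by blast
  obtain u2 m2 where 2: "silent (trC q) m1 u2 m2" "u2 \<le> 40 * t'" "sim b S L m2 s''" "same_above 2 b S m1 m2"
    using Seq.IH(2)[OF 1(3) Seq.prems(2,3)] by blast
  have "silent (trC (Seq p q)) m (u1 + u2) m2"
    using 1(1) 2(1) unfolding silent_def trC.simps by (intro allI exec.Seq) auto
  moreover have "u1 + u2 \<le> 40 * (t + t')" using 1(2) 2(2) by simp
  ultimately show ?case using 2(3) same_above_trans[OF 1(4) 2(4)] by blast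
next
  case (CondTrue pm e p xs ys t s' q)
  have sm: "small m" "m 10 = b" "holds_mem b S m pm" using CondTrue.prems by (auto simp: sim_def)
  note e = trE[OF sm(3,2) CondTrue.prems(2) CondTrue.hyps(1)]
  obtain u1 m1 where 1: "silent (trC p) m u1 m1" "u1 \<le> 40 * t" "sim b S L m1 s'" "same_above 2 b S m m1"
    using CondTrue.IH[OF CondTrue.prems] by blast
  have "silent (trC (Cond e p q)) m (1 + acost (trE e) + u1) m1"
    using 1(1) e CondTrue.hyps(2) unfolding silent_def trC.simps by (intro allI exec.CondTrue) auto
  moreover have "1 + acost (trE e) + u1 \<le> 40 * (1 + acost e + t)" using e 1(2) by simp
  ultimately show ?case using 1 by blast
next
  case (CondFalse pm e q xs ys t s' p)
  have sm: "small m" "m 10 = b" "holds_mem b S m pm" using CondFalse.prems by (auto simp: sim_def)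
  note e = trE[OF sm(3,2) CondFalse.prems(2) CondFalse.hyps(1)]
  obtain u1 m1 where 1: "silent (trC q) m u1 m1" "u1 \<le> 40 * t" "sim b S L m1 s'" "same_above 2 b S m m1"
    using CondFalse.IH[OF CondFalse.prems] by blast
  have "silent (trC (Cond e p q)) m (1 + acost (trE e) + u1) m1"
    using 1(1) e CondFalse.hyps(2) unfolding silent_def trC.simps by (intro allI exec.CondFalse) auto
  moreover have "1 + acost (trE e) + u1 \<le> 40 * (1 + acost e + t)" using e 1(2) by simp
  ultimately show ?case using 1 by blast
next
  case (WhileTrue pm e p xs ys t s' t' s'')
  have sm: "small m" "m 10 = b" "holds_mem b S m pm" using WhileTrue.prems by (auto simp: sim_def)
  note e = trE[OF sm(3,2) WhileTrue.prems(2) WhileTrue.hyps(1)]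
  obtain u1 m1 where 1: "silent (trC p) m u1 m1" "u1 \<le> 40 * t" "sim b S L m1 s'" "same_above 2 b S m m1"
    using WhileTrue.IH(1)[OF WhileTrue.prems] by blast
  obtain u2 m2 where 2: "silent (trC (While e p)) m1 u2 m2" "u2 \<le> 40 * t'" "sim b S L m2 s''" "same_above 2 b S m1 m2"
    using WhileTrue.IH(2)[OF 1(3) WhileTrue.prems(2,3)] by blast
  have "silent (trC (While e p)) m (1 + acost (trE e) + u1 + u2) m2"
    using 1(1) 2(1) e WhileTrue.hyps(2) unfolding silent_def trC.simps by (intro allI exec.WhileTrue) auto
  moreover have "1 + acost (trE e) + u1 + u2 \<le> 40 * (1 + acost e + t + t')" using e 1(2) 2(2) by simp
  ultimately show ?case using 2(3) same_above_trans[OF 1(4) 2(4)] by blast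
next
  case (WhileFalse pm e p xs ys)
  have sm: "small m" "m 10 = b" "holds_mem b S m pm" using WhileFalse.prems by (auto simp: sim_def)
  note e = trE[OF sm(3,2) WhileFalse.prems(2) WhileFalse.hyps(1)]
  have "silent (trC (While e p)) m (1 + acost (trE e)) m"
    using e WhileFalse.hyps(2) unfolding silent_def trC.simps by (intro allI exec.WhileFalse) auto
  moreover have "1 + acost (trE e) \<le> 40 * (1 + acost e)" using e by simp
  ultimately show ?case using WhileFalse.prems same_above_refl by blast
qed

lemma wp_simulation:
  assumes "exec S p (pm, xs, []) u (pm', xs', ys')" "b + S \<le> X" "L < X" "m 10 = b" "holds_mem b S m pm"
    "\<forall>k<length xs. m (ad 5 (m 0 + k)) = xs ! k" "m 0 + length xs \<le> L"
    and Q: "\<And>m'. small m' \<Longrightarrow> holds_mem b S m' pm' \<Longrightarrow> (ys' \<noteq> [] \<Longrightarrow> m' 1 = last ys') \<Longrightarrow>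
      same_above 2 b S m m' \<Longrightarrow> Q m' (t + 40 * u)"
  shows "wp (trC p) m t Q"
  unfolding wp_def wpx_def
proof (intro allI impI)
  fix ins outs assume "small m"
  then have "sim b S L m (pm, xs, [])" using assms by (simp add: sim_def)
  then obtain u' m' where *: "silent (trC p) m u' m'" "u' \<le> 40 * u" "sim b S L m' (pm', xs', ys')" "same_above 2 b S m m'"
    using simulation[OF assms(1)] assms(2,3) by blast
  have "Q m' (t + 40 * u)" using *(3,4) by (intro Q) (auto simp: sim_def)
  then show "\<exists>u m' xs' ys' t'. exec B (trC p) (m, ins, outs) u (m', xs', ys') \<and> t + u \<le> t' \<and> small m' \<and>
      xs' = ins \<and> ys' = outs \<and> Q m' t'"
    using * by (intro exI[of _ u'] exI[of _ m'] exI[of _ ins] exI[of _ outs] exI[of _ "t + 40 * u"])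
      (auto simp: silent_def sim_def)
qed

end

section \<open>Issuing requests\<close>

fun selE :: "sel \<Rightarrow> aexp" where
  "selE Sel0 = Lit 0" | "selE Sel1 = Lit 1" | "selE Outer = V 3" | "selE Inner = V 2"

definition portE :: "port \<Rightarrow> aexp" where
  "portE u = Op Plus (Op Times (Lit (fst u)) (V 11)) (selE (snd u))"

definition capE :: "orientation \<Rightarrow> port \<Rightarrow> port \<Rightarrow> aexp" where
  "capE d u v = (if d = Undirected \<and> (fst u = 0 \<or> fst v = 0) then Op Plus (V 11) (V 11) else Lit 1)"

definition row_index :: "aexp \<Rightarrow> aexp" where
  "row_index e = Op Plus (Op Times (V 13) (V 11)) e"

definition col_index :: "aexp \<Rightarrow> aexp" where
  "col_index e = Op Plus (Op Times (V 14) (V 11)) e"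

fun flagE :: "bool \<Rightarrow> aexp \<Rightarrow> aexp" where
  "flagE b e = (if b then e else Op Eq e (Lit 0))"

fun cndE :: "cnd \<Rightarrow> aexp" where
  "cndE Always = Lit 1"
| "cndE AtZero = Op Eq (V 2) (Lit 0)"
| "cndE (IfM b) = flagE b (Cell (AD 0 (Op Plus (Op Times (row_index (V 3)) (Op Times (V 11) (V 11))) (col_index (V 2)))))"
| "cndE (IfV b) = flagE b (Cell (AD 1 (col_index (V 2))))"
| "cndE (IfF b) = flagE b (Cell (AD 2 (row_index (V 2))))"

definition blkM :: "nat \<Rightarrow> memory \<Rightarrow> nat \<Rightarrow> nat \<Rightarrow> bool" where
  "blkM q m i j \<longleftrightarrow> m (ad 0 ((m 13 * q + i) * (q * q) + (m 14 * q + j))) \<noteq> 0"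

definition blkV :: "nat \<Rightarrow> memory \<Rightarrow> nat \<Rightarrow> bool" where
  "blkV q m j \<longleftrightarrow> m (ad 1 (m 14 * q + j)) \<noteq> 0"

definition blkF :: "nat \<Rightarrow> memory \<Rightarrow> nat \<Rightarrow> bool" where
  "blkF q m i \<longleftrightarrow> m (ad 2 (m 13 * q + i)) \<noteq> 0"

lemma blk_same:
  assumes "same_above l b S m m'" "l \<le> 13"
  shows "blkM q m' = blkM q m" "blkV q m' = blkV q m" "blkF q m' = blkF q m"
  using same_above_var[OF assms(1), of 13] same_above_var[OF assms(1), of 14]
    same_above_arr[OF assms(1)] assms(2)
  by (auto simp: blkM_def blkV_def blkF_def fun_eq_iff)

text \<open>Only the data that the condition inspects have to be in memory, so that the other
  parameters may be instantiated arbitrarily.\<close>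

fun agrees :: "nat \<Rightarrow> memory \<Rightarrow> (nat \<Rightarrow> nat \<Rightarrow> bool) \<Rightarrow> (nat \<Rightarrow> bool) \<Rightarrow> (nat \<Rightarrow> bool) \<Rightarrow> cnd \<Rightarrow> bool" where
  "agrees q m M Vb D (IfM b) \<longleftrightarrow> blkM q m = M"
| "agrees q m M Vb D (IfV b) \<longleftrightarrow> blkV q m = Vb"
| "agrees q m M Vb D (IfF b) \<longleftrightarrow> blkF q m = D"
| "agrees q m M Vb D _ \<longleftrightarrow> True"

lemma agrees_same: "same_above l b S m m' \<Longrightarrow> l \<le> 13 \<Longrightarrow> agrees q m' M Vb D c = agrees q m M Vb D c"
  by (cases c) (auto simp: blk_same)

lemma cndE:
  assumes "m 11 = q" "agrees q m M Vb D c"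
  shows "aval m (cndE c) \<noteq> 0 \<longleftrightarrow> cnd_holds M Vb D (m 3) (m 2) c"
  using assms by (cases c) (auto simp: blkM_def blkV_def blkF_def row_index_def col_index_def)

lemma esz_cndE: "esz (cndE c) \<le> 60"
  by (cases c) (auto simp: row_index_def col_index_def)

text \<open>The parts of a request are written to the buffer in turn, so none of them may depend on
  the buffer.\<close>

definition stable :: "aexp \<Rightarrow> bool" where
  "stable e \<longleftrightarrow> (\<forall>m j x. aval (m(ad 5 j := x)) e = aval m e)"

lemma stable_portE: "stable (portE u)" "stable (capE d u v)" "stable (Lit k)"
  by (cases "snd u"; simp add: stable_def portE_def capE_def)+

lemma esz_portE: "fst u < 7 \<Longrightarrow> esz (portE u) \<le> 60" "esz (capE d u v) \<le> 60"
  by (cases "snd u"; simp add: portE_def capE_def)+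

lemma aval_portE: "m 11 = q \<Longrightarrow> aval m (portE u) = enc q (port_node (m 3) (m 2) u)"
  by (cases u; cases "snd u") (auto simp: portE_def)

lemma fst_port_node [simp]: "fst (port_node o' x u) = fst u"
  by (cases "(o', x, u)" rule: port_node.cases) auto

lemma aval_capE: "m 11 = q \<Longrightarrow> aval m (capE d u v) = edge_cap d q (port_node (m 3) (m 2) u) (port_node (m 3) (m 2) v)"
  by (auto simp: capE_def edge_cap_def)

fun WR :: "nat \<Rightarrow> aexp list \<Rightarrow> com" where
  "WR k [] = Skip"
| "WR k (e # es) = Seq (Assign (AD 5 (Lit k)) e) (WR (Suc k) es)"

text \<open>With all parameters 0 the frame condition is strictest: only the buffer may
  change.\<close>

lemma same_above_0: "same_above 0 0 0 m m' \<Longrightarrow> same_above l b S m m'"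
  by (simp add: same_above_def)

lemma same_above_0_mem: "same_above 0 0 0 m m' \<Longrightarrow> holds_mem b S m pm \<Longrightarrow> holds_mem b S m' pm"
  by (simp add: same_above_def holds_mem_def)

context machine
begin

lemma wp_WR:
  assumes "k + length es \<le> 90" "\<forall>e\<in>set es. esz e \<le> 60 \<and> stable e \<and> aval m e < X"
    and Q: "\<And>m'. same_above 0 0 0 m m' \<Longrightarrow> (\<forall>i<length es. m' (ad 5 (k + i)) = aval m (es ! i)) \<Longrightarrow>
      (\<forall>j. j < k \<or> k + length es \<le> j \<longrightarrow> m' (ad 5 j) = m (ad 5 j)) \<Longrightarrow> Q m' (t + 150 * length es + 1)"
  shows "wp (WR k es) m t Q"
  using assms
proof (induction es arbitrary: k m t)
  case Nil
  show ?case using Nil.prems(3)[OF same_above_refl] by (auto intro!: wp_Skip)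
next
  case (Cons e es)
  let ?m = "m(ad 5 k := aval m e)"
  have st: "aval ?m e' = aval m e'" if "e' \<in> set es" for e'
    using Cons.prems(2) that by (auto simp: stable_def)
  have "wp (WR (Suc k) es) ?m (t + 150) Q"
  proof (rule Cons.IH)
    show "Suc k + length es \<le> 90" "\<forall>e\<in>set es. esz e \<le> 60 \<and> stable e \<and> aval ?m e < X"
      using Cons.prems(1,2) st by auto
    fix m' assume *: "same_above 0 0 0 ?m m'" "\<forall>i<length es. m' (ad 5 (Suc k + i)) = aval ?m (es ! i)"
      "\<forall>j. j < Suc k \<or> Suc k + length es \<le> j \<longrightarrow> m' (ad 5 j) = ?m (ad 5 j)"
    have "Q m' (t + 150 * length (e # es) + 1)"
    proof (rule Cons.prems(3))
      show "same_above 0 0 0 m m'" using *(1) by (auto simp: same_above_def)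
      show "\<forall>i<length (e # es). m' (ad 5 (k + i)) = aval m ((e # es) ! i)"
      proof (intro allI impI)
        fix i assume "i < length (e # es)"
        then show "m' (ad 5 (k + i)) = aval m ((e # es) ! i)"
          using *(2,3) st by (cases i) auto
      qed
      show "\<forall>j. j < k \<or> k + length (e # es) \<le> j \<longrightarrow> m' (ad 5 j) = m (ad 5 j)"
        using *(3) by auto
    qed
    then show "Q m' (t + 150 + 150 * length es + 1)" by (simp add: algebra_simps)
  qed
  then show ?case
    using Cons.prems by (auto intro!: wp_Seq wp_Assign)
qed

end

text \<open>The bound on \<open>X\<close> covers in particular the initial request, whose length is
  at most \<open>4 + 3 * 11 * q * q\<close>.\<close>

locale driver = flow_algorithm md d q W c p T + machine B X
  for md d q W c p T B X +
  assumes X_size: "40 * q * q + 100 < X"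
begin

lemma X_sizes: "40 * q < X" "40 * q * q < X"
proof -
  have "q \<le> q * q" by simp
  then show "40 * q < X" "40 * q * q < X" using X_size by linarith+
qed

text \<open>The account of one instance. \<open>L\<close> bounds the number of requests and hence,
  by \<open>inst_time\<close>, the simulated time \<open>\<tau>\<close>. The clock \<open>t\<close>
  is split into \<open>40 * \<tau>\<close> for the simulation and \<open>z\<close> for everything
  else.\<close>

definition PInst :: "nat \<Rightarrow> memory \<Rightarrow> (node \<times> node) set \<Rightarrow> nat \<Rightarrow> nat \<Rightarrow> nat \<Rightarrow> nat \<Rightarrow> bool" where
  "PInst b m tg L \<tau> t z \<longleftrightarrow> (\<exists>rs pm. hist rs tg \<and> length rs \<le> L \<and> inst rs \<tau> pm \<and>
     holds_mem b S m pm \<and> t \<le> 40 * \<tau> + z)"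

definition Inst :: "nat \<Rightarrow> memory \<Rightarrow> (node \<times> node) set \<Rightarrow> nat \<Rightarrow> nat \<Rightarrow> nat \<Rightarrow> bool" where
  "Inst b m tg L t z \<longleftrightarrow> (\<exists>\<tau>. PInst b m tg L \<tau> t z)"

lemma Inst_mono: "Inst b m tg L t z \<Longrightarrow> L \<le> L' \<Longrightarrow> t' + z \<le> t + z' \<Longrightarrow> Inst b m tg L' t' z'"
  unfolding Inst_def PInst_def by (fastforce intro: order_trans)

lemma Inst_edges: "Inst b m tg L t z \<Longrightarrow> tg \<subseteq> edges d q"
  by (auto simp: Inst_def PInst_def history_def)

lemma Inst_upd_var: "v < 40 \<Longrightarrow> Inst b (m(v := x)) tg L t z = Inst b m tg L t z"
  by (simp add: Inst_def PInst_def holds_mem_def)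

definition REQ :: "aexp list \<Rightarrow> com" where
  "REQ es = Seq (WR 0 es) (Seq (Assign (Lit 0) (Lit 0)) (trC p))"

text \<open>The simulation is charged to \<open>\<tau>\<close>, so \<open>z\<close> only pays for at
  most four buffer cells and the pointer: \<open>4 * 150 + 1 + 150\<close>, rounded up to
  1000.\<close>

lemma wp_REQ:
  assumes es: "length es \<le> 4" "\<forall>e\<in>set es. esz e \<le> 60 \<and> stable e \<and> aval m e < X"
    and r: "map (aval m) es = enc_request r" "\<And>rs. hist rs tg \<Longrightarrow> hist (rs @ [r]) tg'"
    and I: "Inst b m tg L t z" and b: "m 10 = b" "b + S \<le> X"
  shows "wp (REQ es) m t (\<lambda>m' t'. same_above 2 b S m m' \<and> Inst b m' tg' (L + 1) t' (z + 1000) \<and>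
    (r = Query \<longrightarrow> is_max q (edge_graph d q (current_edges md d q tg')) (m' 1)))"
  unfolding REQ_def
proof (rule wp_Seq, rule wp_WR)
  fix m1 assume m1: "same_above 0 0 0 m m1" "\<forall>i<length es. m1 (ad 5 (0 + i)) = aval m (es ! i)"
  obtain rs pm \<tau> where *: "hist rs tg" "length rs \<le> L" "inst rs \<tau> pm" "holds_mem b S m pm" "t \<le> 40 * \<tau> + z"
    using I by (auto simp: Inst_def PInst_def)
  obtain u pm' xs ys where ex: "exec S p (pm, enc_request r, []) u (pm', xs, ys)" "inst (rs @ [r]) (\<tau> + u) pm'"
    "r = Query \<Longrightarrow> \<exists>y. ys = [y] \<and> is_max q (edge_graph d q (current_edges md d q tg')) y"
    using inst_snoc[OF *(3) r(2)[OF *(1)]] by metis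
  let ?m = "m1(0 := 0)"
  have len: "length (enc_request r) = length es" using r(1) by (metis length_map)
  have "wp (trC p) ?m (t + 150 * length es + 1 + 150) (\<lambda>m' t'. same_above 2 b S m m' \<and> Inst b m' tg' (L + 1) t' (z + 1000) \<and>
    (r = Query \<longrightarrow> is_max q (edge_graph d q (current_edges md d q tg')) (m' 1)))"
  proof (rule wp_simulation[OF ex(1), where b = b and L = 4])
    show "b + S \<le> X" "4 < X" using b X100 by auto
    show "?m 10 = b" using same_above_var[OF m1(1), of 10] b by simp
    show "holds_mem b S ?m pm" using same_above_0_mem[OF m1(1) *(4)] by (simp add: holds_mem_def)
    show "\<forall>k<length (enc_request r). ?m (ad 5 (?m 0 + k)) = enc_request r ! k"
      using m1(2) len by (auto simp flip: r(1))
    show "?m 0 + length (enc_request r) \<le> 4" using len es by simp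
    fix m' assume m': "small m'" "holds_mem b S m' pm'" "(ys \<noteq> [] \<Longrightarrow> m' 1 = last ys)" "same_above 2 b S ?m m'"
    have "same_above 2 b S m ?m" using same_above_0[OF m1(1)] by (intro same_above_upd_var) auto
    then have "same_above 2 b S m m'" using m'(4) by (rule same_above_trans)
    moreover have "Inst b m' tg' (L + 1) (t + 150 * length es + 1 + 150 + 40 * u) (z + 1000)"
      unfolding Inst_def PInst_def using r(2)[OF *(1)] *(2,5) ex(2) m'(2) es(1)
      by (intro exI[of _ "\<tau> + u"] exI[of _ "rs @ [r]"] exI[of _ pm']) auto
    ultimately show "same_above 2 b S m m' \<and> Inst b m' tg' (L + 1) (t + 150 * length es + 1 + 150 + 40 * u) (z + 1000) \<and>
      (r = Query \<longrightarrow> is_max q (edge_graph d q (current_edges md d q tg')) (m' 1))"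
      using ex(3) m'(3) by auto
  qed
  then show "wp (Seq (Assign (Lit 0) (Lit 0)) (trC p)) m1 (t + 150 * length es + 1) (\<lambda>m' t'. same_above 2 b S m m' \<and> Inst b m' tg' (L + 1) t' (z + 1000) \<and>
    (r = Query \<longrightarrow> is_max q (edge_graph d q (current_edges md d q tg')) (m' 1)))"
    using X100 by (auto intro!: wp_Seq wp_Assign)
qed (use es in auto)

definition TOG :: "port \<Rightarrow> port \<Rightarrow> com" where
  "TOG u v = REQ (if md = Incremental then [Lit 0, portE u, portE v, capE d u v] else [Lit 1, portE u, portE v])"

lemma wp_TOG:
  assumes I: "Inst b m tg L t z" and b: "m 10 = b" "b + S \<le> X" and m: "m 11 = q"
    and e: "e = (port_node (m 3) (m 2) u, port_node (m 3) (m 2) v)" "e \<in> edges d q" "e \<notin> tg"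
  shows "wp (TOG u v) m t (\<lambda>m' t'. same_above 2 b S m m' \<and> Inst b m' (insert e tg) (L + 1) t' (z + 1000))"
proof -
  let ?x = "port_node (m 3) (m 2) u" and ?y = "port_node (m 3) (m 2) v"
  have v: "valid_node q ?x" "valid_node q ?y" using edges_nodes[OF _ q2] e by auto
  then have c: "fst u < 7" "fst v < 7" by (auto simp: valid_node_def)
  have lt: "enc q ?x < X" "enc q ?y < X" using enc_less[OF v(1)] enc_less[OF v(2)] X_sizes by linarith+
  have cap: "edge_cap d q ?x ?y < X" using X_sizes X100 by (simp add: edge_cap_def)
  show ?thesis unfolding TOG_def
  proof (rule wp_conseq[OF wp_REQ[where r = "toggle md d q e", OF _ _ _ _ I b]])
    show "length (if md = Incremental then [Lit 0, portE u, portE v, capE d u v] else [Lit 1, portE u, portE v]) \<le> 4"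
      by simp
    show "\<forall>e\<in>set (if md = Incremental then [Lit 0, portE u, portE v, capE d u v] else [Lit 1, portE u, portE v]).
       esz e \<le> 60 \<and> stable e \<and> aval m e < X"
      using c lt cap esz_portE stable_portE X100 by (auto simp: aval_portE[of m q, OF m] aval_capE[of m q, OF m])
    show "map (aval m) (if md = Incremental then [Lit 0, portE u, portE v, capE d u v] else [Lit 1, portE u, portE v]) =
       enc_request (toggle md d q e)"
      by (simp add: toggle_def e(1) aval_portE[of m q, OF m] aval_capE[of m q, OF m])
    show "hist (rs @ [toggle md d q e]) (insert e tg)" if "hist rs tg" for rs
      using history_toggle[OF that e(2,3) q2 cap_le] .
  qed auto
qed

definition QRY :: com where "QRY = REQ [Lit 2]"

lemma wp_QRY:
  assumes I: "Inst b m tg L t z" and b: "m 10 = b" "b + S \<le> X"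
  shows "wp QRY m t (\<lambda>m' t'. same_above 2 b S m m' \<and> Inst b m' tg (L + 1) t' (z + 1000) \<and>
    is_max q (edge_graph d q (current_edges md d q tg)) (m' 1))"
  unfolding QRY_def
  by (rule wp_conseq[OF wp_REQ[where r = Query, OF _ _ _ _ I b]])
     (use X100 stable_portE history_Query in auto)

fun TPLS :: "template list \<Rightarrow> com" where
  "TPLS [] = Skip"
| "TPLS ((cn, u, v) # ts) = Seq (Cond (cndE cn) (TOG u v) Skip) (TPLS ts)"

lemma pairs_Cons: "pairs M Vb D ((cn, u, v) # ts) o' x =
    (if cnd_holds M Vb D o' x cn then [(port_node o' x u, port_node o' x v)] else []) @ pairs M Vb D ts o' x"
  by (simp add: pairs_def)

text \<open>Each template is charged 1100: 1000 for a request and 70 for the test of its condition,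
  rounded up.\<close>

lemma wp_TPLS:
  assumes "Inst b m tg L t z" "m 10 = b" "b + S \<le> X" "m 11 = q"
    "\<forall>(cn, u, v) \<in> set ts. agrees q m M Vb D cn"
    "fresh d q (pairs M Vb D ts (m 3) (m 2)) tg"
  shows "wp (TPLS ts) m t (\<lambda>m' t'. same_above 2 b S m m' \<and>
    Inst b m' (tg \<union> set (pairs M Vb D ts (m 3) (m 2))) (L + length ts) t' (z + 1100 * length ts + 1))"
  using assms
proof (induction ts arbitrary: m tg L t z)
  case Nil
  show ?case using Inst_mono[OF Nil.prems(1), of L "t + 1" "z + 1"]
    by (auto simp: pairs_def intro!: wp_Skip same_above_refl)
next
  case (Cons tp ts)
  obtain cn u v where tp: "tp = (cn, u, v)" by (cases tp) auto
  let ?e = "(port_node (m 3) (m 2) u, port_node (m 3) (m 2) v)"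
  define es where "es = (if cnd_holds M Vb D (m 3) (m 2) cn then [?e] else [])"
  have ps: "pairs M Vb D (tp # ts) (m 3) (m 2) = es @ pairs M Vb D ts (m 3) (m 2)"
    by (simp add: tp pairs_Cons es_def)
  have fr: "fresh d q es tg" "fresh d q (pairs M Vb D ts (m 3) (m 2)) (tg \<union> set es)"
    using Cons.prems(6) unfolding ps fresh_append by auto
  have ag: "agrees q m M Vb D cn" using Cons.prems(5) tp by auto
  note cn = cndE[OF Cons.prems(4) ag]
  have head: "wp (Cond (cndE cn) (TOG u v) Skip) m t
     (\<lambda>m' t'. same_above 2 b S m m' \<and> Inst b m' (tg \<union> set es) (L + 1) t' (z + 1100))"
  proof (rule wp_Cond)
    show "esz (cndE cn) \<le> 64" using esz_cndE[of cn] by simp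
    assume "aval m (cndE cn) \<noteq> 0"
    then have es: "es = [?e]" using cn by (simp add: es_def)
    have I: "Inst b m tg L (t + 70) (z + 70)" using Cons.prems(1) by (rule Inst_mono) auto
    show "wp (TOG u v) m (t + 70) (\<lambda>m' t'. same_above 2 b S m m' \<and> Inst b m' (tg \<union> set es) (L + 1) t' (z + 1100))"
      by (rule wp_conseq[OF wp_TOG[OF I Cons.prems(2-4) refl]])
         (use fr(1) in \<open>auto simp: es fresh_def elim: Inst_mono\<close>)
  next
    assume "aval m (cndE cn) = 0"
    then have "es = []" using cn by (simp add: es_def)
    then show "wp Skip m (t + 70) (\<lambda>m' t'. same_above 2 b S m m' \<and> Inst b m' (tg \<union> set es) (L + 1) t' (z + 1100))"
      using Cons.prems(1) by (auto intro!: wp_Skip same_above_refl elim: Inst_mono)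
  qed
  show ?case unfolding tp TPLS.simps
  proof (rule wp_Seq, rule wp_conseq[OF head], elim conjE)
    fix m1 t1 assume s1: "same_above 2 b S m m1" and I1: "Inst b m1 (tg \<union> set es) (L + 1) t1 (z + 1100)"
    have v: "m1 10 = b" "m1 11 = q" "m1 3 = m 3" "m1 2 = m 2"
      using same_above_var[OF s1] Cons.prems(2,4) by auto
    show "wp (TPLS ts) m1 t1 (\<lambda>m' t'. same_above 2 b S m m' \<and>
        Inst b m' (tg \<union> set (pairs M Vb D ((cn, u, v) # ts) (m 3) (m 2))) (L + length ((cn, u, v) # ts)) t'
          (z + 1100 * length ((cn, u, v) # ts) + 1))"
    proof (rule wp_conseq[OF Cons.IH[OF I1 v(1) Cons.prems(3) v(2)]])
      show "\<forall>(cn, u, v)\<in>set ts. agrees q m1 M Vb D cn"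
        using Cons.prems(5) agrees_same[OF s1] by auto
      show "fresh d q (pairs M Vb D ts (m1 3) (m1 2)) (tg \<union> set es)" using fr(2) v by simp
      fix m' t' assume *: "same_above 2 b S m1 m' \<and> Inst b m' (tg \<union> set es \<union> set (pairs M Vb D ts (m1 3) (m1 2)))
          (L + 1 + length ts) t' (z + 1100 + 1100 * length ts + 1)"
      then show "same_above 2 b S m m' \<and>
        Inst b m' (tg \<union> set (pairs M Vb D ((cn, u, v) # ts) (m 3) (m 2))) (L + length ((cn, u, v) # ts)) t'
          (z + 1100 * length ((cn, u, v) # ts) + 1)"
        using same_above_trans[OF s1] ps[unfolded tp] v by (simp add: Un_assoc add.assoc)
    qed
  qed
qed

definition SCR :: "template list \<Rightarrow> com" where
  "SCR ts = FOR 2 (V 11) (TPLS ts)"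

lemma wp_SCR:
  assumes I: "Inst b m tg L t z" and b: "m 10 = b" "b + S \<le> X" and q: "m 11 = q"
    and ag: "\<forall>(cn, u, v) \<in> set ts. agrees q m M Vb D cn"
    and fr: "fresh d q (script M Vb D ts (m 3) q) tg"
  shows "wp (SCR ts) m t (\<lambda>m' t'. same_above 3 b S m m' \<and>
    Inst b m' (tg \<union> set (script M Vb D ts (m 3) q)) (L + length ts * q) t' (z + 220 + (1100 * length ts + 300) * q))"
proof -
  let ?I = "\<lambda>k m1 t1. m1 2 = k \<and> same_above 3 b S m m1 \<and>
      Inst b m1 (tg \<union> set (script M Vb D ts (m 3) k)) (L + length ts * k) t1 (z + 150 + (1100 * length ts + 300) * k)"
  show ?thesis unfolding SCR_def
  proof (rule wp_FOR[where n = q and I = ?I])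
    show "q < X" using X_sizes by simp
    show "?I 0 (m(2 := 0)) (t + 150)"
      using I by (auto simp: script_def Inst_upd_var intro!: same_above_upd_var same_above_refl elim: Inst_mono)
  next
    fix k m1 t1 assume k: "k < q" and "small m1" and "?I k m1 t1"
    then have m1: "m1 2 = k" "same_above 3 b S m m1"
      and I1: "Inst b m1 (tg \<union> set (script M Vb D ts (m 3) k)) (L + length ts * k) t1 (z + 150 + (1100 * length ts + 300) * k)"
      by auto
    have v: "m1 10 = b" "m1 11 = q" "m1 3 = m 3" using same_above_var[OF m1(2)] b q by auto
    have I2: "Inst b m1 (tg \<union> set (script M Vb D ts (m 3) k)) (L + length ts * k) (t1 + 70) (z + 220 + (1100 * length ts + 300) * k)"
      using I1 by (rule Inst_mono) auto
    have "[0..<q] = [0..<Suc k] @ [Suc k..<q]" using k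
      by (metis Suc_leI le0 upt_add_eq_append le_add_diff_inverse)
    then have "script M Vb D ts (m 3) q = script M Vb D ts (m 3) k @ pairs M Vb D ts (m 3) k @
        concat (map (pairs M Vb D ts (m 3)) [Suc k..<q])"
      by (simp add: script_def)
    then have fr1: "fresh d q (pairs M Vb D ts (m1 3) (m1 2)) (tg \<union> set (script M Vb D ts (m 3) k))"
      using fr v m1(1) by (simp add: fresh_append)
    have sc: "set (script M Vb D ts (m 3) (Suc k)) = set (script M Vb D ts (m 3) k) \<union> set (pairs M Vb D ts (m 3) k)"
      by (simp add: script_def)
    show "wp (TPLS ts) m1 (t1 + 70) (\<lambda>m' t'. m' 2 = k \<and> ?I (Suc k) (m'(2 := Suc k)) (t' + 150))"
    proof (rule wp_conseq[OF wp_TPLS[OF I2 v(1) b(2) v(2) _ fr1]])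
      show "\<forall>(cn, u, v)\<in>set ts. agrees q m1 M Vb D cn" using ag agrees_same[OF m1(2)] by auto
      fix m' t' assume *: "same_above 2 b S m1 m' \<and> Inst b m' (tg \<union> set (script M Vb D ts (m 3) k) \<union> set (pairs M Vb D ts (m1 3) (m1 2)))
         (L + length ts * k + length ts) t' (z + 220 + (1100 * length ts + 300) * k + 1100 * length ts + 1)"
      then have "same_above 3 b S m m'" using same_above_trans[OF m1(2)] same_above_mono[of 2 b S m1 m' 3] by simp
      moreover have "Inst b m' (tg \<union> set (script M Vb D ts (m 3) (Suc k))) (L + length ts * Suc k) (t' + 150)
          (z + 150 + (1100 * length ts + 300) * Suc k)"
      proof (rule Inst_mono)
        show "Inst b m' (tg \<union> set (script M Vb D ts (m 3) (Suc k))) (L + length ts * k + length ts) t'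
            (z + 220 + (1100 * length ts + 300) * k + 1100 * length ts + 1)"
          using * v m1(1) by (simp add: sc Un_assoc)
      qed (auto simp: algebra_simps)
      ultimately show "m' 2 = k \<and> ?I (Suc k) (m'(2 := Suc k)) (t' + 150)"
        using * m1(1) v same_above_var[of 2 b S m1 m' 2]
        by (simp add: Inst_upd_var same_above_upd_var)
    qed
  next
    fix k m1 t1 assume "?I k m1 t1"
    then show "m1 2 = k \<and> aval m1 (V 11) = q" using same_above_var[of 3 b S m m1 11] q by auto
  next
    fix m1 t1 assume "?I q m1 t1"
    then show "same_above 3 b S m m1 \<and>
      Inst b m1 (tg \<union> set (script M Vb D ts (m 3) q)) (L + length ts * q) (t1 + 70) (z + 220 + (1100 * length ts + 300) * q)"
      using Inst_mono[of b m1 "tg \<union> set (script M Vb D ts (m 3) q)" "L + length ts * q" t1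
          "z + 150 + (1100 * length ts + 300) * q" "L + length ts * q" "t1 + 70" "z + 220 + (1100 * length ts + 300) * q"]
      by simp
  qed auto
qed

end

section \<open>One round\<close>

text \<open>
  Rows are inserted (deleted) one after the other.  The first change of the maximum flow in the
  incremental case, the last one in the decremental case, identifies a hit row.
\<close>

definition active :: "mode \<Rightarrow> nat set \<Rightarrow> nat set \<Rightarrow> nat set" where
  "active md U X = (if md = Incremental then X else U - X)"

text \<open>The record is a row plus one, and 0 means none. Incrementally it is final once set.
  Decrementally it may be wrong while a hit row is active, since nothing is known about changes of
  the flow above the threshold; the fall to the threshold corrects it.\<close>

definition record_ok :: "mode \<Rightarrow> nat set \<Rightarrow> (nat \<Rightarrow> bool) \<Rightarrow> nat set \<Rightarrow> nat \<Rightarrow> bool" where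
  "record_ok md U h X \<rho> \<longleftrightarrow> (\<exists>i\<in>U. \<rho> = Suc i \<and> h i) \<or>
     (if md = Incremental then \<rho> = 0 \<and> (\<forall>i\<in>X. \<not> h i)
      else (\<exists>i\<in>U - X. h i) \<or> \<rho> = 0 \<and> (\<forall>i\<in>U. \<not> h i))"

text \<open>If the threshold is crossed between two consecutive answers, the row toggled in between
  is hit. Incrementally the first change is such a crossing, decrementally the last one.\<close>

lemma record_ok_step:
  fixes K :: real
  assumes "k \<in> U" "X \<subseteq> U" "k \<notin> X" "record_ok md U h X \<rho>"
    and "if \<exists>i\<in>active md U X. h i then K < p else p = K"
    and "if \<exists>i\<in>active md U (insert k X). h i then K < y else y = K"
  shows "record_ok md U h (insert k X) (if y = p \<or> (md = Incremental \<and> \<rho> \<noteq> 0) then \<rho> else Suc k)"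
proof (cases "md = Incremental")
  case True
  then show ?thesis
    using assms by (auto simp: record_ok_def active_def split: if_splits)
next
  case False
  then show ?thesis
    using assms by (auto simp: record_ok_def active_def split: if_splits)
qed

context driver
begin

definition RECORD :: com where
  "RECORD = (if md = Incremental then Cond (V 5) Skip (Assign (Lit 5) (Op Plus (V 2) (Lit 1)))
     else Assign (Lit 5) (Op Plus (V 2) (Lit 1)))"

definition ROW :: com where
  "ROW = Seq (TOG (3, Outer) (1, Inner)) (Seq QRY
     (Cond (Op Eq (V 1) (V 4)) Skip (Seq RECORD (Assign (Lit 4) (V 1)))))"

lemma wp_RECORD:
  assumes "m 2 < q" and Q: "Q (m(5 := if md = Incremental \<and> m 5 \<noteq> 0 then m 5 else Suc (m 2))) (t + 300)"
    and mono: "\<And>m t t'. Q m t \<Longrightarrow> t' \<le> t \<Longrightarrow> Q m t'"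
  shows "wp RECORD m t Q"
proof -
  have "m 2 + 1 < X" using assms(1) X_sizes by simp
  moreover have "Q (m(5 := if md = Incremental \<and> m 5 \<noteq> 0 then m 5 else Suc (m 2))) (t + k)" if "k \<le> 300" for k
    using Q by (rule mono) (use that in simp)
  note this[of 71] this[of 220] this[of 150]
  ultimately show ?thesis
    unfolding RECORD_def
    by (auto intro!: wp_Cond wp_Skip wp_Assign simp: add.commute[of _ t] split: if_splits)
qed

definition SCAN :: com where
  "SCAN = FOR 2 (V 11) (Cond (Cell (AD 2 (row_index (V 2)))) Skip ROW)"

definition detects :: "(node \<times> node) set \<Rightarrow> nat \<Rightarrow> nat set \<Rightarrow> (nat \<Rightarrow> bool) \<Rightarrow> real \<Rightarrow> bool" where
  "detects tg r U h K \<longleftrightarrow> (\<forall>X y. X \<subseteq> U \<longrightarrow>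
     is_max q (edge_graph d q (current_edges md d q (tg \<union> row_pairs r X))) y \<longrightarrow>
     (if \<exists>i\<in>active md U X. h i then K < real y else real y = K))"

lemma wp_ROW:
  fixes Y :: "nat set"
  assumes I: "Inst b m (tg \<union> row_pairs r Y) L t z" and b: "m 10 = b" "b + S \<le> X"
    and v: "m 11 = q" "m 3 = r" "m 2 = k" "k < q" "r < q"
    and U: "k \<in> U" "Y \<subseteq> U" "k \<notin> Y" "((3,r),(1,k)) \<notin> tg"
    and det: "detects tg r U h K"
    and rec: "record_ok md U h Y (m 5)" "if \<exists>i\<in>active md U Y. h i then K < real (m 4) else real (m 4) = K"
  shows "wp ROW m t (\<lambda>m' t'. same_above 6 b S m m' \<and> m' 3 = r \<and> m' 2 = k \<and>
    Inst b m' (tg \<union> row_pairs r (insert k Y)) (L + 2) t' (z + 2800) \<and>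
    record_ok md U h (insert k Y) (m' 5) \<and>
    (if \<exists>i\<in>active md U (insert k Y). h i then K < real (m' 4) else real (m' 4) = K))"
    (is "wp ROW m t ?Q")
proof -
  have ins: "insert ((3,r),(1,k)) (tg \<union> row_pairs r Y) = tg \<union> row_pairs r (insert k Y)"
    by (auto simp: row_pairs_def)
  have new: "((3,r),(1,k)) \<notin> tg \<union> row_pairs r Y" using U by (auto simp: row_pairs_def)
  have e: "((3,r),(1,k)) = (port_node (m 3) (m 2) (3, Outer), port_node (m 3) (m 2) (1, Inner))"
    using v by simp
  have ed: "((3,r),(1,k)) \<in> edges d q" using v by (simp del: One_nat_def)
  have sub: "insert k Y \<subseteq> U" using U by simp
  show ?thesis unfolding ROW_def
  proof (rule wp_Seq, rule wp_conseq[OF wp_TOG[OF I b v(1) e ed new]], elim conjE)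
    fix m1 t1 assume s1: "same_above 2 b S m m1"
      and I1: "Inst b m1 (insert ((3,r),(1,k)) (tg \<union> row_pairs r Y)) (L + 1) t1 (z + 1000)"
    have b1: "m1 10 = b" using same_above_var[OF s1, of 10] b by simp
    note I1 = I1[unfolded ins]
    show "wp (Seq QRY (Cond (Op Eq (V 1) (V 4)) Skip (Seq RECORD (Assign (Lit 4) (V 1))))) m1 t1 ?Q"
    proof (rule wp_Seq, rule wp_conseq[OF wp_QRY[OF I1 b1 b(2)]], elim conjE)
      fix m2 t2 assume s2: "same_above 2 b S m1 m2" and I2: "Inst b m2 (tg \<union> row_pairs r (insert k Y)) (L + 1 + 1) t2 (z + 1000 + 1000)"
        and mx: "is_max q (edge_graph d q (current_edges md d q (tg \<union> row_pairs r (insert k Y)))) (m2 1)"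
      have s: "same_above 2 b S m m2" using s1 s2 by (rule same_above_trans)
      have v2: "m2 3 = r" "m2 2 = k" "m2 4 = m 4" "m2 5 = m 5"
        using same_above_var[OF s] v by auto
      have y: "if \<exists>i\<in>active md U (insert k Y). h i then K < real (m2 1) else real (m2 1) = K"
        using det sub mx unfolding detects_def by blast
      note step = record_ok_step[OF U(1-3) rec y]
      have s6: "same_above 6 b S m m2" using s by (rule same_above_mono) simp
      have I3: "Inst b m2 (tg \<union> row_pairs r (insert k Y)) (L + 2) t' (z + 2800)" if "t' \<le> t2 + 800" for t'
        using I2 by (rule Inst_mono) (use that in auto)
      show "wp (Cond (Op Eq (V 1) (V 4)) Skip (Seq RECORD (Assign (Lit 4) (V 1)))) m2 t2 ?Q"
      proof (rule wp_Cond)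
        assume "aval m2 (Op Eq (V 1) (V 4)) \<noteq> 0"
        then have eq: "m2 1 = m 4" using v2 by (simp split: if_splits)
        show "wp Skip m2 (t2 + 70) ?Q"
          using step y[unfolded eq] eq v2 s6 I3[of "71 + t2"] by (intro wp_Skip) simp
      next
        assume "aval m2 (Op Eq (V 1) (V 4)) = 0"
        then have ne: "m2 1 \<noteq> m 4" using v2 by (simp split: if_splits)
        show "wp (Seq RECORD (Assign (Lit 4) (V 1))) m2 (t2 + 70) ?Q"
        proof (rule wp_Seq, rule wp_RECORD)
          show "m2 2 < q" using v2 v by simp
          let ?m = "m2(5 := if md = Incremental \<and> m2 5 \<noteq> 0 then m2 5 else Suc (m2 2))"
          have "?Q (?m(4 := m2 1)) t'" if "t' \<le> t2 + 800" for t'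
            using step y ne v2 s6 I3[OF that]
            by (auto simp: Inst_upd_var same_above_upd_var split: if_splits)
          from this[of "t2 + 70 + 300 + 150"] have Q: "?Q (?m(4 := m2 1)) (t2 + 70 + 300 + 150)" by linarith
          have e1: "?m 1 = m2 1" by simp
          show "wp (Assign (Lit 4) (V 1)) ?m (t2 + 70 + 300) ?Q"
          proof (rule wp_Assign)
            show "?Q (?m(aval ?m (Lit 4) := aval ?m (V 1))) (t2 + 70 + 300 + 150)"
              unfolding aval.simps e1 by (rule Q)
            show "small ?m \<Longrightarrow> aval ?m (V 1) < X" by (simp only: aval.simps smallD)
          qed simp_all
          fix m t t' assume "wp (Assign (Lit 4) (V 1)) m t ?Q" "t' \<le> (t :: nat)"
          then show "wp (Assign (Lit 4) (V 1)) m t' ?Q" by (rule wp_time)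
        qed
      qed simp
    qed
  qed
qed

lemma wp_SCAN:
  defines "U \<equiv> \<lambda>m. {i. i < q \<and> \<not> blkF q m i}"
  assumes I: "Inst b m tg L t z" and b: "m 10 = b" "b + S \<le> X"
    and v: "m 11 = q" "m 3 = r" "r < q"
    and new: "\<And>k. k \<in> U m \<Longrightarrow> ((3,r),(1,k)) \<notin> tg"
    and det: "detects tg r (U m) h K"
    and rec: "m 5 = 0" "is_max q (edge_graph d q (current_edges md d q tg)) (m 4)"
  shows "wp SCAN m t (\<lambda>m' t'. same_above 6 b S m m' \<and> m' 3 = r \<and>
    Inst b m' (tg \<union> row_pairs r (U m)) (L + 2 * q) t' (z + 220 + 3100 * q) \<and>
    (m' 5 = 0 \<and> (\<forall>i\<in>U m. \<not> h i) \<or> (\<exists>i\<in>U m. m' 5 = Suc i \<and> h i)))"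
proof -
  let ?I = "\<lambda>k m1 t1. m1 2 = k \<and> same_above 6 b S m m1 \<and> m1 3 = r \<and>
      Inst b m1 (tg \<union> row_pairs r {i\<in>U m. i < k}) (L + 2 * k) t1 (z + 150 + 3100 * k) \<and>
      record_ok md (U m) h {i\<in>U m. i < k} (m1 5) \<and>
      (if \<exists>i\<in>active md (U m) {i\<in>U m. i < k}. h i then K < real (m1 4) else real (m1 4) = K)"
  show ?thesis unfolding SCAN_def
  proof (rule wp_FOR[where n = q and I = ?I])
    show "q < X" using X_sizes by simp
    \<comment> \<open>The query that precedes the scan is the answer for \<open>X = {}\<close>, the
      first one to compare with.\<close>
    have "if \<exists>i\<in>active md (U m) {}. h i then K < real (m 4) else real (m 4) = K"
      using det[unfolded detects_def, THEN spec[of _ "{}"], THEN spec[of _ "m 4"]] rec(2)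
      by (simp add: row_pairs_def)
    moreover have "record_ok md (U m) h {} 0" by (auto simp: record_ok_def)
    moreover have "Inst b m tg L (t + 150) (z + 150)" using I by (rule Inst_mono) auto
    ultimately show "?I 0 (m(2 := 0)) (t + 150)"
      using v rec by (simp add: Inst_upd_var same_above_upd_var same_above_refl row_pairs_def)
  next
    fix k m1 t1 assume "?I k m1 t1"
    then show "m1 2 = k \<and> aval m1 (V 11) = q" using same_above_var[of 6 b S m m1 11] v by simp
  next
    fix k m1 t1 assume k: "k < q" and "?I k m1 t1"
    then have m1: "m1 2 = k" "same_above 6 b S m m1" "m1 3 = r"
      and I1: "Inst b m1 (tg \<union> row_pairs r {i\<in>U m. i < k}) (L + 2 * k) t1 (z + 150 + 3100 * k)"
      and rec1: "record_ok md (U m) h {i\<in>U m. i < k} (m1 5)"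
        "if \<exists>i\<in>active md (U m) {i\<in>U m. i < k}. h i then K < real (m1 4) else real (m1 4) = K" by auto
    have v1: "m1 10 = b" "m1 11 = q" "m1 13 = m 13" using same_above_var[OF m1(2)] b v by auto
    have F: "aval m1 (Cell (AD 2 (row_index (V 2)))) \<noteq> 0 \<longleftrightarrow> blkF q m k"
      using blk_same(3)[OF m1(2), of q] v1 m1(1) by (simp add: blkF_def row_index_def fun_eq_iff)
    let ?Q = "\<lambda>m' t'. m' 2 = k \<and> ?I (Suc k) (m'(2 := Suc k)) (t' + 150)"
    show "wp (Cond (Cell (AD 2 (row_index (V 2)))) Skip ROW) m1 (t1 + 70) ?Q"
    proof (rule wp_Cond)
      show "esz (Cell (AD 2 (row_index (V 2)))) \<le> 64" by (simp add: row_index_def)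
      assume "aval m1 (Cell (AD 2 (row_index (V 2)))) \<noteq> 0"
      then have eq: "{i\<in>U m. i < Suc k} = {i\<in>U m. i < k}" using F by (auto simp: U_def less_Suc_eq)
      have "Inst b m1 (tg \<union> row_pairs r {i\<in>U m. i < k}) (L + 2 * Suc k) (t1 + 70 + 70 + 1 + 150) (z + 150 + 3100 * Suc k)"
        using I1 by (rule Inst_mono) auto
      then show "wp Skip m1 (t1 + 70 + 70) ?Q"
        unfolding eq using m1 rec1 by (intro wp_Skip) (simp add: Inst_upd_var same_above_upd_var)
    next
      assume "aval m1 (Cell (AD 2 (row_index (V 2)))) = 0"
      then have kU: "k \<in> U m" using F k by (auto simp: U_def)
      then have eq: "{i\<in>U m. i < Suc k} = insert k {i\<in>U m. i < k}" by (auto simp: less_Suc_eq)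
      have I2: "Inst b m1 (tg \<union> row_pairs r {i\<in>U m. i < k}) (L + 2 * k) (t1 + 70 + 70) (z + 290 + 3100 * k)"
        using I1 by (rule Inst_mono) auto
      show "wp ROW m1 (t1 + 70 + 70) ?Q"
        unfolding eq
      proof (rule wp_conseq[OF wp_ROW[OF I2 v1(1) b(2) v1(2) m1(3,1) k v(3) kU _ _ new[OF kU] det rec1]])
        fix m' t' assume *: "same_above 6 b S m1 m' \<and> m' 3 = r \<and> m' 2 = k \<and>
          Inst b m' (tg \<union> row_pairs r (insert k {i\<in>U m. i < k})) (L + 2 * k + 2) t' (z + 290 + 3100 * k + 2800) \<and>
          record_ok md (U m) h (insert k {i\<in>U m. i < k}) (m' 5) \<and>
          (if \<exists>i\<in>active md (U m) (insert k {i\<in>U m. i < k}). h i then K < real (m' 4) else real (m' 4) = K)"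
        have "same_above 6 b S m m'" using same_above_trans[OF m1(2)] * by blast
        moreover have "Inst b m' (tg \<union> row_pairs r (insert k {i\<in>U m. i < k})) (L + 2 * Suc k) (t' + 150) (z + 150 + 3100 * Suc k)"
          using * by (auto intro: Inst_mono)
        ultimately show "m' 2 = k \<and> (m'(2 := Suc k)) 2 = Suc k \<and> same_above 6 b S m (m'(2 := Suc k)) \<and> (m'(2 := Suc k)) 3 = r \<and>
        Inst b (m'(2 := Suc k)) (tg \<union> row_pairs r (insert k {i\<in>U m. i < k})) (L + 2 * Suc k) (t' + 150) (z + 150 + 3100 * Suc k) \<and>
        record_ok md (U m) h (insert k {i\<in>U m. i < k}) ((m'(2 := Suc k)) 5) \<and>
        (if \<exists>i\<in>active md (U m) (insert k {i\<in>U m. i < k}). h i then K < real ((m'(2 := Suc k)) 4) else real ((m'(2 := Suc k)) 4) = K)"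
          using * by (simp add: Inst_upd_var same_above_upd_var)
      qed auto
    qed
  next
    fix m1 t1 assume *: "?I q m1 t1"
    have eq: "{i\<in>U m. i < q} = U m" by (auto simp: U_def)
    have r: "record_ok md (U m) h (U m) (m1 5)" and I1: "Inst b m1 (tg \<union> row_pairs r (U m)) (L + 2 * q) t1 (z + 150 + 3100 * q)"
      using * unfolding eq by blast+
    \<comment> \<open>All rows have been toggled, so decrementally none is active any more and the
      record is no longer provisional.\<close>
    have "m1 5 = 0 \<and> (\<forall>i\<in>U m. \<not> h i) \<or> (\<exists>i\<in>U m. m1 5 = Suc i \<and> h i)"
      using r unfolding record_ok_def by (cases md) auto
    moreover have "Inst b m1 (tg \<union> row_pairs r (U m)) (L + 2 * q) (t1 + 70) (z + 220 + 3100 * q)"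
      using I1 by (rule Inst_mono) auto
    ultimately show "same_above 6 b S m m1 \<and> m1 3 = r \<and>
      Inst b m1 (tg \<union> row_pairs r (U m)) (L + 2 * q) (t1 + 70) (z + 220 + 3100 * q) \<and>
      (m1 5 = 0 \<and> (\<forall>i\<in>U m. \<not> h i) \<or> (\<exists>i\<in>U m. m1 5 = Suc i \<and> h i))"
      using * by blast
  qed auto
qed

end

definition flat :: "(nat \<times> nat \<times> nat) list \<Rightarrow> nat list" where
  "flat es = concat (map (\<lambda>(u, v, c). [u, v, c]) es)"

lemma length_flat [simp]: "length (flat es) = 3 * length es"
  by (induction es) (auto simp: flat_def)

lemma flat_append: "flat (es @ es') = flat es @ flat es'"
  by (simp add: flat_def)

text \<open>The offset 4 leaves room for the header of the initial request, which contains the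
  number of edges and is therefore written last.\<close>

definition emitted :: "memory \<Rightarrow> (nat \<times> nat \<times> nat) list \<Rightarrow> bool" where
  "emitted m es \<longleftrightarrow> m 6 = length es \<and> (\<forall>k<3 * length es. m (ad 5 (4 + k)) = flat es ! k)"

lemma emitted_snoc:
  assumes "emitted m es"
  shows "emitted (m(ad 5 (4 + 3 * length es) := a, ad 5 (5 + 3 * length es) := b,
    ad 5 (6 + 3 * length es) := c, 6 := Suc (length es))) (es @ [(a, b, c)])"
proof -
  let ?m = "m(ad 5 (4 + 3 * length es) := a, ad 5 (5 + 3 * length es) := b,
    ad 5 (6 + 3 * length es) := c, 6 := Suc (length es))"
  have "?m (ad 5 (4 + k)) = flat (es @ [(a, b, c)]) ! k" if "k < 3 * Suc (length es)" for k
  proof -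
    have "k < 3 * length es \<or> k = 3 * length es \<or> k = 3 * length es + 1 \<or> k = 3 * length es + 2"
      using that by auto
    then consider "k < 3 * length es" | "k = 3 * length es" | "k = 3 * length es + 1" | "k = 3 * length es + 2"
      by blast
    then show ?thesis
      using assms by cases (auto simp: emitted_def flat_append nth_append flat_def[of "[(a, b, c)]"])
  qed
  then show ?thesis by (simp add: emitted_def)
qed

lemma length_pairs: "length (pairs M Vb D ts o' x) \<le> length ts"
  unfolding pairs_def by simp

lemma length_concat_upt: "(\<And>x. length (f x) \<le> l) \<Longrightarrow> length (concat (map f [0..<k])) \<le> l * k"
  by (induction k) (auto intro: add_mono simp: add.commute)

lemma length_initial_edges: "length (initial_edges md d q) \<le> 11 * q * q"
proof -
  have "length (full_tms d) \<le> 11" by (cases d) auto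
  then have "length (pairs (\<lambda>_ _. False) (\<lambda>_. False) (\<lambda>_. False) (full_tms d) o' x) \<le> 11" for o' x
    using length_pairs by (rule order.trans[rotated])
  then have "length (script (\<lambda>_ _. False) (\<lambda>_. False) (\<lambda>_. False) (full_tms d) o' q) \<le> 11 * q" for o'
    unfolding script_def by (rule length_concat_upt)
  then have "length (full_script d q) \<le> 11 * q * q"
    unfolding full_script_def by (rule length_concat_upt)
  then show ?thesis by (simp add: initial_edges_def)
qed

text \<open>Reduces the time of a script to the atoms \<open>l * q\<close> and \<open>q\<close>, as
  \<open>linarith\<close> needs it.\<close>

lemma script_time: "(1100 * l + 300) * q = 1100 * (l * q) + 300 * (q :: nat)"
  by (simp add: algebra_simps)

context driver
begin

definition ROUND :: com where
  "ROUND = Seq (SCR (open_tms md d)) (Seq QRY (Seq (Assign (Lit 4) (V 1)) (Seq (Assign (Lit 5) (Lit 0))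
     (Seq SCAN (SCR (close_tms md d))))))"

definition blk_hit :: "memory \<Rightarrow> nat \<Rightarrow> bool" where
  "blk_hit m i \<longleftrightarrow> (\<exists>j<q. blkM q m i j \<and> blkV q m j)"

text \<open>The operations are at most \<open>4 * q\<close> to open, one query, \<open>2 * q\<close>
  for the scan and \<open>2 * q\<close> to close; \<open>20 * q\<close> is generous.\<close>

lemma wp_ROUND:
  assumes I: "Inst b m tg L t z" and b: "m 10 = b" "b + S \<le> X"
    and v: "m 11 = q" "m 3 = r" "r < q"
    and cl: "closed_from md d (blkM q m) q (Suc r) tg"
  shows "wp ROUND m t (\<lambda>m' t'. same_above 8 b S m m' \<and>
    (\<exists>tg'. closed_from md d (blkM q m) q r tg' \<and> Inst b m' tg' (L + 20 * q) t' (z + 20000 * q)) \<and>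
    (m' 5 = 0 \<and> (\<forall>i<q. \<not> blkF q m i \<longrightarrow> \<not> blk_hit m i) \<or>
     (\<exists>i<q. m' 5 = Suc i \<and> \<not> blkF q m i \<and> blk_hit m i)))"
    (is "wp ROUND m t ?Q")
proof -
  let ?M = "blkM q m" and ?V = "blkV q m" and ?D = "blkF q m"
  define U where "U = {i. i < q \<and> \<not> ?D i}"
  define os where "os = open_script md d ?V ?D r q"
  define cs where "cs = close_script md d ?V ?D r q"
  define rows where "rows = filter (\<lambda>i. \<not> ?D i) [0..<q]"
  have rows: "distinct rows" "set rows = {i. i < q \<and> \<not> ?D i}" by (auto simp: rows_def)
  have fr: "fresh d q (os @ map (\<lambda>i. ((3,r),(1,i))) rows @ cs) tg"
    and cl': "closed_from md d ?M q r (tg \<union> round_pairs md d ?V ?D r q)"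
    using fresh_round[OF q2 v(3) cl rows, of ?V] unfolding os_def cs_def by auto
  have rs: "set (map (\<lambda>i. ((3,r),(1,i)) :: node \<times> node) rows) = row_pairs r U"
    using rows(2) by (auto simp: row_pairs_def U_def)
  have fr1: "fresh d q os tg" and fr2: "row_pairs r U \<inter> (tg \<union> set os) = {}"
    and fr3: "fresh d q cs (tg \<union> set os \<union> row_pairs r U)"
  proof -
    have *: "fresh d q os tg" "fresh d q (map (\<lambda>i. ((3,r),(1,i))) rows) (tg \<union> set os)"
      "fresh d q cs (tg \<union> set os \<union> set (map (\<lambda>i. ((3,r),(1,i)) :: node \<times> node) rows))"
      using fr unfolding fresh_append by auto
    show "fresh d q os tg" "fresh d q cs (tg \<union> set os \<union> row_pairs r U)" using *(1,3) unfolding rs by auto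
    show "row_pairs r U \<inter> (tg \<union> set os) = {}" using *(2) unfolding fresh_def rs by blast
  qed
  have rp: "round_pairs md d ?V ?D r q = set os \<union> row_pairs r U \<union> set cs"
    by (simp add: round_pairs_def os_def cs_def U_def)
  obtain K where det: "detects (tg \<union> set os) r U (blk_hit m) K"
  proof (rule round_detects[OF q2 v(3) cl Inst_edges[OF I], where D = ?D and V = ?V])
    fix K :: real
    assume K: "\<And>X y. X \<subseteq> {i. i < q \<and> \<not> ?D i} \<Longrightarrow>
      is_max q (edge_graph d q (current_edges md d q (tg \<union> set (open_script md d ?V ?D r q) \<union> row_pairs r X))) y \<Longrightarrow>
      (if \<exists>i \<in> (if md = Incremental then X else {i. i < q \<and> \<not> ?D i} - X). \<exists>j<q. ?M i j \<and> ?V j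
       then real y > K else real y = K)"
    have "detects (tg \<union> set os) r U (blk_hit m) K"
      unfolding detects_def active_def blk_hit_def U_def os_def by (intro allI impI K)
    then show thesis by (rule that)
  qed
  have tl: "length (open_tms md d) \<le> 4" "length (close_tms md d) \<le> 2" by (cases md; cases d; simp)+
  have ag: "\<forall>(cn, u, w)\<in>set (open_tms md d). agrees q m (\<lambda>_ _. False) ?V ?D cn"
    "\<forall>(cn, u, w)\<in>set (close_tms md d). agrees q m (\<lambda>_ _. False) ?V ?D cn"
    by (cases md; cases d; simp)+
  have sc: "script (\<lambda>_ _. False) ?V ?D (open_tms md d) (m 3) q = os"
    "script (\<lambda>_ _. False) ?V ?D (close_tms md d) (m 3) q = cs"
    using v by (simp_all add: os_def cs_def open_script_def close_script_def)
  have q1: "1 \<le> q" using q2 by simp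
  show ?thesis unfolding ROUND_def
  proof (rule wp_Seq, rule wp_conseq[OF wp_SCR[OF I b v(1) ag(1)]], unfold sc, rule fr1, elim conjE)
    fix m1 t1 assume s1: "same_above 3 b S m m1"
      and I1: "Inst b m1 (tg \<union> set os) (L + length (open_tms md d) * q) t1 (z + 220 + (1100 * length (open_tms md d) + 300) * q)"
    have ol: "length (open_tms md d) * q \<le> 4 * q" using tl(1) by simp
    have I1': "Inst b m1 (tg \<union> set os) (L + 4 * q) t1 (z + 220 + 4700 * q)"
      using I1 by (rule Inst_mono) (use ol script_time[of "length (open_tms md d)" q] in linarith)+
    have v1: "m1 10 = b" using same_above_var[OF s1] b by simp
    show "wp (Seq QRY (Seq (Assign (Lit 4) (V 1)) (Seq (Assign (Lit 5) (Lit 0)) (Seq SCAN (SCR (close_tms md d)))))) m1 t1 ?Q"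
    proof (rule wp_Seq, rule wp_conseq[OF wp_QRY[OF I1' v1 b(2)]], elim conjE)
      fix m2 t2 assume s2: "same_above 2 b S m1 m2" and sm2: "small m2"
        and I2: "Inst b m2 (tg \<union> set os) (L + 4 * q + 1) t2 (z + 220 + 4700 * q + 1000)"
        and mx: "is_max q (edge_graph d q (current_edges md d q (tg \<union> set os))) (m2 1)"
      let ?m = "m2(4 := m2 1, 5 := 0)"
      have "same_above 3 b S m m2" using same_above_trans[OF s1 same_above_mono[OF s2]] by simp
      then have s: "same_above 6 b S m ?m" "m2 3 = m 3"
        by (auto intro!: same_above_upd_var elim: same_above_mono simp: same_above_var)
      have blk: "blkM q ?m = ?M" "blkV q ?m = ?V" "blkF q ?m = ?D" using blk_same[OF s(1)] by simp_all
      have I3: "Inst b ?m (tg \<union> set os) (L + 4 * q + 1) (t2 + 150 + 150) (z + 1520 + 4700 * q)"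
        using I2 by (simp add: Inst_upd_var) (erule Inst_mono, auto)
      have "wp (Seq SCAN (SCR (close_tms md d))) ?m (t2 + 150 + 150) ?Q"
      proof (rule wp_Seq, rule wp_conseq[OF wp_SCAN[OF I3 _ b(2), where r = r and h = "blk_hit m" and K = K]], unfold blk U_def[symmetric])
        show "?m 10 = b" "?m 11 = q" "?m 3 = r" "r < q" using same_above_var[OF s(1)] b v s(2) by auto
        show "((3,r),(1,k)) \<notin> tg \<union> set os" if "k \<in> U" for k
          using fr2 that by (auto simp: row_pairs_def)
        show "detects (tg \<union> set os) r U (blk_hit m) K" by (rule det)
        show "?m 5 = 0" "is_max q (edge_graph d q (current_edges md d q (tg \<union> set os))) (?m 4)" using mx by auto
        fix m3 t3 assume *: "same_above 6 b S ?m m3 \<and> m3 3 = r \<and>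
          Inst b m3 (tg \<union> set os \<union> row_pairs r U) (L + 4 * q + 1 + 2 * q) t3 (z + 1520 + 4700 * q + 220 + 3100 * q) \<and>
          (m3 5 = 0 \<and> (\<forall>i\<in>U. \<not> blk_hit m i) \<or> (\<exists>i\<in>U. m3 5 = Suc i \<and> blk_hit m i))"
        then have I4: "Inst b m3 (tg \<union> set os \<union> row_pairs r U) (L + 4 * q + 1 + 2 * q) t3 (z + 1520 + 4700 * q + 220 + 3100 * q)" by blast
        have s3: "same_above 6 b S m m3" using same_above_trans[OF s(1)] * by blast
        have v3: "m3 10 = b" "m3 11 = q" "m3 3 = m 3" using same_above_var[OF s3] b v * by auto
        have ag3: "\<forall>(cn, u, w)\<in>set (close_tms md d). agrees q m3 (\<lambda>_ _. False) ?V ?D cn"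
          using ag(2) agrees_same[OF s3] by auto
        show "wp (SCR (close_tms md d)) m3 t3 ?Q"
        proof (rule wp_conseq[OF wp_SCR[OF I4 v3(1) b(2) v3(2) ag3]], unfold v3(3) sc, rule fr3, elim conjE)
          fix m4 t4 assume s4: "same_above 3 b S m3 m4"
            and I5: "Inst b m4 (tg \<union> set os \<union> row_pairs r U \<union> set cs) (L + 4 * q + 1 + 2 * q + length (close_tms md d) * q) t4
              (z + 1520 + 4700 * q + 220 + 3100 * q + 220 + (1100 * length (close_tms md d) + 300) * q)"
          have ol: "length (close_tms md d) * q \<le> 2 * q" using tl(2) by simp
          have "Inst b m4 (tg \<union> round_pairs md d ?V ?D r q) (L + 20 * q) t4 (z + 20000 * q)"
          proof (rule Inst_mono)
            show "Inst b m4 (tg \<union> round_pairs md d ?V ?D r q) (L + 4 * q + 1 + 2 * q + length (close_tms md d) * q) t4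
              (z + 1520 + 4700 * q + 220 + 3100 * q + 220 + (1100 * length (close_tms md d) + 300) * q)"
              using I5 unfolding rp by (simp only: Un_assoc)
          qed (use ol q1 script_time[of "length (close_tms md d)" q] in linarith)+
          moreover have "same_above 8 b S m m4"
            using same_above_trans[OF same_above_mono[OF s3] same_above_mono[OF s4], of 8] by simp
          moreover have "m4 5 = m3 5" using same_above_var[OF s4] by simp
          moreover have "m3 5 = 0 \<and> (\<forall>i<q. \<not> ?D i \<longrightarrow> \<not> blk_hit m i) \<or> (\<exists>i<q. m3 5 = Suc i \<and> \<not> ?D i \<and> blk_hit m i)"
            using * by (auto simp: U_def)
          ultimately show "?Q m4 t4" using cl' by auto
        qed
      qed
      then show "wp (Seq (Assign (Lit 4) (V 1)) (Seq (Assign (Lit 5) (Lit 0)) (Seq SCAN (SCR (close_tms md d))))) m2 t2 ?Q"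
        using X100 smallD[OF sm2, of 1]
        by (rule_tac wp_Seq, rule_tac wp_Assign, simp, simp, simp, rule_tac wp_Seq, rule_tac wp_Assign) auto
    qed
  qed
qed

section \<open>Setting up an instance\<close>

fun EMITS :: "template list \<Rightarrow> com" where
  "EMITS [] = Skip"
| "EMITS ((cn, u, v) # ts) = Seq (Cond (cndE cn)
     (Seq (Assign (AD 5 (Op Plus (Lit 4) (Op Times (Lit 3) (V 6)))) (portE u))
     (Seq (Assign (AD 5 (Op Plus (Lit 5) (Op Times (Lit 3) (V 6)))) (portE v))
     (Seq (Assign (AD 5 (Op Plus (Lit 6) (Op Times (Lit 3) (V 6)))) (capE d u v))
     (Assign (Lit 6) (Op Plus (V 6) (Lit 1)))))) Skip) (EMITS ts)"

definition triple :: "node \<times> node \<Rightarrow> nat \<times> nat \<times> nat" where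
  "triple = (\<lambda>(x, y). (enc q x, enc q y, edge_cap d q x y))"

definition only_buffer :: "memory \<Rightarrow> memory \<Rightarrow> bool" where
  "only_buffer m m' \<longleftrightarrow> same_above 7 0 0 m m' \<and> m' 2 = m 2 \<and> m' 3 = m 3"

text \<open>The decremental initial graph is a single request, so all its edges must be in the
  buffer before the simulated program starts. It does not depend on the data, whence the restriction
  on the conditions.\<close>

lemma wp_EMITS:
  assumes "m 11 = q" "emitted m es" "length es + length ts < X"
    "\<forall>(cn, u, v) \<in> set ts. cn = Always \<or> cn = AtZero"
    "set (pairs M Vb D ts (m 3) (m 2)) \<subseteq> edges d q"
  shows "wp (EMITS ts) m t (\<lambda>m' t'. only_buffer m m' \<and>
    emitted m' (es @ map triple (pairs M Vb D ts (m 3) (m 2))) \<and> t' \<le> t + 700 * length ts + 1)"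
  using assms
proof (induction ts arbitrary: m es t)
  case Nil
  then show ?case by (auto simp: pairs_def only_buffer_def intro!: wp_Skip same_above_refl)
next
  case (Cons tp ts)
  obtain cn u v where tp: "tp = (cn, u, v)" by (cases tp) auto
  let ?x = "port_node (m 3) (m 2) u" and ?y = "port_node (m 3) (m 2) v"
  define ps where "ps = (if cnd_holds M Vb D (m 3) (m 2) cn then [(?x, ?y)] else [])"
  have pc: "pairs M Vb D (tp # ts) (m 3) (m 2) = ps @ pairs M Vb D ts (m 3) (m 2)"
    by (simp add: tp pairs_Cons ps_def)
  have ag: "agrees q m M Vb D cn" using Cons.prems(4) tp by auto
  note cn = cndE[OF Cons.prems(1) ag]
  have head: "wp (Cond (cndE cn) (Seq (Assign (AD 5 (Op Plus (Lit 4) (Op Times (Lit 3) (V 6)))) (portE u))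
     (Seq (Assign (AD 5 (Op Plus (Lit 5) (Op Times (Lit 3) (V 6)))) (portE v))
     (Seq (Assign (AD 5 (Op Plus (Lit 6) (Op Times (Lit 3) (V 6)))) (capE d u v))
     (Assign (Lit 6) (Op Plus (V 6) (Lit 1)))))) Skip) m t
     (\<lambda>m' t'. only_buffer m m' \<and> emitted m' (es @ map triple ps) \<and> t' \<le> t + 700)"
  proof (rule wp_Cond)
    show "esz (cndE cn) \<le> 64" using esz_cndE[of cn] by simp
    assume "aval m (cndE cn) \<noteq> 0"
    then have h: "cnd_holds M Vb D (m 3) (m 2) cn" using cn by simp
    then have ps: "ps = [(?x, ?y)]" by (simp add: ps_def)
    have e: "(?x, ?y) \<in> edges d q" using Cons.prems(5) pc ps by simp
    have vn: "valid_node q ?x" "valid_node q ?y" using edges_nodes[OF e q2] by auto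
    then have c: "fst u < 7" "fst v < 7" by (auto simp: valid_node_def)
    have lt: "enc q ?x < X" "enc q ?y < X" using enc_less[OF vn(1)] enc_less[OF vn(2)] X_sizes by linarith+
    have cap: "edge_cap d q ?x ?y < X" using X_sizes X100 by (simp add: edge_cap_def)
    have m6: "m 6 = length es" using Cons.prems(2) by (simp add: emitted_def)
    have av: "aval m (portE u) = enc q ?x" "aval m (portE v) = enc q ?y" "aval m (capE d u v) = edge_cap d q ?x ?y"
      using aval_portE[of m q] aval_capE[of m q] Cons.prems(1) by auto
    have st: "aval (m(ad 5 i := a)) (portE v) = aval m (portE v)"
      "aval (m(ad 5 i := a, ad 5 j := a')) (capE d u v) = aval m (capE d u v)" for i j a a'
      using stable_portE by (auto simp: stable_def)
    let ?m = "m(ad 5 (4 + 3 * length es) := enc q ?x, ad 5 (5 + 3 * length es) := enc q ?y,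
      ad 5 (6 + 3 * length es) := edge_cap d q ?x ?y, 6 := Suc (length es))"
    have em: "emitted ?m (es @ map triple ps)"
      using emitted_snoc[OF Cons.prems(2)] by (simp add: ps triple_def)
    have ob: "only_buffer m ?m"
      by (auto simp: only_buffer_def intro!: same_above_upd_var same_above_upd_buf same_above_refl)
    show "wp (Seq (Assign (AD 5 (Op Plus (Lit 4) (Op Times (Lit 3) (V 6)))) (portE u))
     (Seq (Assign (AD 5 (Op Plus (Lit 5) (Op Times (Lit 3) (V 6)))) (portE v))
     (Seq (Assign (AD 5 (Op Plus (Lit 6) (Op Times (Lit 3) (V 6)))) (capE d u v))
     (Assign (Lit 6) (Op Plus (V 6) (Lit 1)))))) m (t + 70)
     (\<lambda>m' t'. only_buffer m m' \<and> emitted m' (es @ map triple ps) \<and> t' \<le> t + 700)"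
      apply (intro wp_Seq wp_Assign)
      using esz_portE(1)[OF c(1)] esz_portE(1)[OF c(2)] esz_portE(2)[of d u v] lt cap em ob Cons.prems(3)
      by (simp_all add: av st m6)
  next
    assume "aval m (cndE cn) = 0"
    then have "ps = []" using cn by (simp add: ps_def)
    then show "wp Skip m (t + 70) (\<lambda>m' t'. only_buffer m m' \<and> emitted m' (es @ map triple ps) \<and> t' \<le> t + 700)"
      using Cons.prems by (auto intro!: wp_Skip simp: only_buffer_def same_above_refl)
  qed
  show ?case unfolding tp EMITS.simps
  proof (rule wp_Seq, rule wp_conseq[OF head], elim conjE)
    fix m1 t1 assume ob: "only_buffer m m1" and em: "emitted m1 (es @ map triple ps)" and t1: "t1 \<le> t + 700"
    have v: "m1 11 = q" "m1 3 = m 3" "m1 2 = m 2"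
      using ob same_above_var[of 7 0 0 m m1 11] Cons.prems(1) by (auto simp: only_buffer_def)
    have ps1: "length ps \<le> 1" by (simp add: ps_def)
    show "wp (EMITS ts) m1 t1 (\<lambda>m' t'. only_buffer m m' \<and>
      emitted m' (es @ map triple (pairs M Vb D ((cn, u, v) # ts) (m 3) (m 2))) \<and> t' \<le> t + 700 * length ((cn, u, v) # ts) + 1)"
    proof (rule wp_conseq[OF Cons.IH[OF v(1) em]])
      show "length (es @ map triple ps) + length ts < X" using Cons.prems(3) ps1 by simp
      show "\<forall>(cn, u, v)\<in>set ts. cn = Always \<or> cn = AtZero" using Cons.prems(4) by auto
      show "set (pairs M Vb D ts (m1 3) (m1 2)) \<subseteq> edges d q" using Cons.prems(5) v unfolding pc by auto
      fix m' t' assume "only_buffer m1 m' \<and> emitted m' ((es @ map triple ps) @ map triple (pairs M Vb D ts (m1 3) (m1 2))) \<and>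
        t' \<le> t1 + 700 * length ts + 1"
      then show "only_buffer m m' \<and>
      emitted m' (es @ map triple (pairs M Vb D ((cn, u, v) # ts) (m 3) (m 2))) \<and> t' \<le> t + 700 * length ((cn, u, v) # ts) + 1"
        using ob t1 v pc[unfolded tp] same_above_trans[of 7 0 0 m m1 m'] by (auto simp: only_buffer_def)
    qed
  qed
qed

end

context driver
begin

definition emit_tms :: "template list" where
  "emit_tms = (if md = Incremental then [] else full_tms d)"

definition EMIT :: com where
  "EMIT = Seq (Assign (Lit 6) (Lit 0)) (FOR 3 (V 11) (FOR 2 (V 11) (EMITS emit_tms)))"

abbreviation emit_script where
  "emit_script o' k \<equiv> script (\<lambda>_ _. False) (\<lambda>_. False) (\<lambda>_. False) emit_tms o' k"

lemma initial_edges_emit: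
  "initial_edges md d q = map triple (concat (map (\<lambda>o'. emit_script o' q) [0..<q]))"
  unfolding emit_tms_def initial_edges_def full_script_def triple_def by (simp add: script_def pairs_def)

lemma emit_tms_length: "length emit_tms \<le> 11"
  unfolding emit_tms_def by (cases d) auto

lemma emit_script_length: "length (emit_script o' k) \<le> 11 * k"
  unfolding script_def
  by (rule length_concat_upt) (use length_pairs emit_tms_length order_trans in blast)

lemma emit_scripts_length: "length (concat (map (\<lambda>o'. emit_script o' q) [0..<k])) \<le> 11 * q * k"
  by (rule length_concat_upt) (rule emit_script_length)

lemma emit_pairs_edges:
  "o' < q \<Longrightarrow> x < q \<Longrightarrow> set (pairs (\<lambda>_ _. False) (\<lambda>_. False) (\<lambda>_. False) emit_tms o' x) \<subseteq> edges d q"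
  using set_full_script[OF q2, of d]
  by (auto simp: emit_tms_def full_script_def script_def pairs_def[of _ _ _ "[]"])

lemma emitted_upd: "v < 6 \<Longrightarrow> emitted (m(v := x)) es = emitted m es"
  by (simp add: emitted_def)

lemma wp_EMIT_row:
  assumes "m 11 = q" "m 3 = o'" "o' < q" "emitted m es" "length es + 11 * q < X"
  shows "wp (FOR 2 (V 11) (EMITS emit_tms)) m t (\<lambda>m' t'. same_above 7 0 0 m m' \<and> m' 3 = o' \<and>
    emitted m' (es @ map triple (emit_script o' q)) \<and> t' \<le> t + 220 + 8000 * q)"
proof -
  let ?I = "\<lambda>k m1 t1. m1 2 = k \<and> same_above 7 0 0 m m1 \<and> m1 3 = o' \<and>
    emitted m1 (es @ map triple (emit_script o' k)) \<and> t1 \<le> t + 150 + 8000 * k"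
  show ?thesis
  proof (rule wp_FOR[where n = q and I = ?I])
    show "q < X" using X_sizes by simp
    show "?I 0 (m(2 := 0)) (t + 150)"
      using assms by (simp add: same_above_upd_var same_above_refl emitted_upd script_def)
  next
    fix k m1 t1 assume "?I k m1 t1"
    then show "m1 2 = k \<and> aval m1 (V 11) = q" using same_above_var[of 7 0 0 m m1 11] assms(1) by simp
  next
    fix k m1 t1 assume k: "k < q" and "?I k m1 t1"
    then have m1: "m1 2 = k" "same_above 7 0 0 m m1" "m1 3 = o'" "t1 \<le> t + 150 + 8000 * k"
      and em: "emitted m1 (es @ map triple (emit_script o' k))" by auto
    have v: "m1 11 = q" using same_above_var[OF m1(2)] assms(1) by simp
    have "11 * Suc k \<le> 11 * q" using k by simp
    then have len: "length (es @ map triple (emit_script o' k)) + length emit_tms < X"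
      using assms(5) emit_script_length[of o' k] emit_tms_length by simp
    show "wp (EMITS emit_tms) m1 (t1 + 70) (\<lambda>m' t'. m' 2 = k \<and> ?I (Suc k) (m'(2 := Suc k)) (t' + 150))"
    proof (rule wp_conseq[OF wp_EMITS[where M = "\<lambda>_ _. False" and Vb = "\<lambda>_. False" and D = "\<lambda>_. False", OF v em len]])
      show "\<forall>(cn, u, v)\<in>set emit_tms. cn = Always \<or> cn = AtZero"
        unfolding emit_tms_def by (cases d) auto
      show "set (pairs (\<lambda>_ _. False) (\<lambda>_. False) (\<lambda>_. False) emit_tms (m1 3) (m1 2)) \<subseteq> edges d q"
        using emit_pairs_edges assms(3) k m1 by simp
      fix m' t' assume *: "only_buffer m1 m' \<and> emitted m' ((es @ map triple (emit_script o' k)) @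
        map triple (pairs (\<lambda>_ _. False) (\<lambda>_. False) (\<lambda>_. False) emit_tms (m1 3) (m1 2))) \<and>
        t' \<le> t1 + 70 + 700 * length emit_tms + 1"
      have "same_above 7 0 0 m m'" using same_above_trans[OF m1(2)] * by (auto simp: only_buffer_def)
      moreover have "emit_script o' (Suc k) = emit_script o' k @ pairs (\<lambda>_ _. False) (\<lambda>_. False) (\<lambda>_. False) emit_tms o' k"
        by (simp add: script_def)
      moreover have "t' + 150 \<le> t + 150 + 8000 * Suc k" using * m1(4) emit_tms_length by simp
      ultimately show "m' 2 = k \<and> ?I (Suc k) (m'(2 := Suc k)) (t' + 150)"
        using * m1 by (simp add: only_buffer_def same_above_upd_var emitted_upd)
    qed
  qed auto
qed

lemma wp_EMIT:
  assumes "m 11 = q"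
  shows "wp EMIT m t (\<lambda>m' t'. same_above 7 0 0 m m' \<and>
    emitted m' (initial_edges md d q) \<and> t' \<le> t + 370 + (8000 * q + 500) * q)"
  unfolding EMIT_def
proof (intro wp_Seq wp_Assign)
  show "wp (FOR 3 (V 11) (FOR 2 (V 11) (EMITS emit_tms))) (m(aval m (Lit 6) := aval m (Lit 0))) (t + 150)
    (\<lambda>m' t'. same_above 7 0 0 m m' \<and> emitted m' (initial_edges md d q) \<and> t' \<le> t + 370 + (8000 * q + 500) * q)"
  proof -
    let ?I = "\<lambda>k m1 t1. m1 3 = k \<and> same_above 7 0 0 m m1 \<and>
      emitted m1 (map triple (concat (map (\<lambda>o'. emit_script o' q) [0..<k]))) \<and> t1 \<le> t + 300 + (8000 * q + 500) * k"
    show ?thesis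
    proof (rule wp_FOR[where n = q and I = ?I])
      show "q < X" using X_sizes by simp
      show "((m(aval m (Lit 6) := aval m (Lit 0)))(3 := 0)) 3 = 0 \<and>
        same_above 7 0 0 m ((m(aval m (Lit 6) := aval m (Lit 0)))(3 := 0)) \<and>
        emitted ((m(aval m (Lit 6) := aval m (Lit 0)))(3 := 0)) (map triple (concat (map (\<lambda>o'. emit_script o' q) [0..<0]))) \<and>
        t + 150 + 150 \<le> t + 300 + (8000 * q + 500) * 0"
        by (auto simp: emitted_def intro!: same_above_upd_var same_above_refl)
    next
      fix k m1 t1 assume "?I k m1 t1"
      then show "m1 3 = k \<and> aval m1 (V 11) = q" using same_above_var[of 7 0 0 m m1 11] assms(1) by simp
    next
      fix k m1 t1 assume k: "k < q" and *: "?I k m1 t1"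
      then have s: "same_above 7 0 0 m m1" by blast
      have v: "m1 11 = q" using same_above_var[OF s] assms(1) by simp
      have "11 * q * Suc k \<le> 11 * q * q" using k by (intro mult_le_mono2) simp
      then have len: "length (map triple (concat (map (\<lambda>o'. emit_script o' q) [0..<k]))) + 11 * q < X"
        using emit_scripts_length[of k] X_sizes by simp
      show "wp (FOR 2 (V 11) (EMITS emit_tms)) m1 (t1 + 70) (\<lambda>m' t'. m' 3 = k \<and> ?I (Suc k) (m'(3 := Suc k)) (t' + 150))"
        by (rule wp_conseq[OF wp_EMIT_row[where m = m1 and o' = k, OF v _ k _ len]])
           (use * same_above_trans[OF s] in \<open>auto simp: same_above_upd_var emitted_upd\<close>)
    next
      fix m1 t1 assume "?I q m1 t1"
      then show "same_above 7 0 0 m m1 \<and> emitted m1 (initial_edges md d q) \<and> t1 + 70 \<le> t + 370 + (8000 * q + 500) * q"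
        unfolding initial_edges_emit by simp
    qed auto
  qed
qed (use X100 in auto)

definition START :: com where
  "START = Seq (Assign (AD 5 (Lit 0)) (Op Times (Lit 7) (V 11)))
    (Seq (Assign (AD 5 (Lit 1)) (Lit 0)) (Seq (Assign (AD 5 (Lit 2)) (Lit 1))
    (Seq (Assign (AD 5 (Lit 3)) (V 6)) (Seq (Assign (Lit 0) (Lit 0)) (trC p)))))"

lemma enc_init_flat: "enc_init n s t es = [n, s, t, length es] @ flat es"
  by (simp add: enc_init_def flat_def)

text \<open>The area of the instance must look like \<open>initial_memory\<close>. All time before
  the start counts as overhead; 750 is the price of five assignments.\<close>

lemma wp_START:
  assumes "m 11 = q" "emitted m (initial_edges md d q)" "m 10 = b" "b + S \<le> X"
    "\<forall>a<S. m (ad 6 (b + a)) = 0"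
  shows "wp START m t (\<lambda>m' t'. same_above 7 b S m m' \<and> Inst b m' {} 0 t' (t + 750))"
proof -
  let ?es = "initial_edges md d q"
  let ?m = "m(ad 5 0 := 7 * q, ad 5 1 := 0, ad 5 2 := 1, ad 5 3 := length ?es, 0 := 0)"
  obtain u pm xs ys where ex: "exec S p (initial_memory, initial_request, []) u (pm, xs, ys)" "inst [] u pm"
    by (rule inst_Nil)
  have m6: "m 6 = length ?es" using assms(2) by (simp add: emitted_def)
  have les: "length ?es \<le> 11 * q * q" by (rule length_initial_edges)
  have s: "same_above 7 b S m ?m"
    by (intro same_above_upd_var same_above_upd_buf same_above_refl) auto
  have "wp (trC p) ?m (t + 750) (\<lambda>m' t'. same_above 7 b S m m' \<and> Inst b m' {} 0 t' (t + 750))"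
  proof (rule wp_simulation[OF ex(1) assms(4), where L = "4 + 3 * length ?es"])
    show "4 + 3 * length ?es < X" using les X_size by simp
    show "?m 10 = b" using assms(3) by simp
    show "holds_mem b S ?m initial_memory" using assms(5) by (simp add: holds_mem_def)
    show "\<forall>k<length initial_request. ?m (ad 5 (?m 0 + k)) = initial_request ! k"
    proof (intro allI impI)
      fix k assume k: "k < length initial_request"
      consider "k = 0" | "k = 1" | "k = 2" | "k = 3" | l where "k = 4 + l"
      proof (cases "k < 4")
        case True
        then have "k = 0 \<or> k = 1 \<or> k = 2 \<or> k = 3" by auto
        then show thesis using that(1-4) by blast
      next
        case False
        then show thesis using that(5)[of "k - 4"] by simp
      qed
      then show "?m (ad 5 (?m 0 + k)) = initial_request ! k"
        using assms(2) k by cases (auto simp: enc_init_flat emitted_def)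
    qed
    show "?m 0 + length initial_request \<le> 4 + 3 * length ?es" by (simp add: enc_init_flat)
    fix m' assume "holds_mem b S m' pm" "same_above 2 b S ?m m'"
    then show "same_above 7 b S m m' \<and> Inst b m' {} 0 (t + 750 + 40 * u) (t + 750)"
      using ex(2) history_Nil same_above_trans[OF s] same_above_mono[of 2 b S ?m m' 7]
      by (auto simp: Inst_def PInst_def intro!: exI[of _ u] exI[of _ "[]"] exI[of _ pm])
  qed
  moreover have "length ?es < X" "7 * q < X" using les X_sizes by linarith+
  ultimately show ?thesis unfolding START_def
    using X100 assms(1) m6 by (intro wp_Seq wp_Assign) (auto simp: ac_simps)
qed

definition LOAD :: com where "LOAD = FOR 3 (V 11) (SCR (init_tms md d))"

text \<open>The matrix enters through ordinary requests, at most 7 for each pair of indices, and is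
  paid for like any other operation.\<close>

lemma wp_LOAD:
  assumes I: "Inst b m {} L t z" and b: "m 10 = b" "b + S \<le> X" and v: "m 11 = q"
  shows "wp LOAD m t (\<lambda>m' t'. same_above 4 b S m m' \<and>
    Inst b m' (set (init_script md d (blkM q m) q)) (L + 7 * q * q) t' (z + 220 + (8000 * q + 600) * q))"
  unfolding LOAD_def
proof (rule wp_FOR[where n = q and I = "\<lambda>k m1 t1. m1 3 = k \<and> same_above 4 b S m m1 \<and>
    Inst b m1 (set (concat (map (\<lambda>o'. script (blkM q m) (\<lambda>_. False) (\<lambda>_. False) (init_tms md d) o' q) [0..<k])))
      (L + 7 * q * k) t1 (z + 150 + (8000 * q + 600) * k)"])
  let ?sc = "\<lambda>o'. script (blkM q m) (\<lambda>_. False) (\<lambda>_. False) (init_tms md d) o' q"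
  let ?I = "\<lambda>k m1 t1. Inst b m1 (set (concat (map ?sc [0..<k]))) (L + 7 * q * k) t1 (z + 150 + (8000 * q + 600) * k)"
  show "q < X" using X_sizes by simp
  show "(m(3 := 0)) 3 = 0 \<and> same_above 4 b S m (m(3 := 0)) \<and> ?I 0 (m(3 := 0)) (t + 150)"
    using Inst_mono[OF I, of L "t + 150" "z + 150"]
    by (simp add: Inst_upd_var same_above_upd_var same_above_refl)
  show "m1 3 = k \<and> aval m1 (V 11) = q" if "m1 3 = k \<and> same_above 4 b S m m1 \<and> ?I k m1 t1" for k m1 t1
    using that same_above_var[of 4 b S m m1 11] v by simp
  show "same_above 4 b S m m1 \<and>
    Inst b m1 (set (init_script md d (blkM q m) q)) (L + 7 * q * q) (t1 + 70) (z + 220 + (8000 * q + 600) * q)"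
    if "m1 3 = q \<and> same_above 4 b S m m1 \<and> ?I q m1 t1" for m1 t1
  proof -
    have "Inst b m1 (set (init_script md d (blkM q m) q)) (L + 7 * q * q) t1 (z + 150 + (8000 * q + 600) * q)"
      using that unfolding init_script_def by blast
    then have "Inst b m1 (set (init_script md d (blkM q m) q)) (L + 7 * q * q) (t1 + 70) (z + 220 + (8000 * q + 600) * q)"
      by (rule Inst_mono) auto
    then show ?thesis using that by blast
  qed
  fix k m1 t1 assume k: "k < q" and "m1 3 = k \<and> same_above 4 b S m m1 \<and> ?I k m1 t1"
  then have m1: "m1 3 = k" "same_above 4 b S m m1" and I1: "?I k m1 t1" by auto
  have v1: "m1 10 = b" "m1 11 = q" using same_above_var[OF m1(2)] b v by auto
  have I2: "Inst b m1 (set (concat (map ?sc [0..<k]))) (L + 7 * q * k) (t1 + 70) (z + 220 + (8000 * q + 600) * k)"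
    using I1 by (rule Inst_mono) auto
  have ag: "\<forall>(cn, u, w)\<in>set (init_tms md d). agrees q m1 (blkM q m) (\<lambda>_. False) (\<lambda>_. False) cn"
    using blk_same(1)[OF m1(2)] by (cases md; cases d) auto
  have "[0..<q] = [0..<k] @ k # [Suc k..<q]" using k 
    by (metis le0 le_add_diff_inverse less_imp_le_nat upt_add_eq_append upt_conv_Cons)
  then have "init_script md d (blkM q m) q = concat (map ?sc [0..<k]) @ ?sc k @ concat (map ?sc [Suc k..<q])"
    by (simp add: init_script_def)
  then have fr: "fresh d q (?sc (m1 3)) (set (concat (map ?sc [0..<k])))"
    using fresh_init[OF q2, of d md "blkM q m"] m1(1) by (simp only: fresh_append Un_empty_left)
  have len: "length (init_tms md d) \<le> 7" by (cases md; cases d) auto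
  show "wp (SCR (init_tms md d)) m1 (t1 + 70) (\<lambda>m' t'. m' 3 = k \<and> (m'(3 := Suc k)) 3 = Suc k \<and>
      same_above 4 b S m (m'(3 := Suc k)) \<and> ?I (Suc k) (m'(3 := Suc k)) (t' + 150))"
  proof (rule wp_conseq[OF wp_SCR[OF I2 v1(1) b(2) v1(2) ag fr]], elim conjE)
    fix m' t' assume s': "same_above 3 b S m1 m'"
      and I3: "Inst b m' (set (concat (map ?sc [0..<k])) \<union> set (?sc (m1 3))) (L + 7 * q * k + length (init_tms md d) * q) t'
        (z + 220 + (8000 * q + 600) * k + 220 + (1100 * length (init_tms md d) + 300) * q)"
    have ol: "length (init_tms md d) * q \<le> 7 * q" using len by (intro mult_le_mono1)
    have "Inst b m' (set (concat (map ?sc [0..<k])) \<union> set (?sc (m1 3))) (L + 7 * q * Suc k) (t' + 150) (z + 150 + (8000 * q + 600) * Suc k)"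
      unfolding mult_Suc_right by (rule Inst_mono[OF I3]) (use ol script_time[of "length (init_tms md d)" q] add_mult_distrib[of "8000 * q" 600 q] in linarith)+
    moreover have "set (concat (map ?sc [0..<Suc k])) = set (concat (map ?sc [0..<k])) \<union> set (?sc (m1 3))"
      using m1(1) by simp
    ultimately have "?I (Suc k) m' (t' + 150)" by simp
    moreover have "same_above 4 b S m m'" using same_above_trans[OF m1(2) same_above_mono[OF s']] by simp
    moreover have "m' 3 = k" using same_above_var[OF s'] m1(1) by simp
    ultimately show "m' 3 = k \<and> (m'(3 := Suc k)) 3 = Suc k \<and>
      same_above 4 b S m (m'(3 := Suc k)) \<and> ?I (Suc k) (m'(3 := Suc k)) (t' + 150)"
      by (simp add: Inst_upd_var same_above_upd_var del: upt_Suc concat.simps map_append concat_append)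
  qed
qed auto

text \<open>A generation is given the area that starts at its number times \<open>S\<close>. No
  earlier generation has touched it, so it is zero without being cleared.\<close>

definition CREATE :: com where
  "CREATE = Seq (Assign (Lit 10) (Op Times (V 16) (V 15))) (Seq EMIT (Seq START LOAD))"

lemma wp_CREATE:
  assumes v: "m 11 = q" "m 15 = S" "m 16 = G" and b: "b = G * S" "b + S < X"
    and zero: "\<forall>a<S. m (ad 6 (b + a)) = 0"
  shows "wp CREATE m t (\<lambda>m' t'. same_above 11 b S m m' \<and> m' 10 = b \<and>
    Inst b m' (set (init_script md d (blkM q m) q)) (7 * q * q) t' (t + 20000 * q * q))"
  unfolding CREATE_def
proof (rule wp_Seq, rule wp_Assign)
  let ?Q = "\<lambda>m' t'. same_above 11 b S m m' \<and> m' 10 = b \<and>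
    Inst b m' (set (init_script md d (blkM q m) q)) (7 * q * q) t' (t + 20000 * q * q)"
  let ?m = "m(aval m (Lit 10) := aval m (Op Times (V 16) (V 15)))"
  have s0: "same_above 11 b S m ?m" "?m 10 = b" using v b by (auto intro!: same_above_upd_var same_above_refl)
  have m11: "?m 11 = q" using same_above_var[OF s0(1)] v by simp
  show "wp (Seq EMIT (Seq START LOAD)) ?m (t + 150) ?Q"
  proof (rule wp_Seq, rule wp_conseq[OF wp_EMIT[where m = ?m, OF m11]], elim conjE)
    fix m1 t1 assume s1: "same_above 7 0 0 ?m m1" and em: "emitted m1 (initial_edges md d q)"
      and t1: "t1 \<le> t + 150 + 370 + (8000 * q + 500) * q"
    have v1: "m1 11 = q" "m1 10 = b" using same_above_var[OF s1] m11 s0(2) by auto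
    have z1: "\<forall>a<S. m1 (ad 6 (b + a)) = 0" using same_above_inst[OF s1] zero by simp
    have s1': "same_above 11 b S m m1"
      using same_above_trans[OF s0(1), of m1] s1 by (simp add: same_above_def)
    show "wp (Seq START LOAD) m1 t1 ?Q"
    proof (rule wp_Seq, rule wp_conseq[OF wp_START[OF v1(1) em v1(2) _ z1]], goal_cases)
      case 1
      then show ?case using b by simp
    next
      case (2 m2 t2)
      then have s2: "same_above 7 b S m1 m2" and I2: "Inst b m2 {} 0 t2 (t1 + 750)" by auto
      have v2: "m2 11 = q" "m2 10 = b" using same_above_var[OF s2] v1 by auto
      have s2': "same_above 11 b S m m2" using same_above_trans[OF s1' same_above_mono[OF s2]] by simp
      have M: "blkM q m2 = blkM q m" using blk_same(1)[OF s2'] by simp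
      show ?case
      proof (rule wp_conseq[OF wp_LOAD[OF I2 v2(2) _ v2(1)]], goal_cases)
        case 1
        then show ?case using b by simp
      next
        case (2 m3 t3)
        then have s3: "same_above 4 b S m2 m3" and I3: "Inst b m3 (set (init_script md d (blkM q m) q)) (0 + 7 * q * q) t3
          (t1 + 750 + 220 + (8000 * q + 600) * q)" unfolding M by auto
        have "2 * q \<le> q * q" "4 \<le> q * q" using q2 mult_le_mono[OF q2 q2] by auto
        moreover have "(8000 * q + 500) * q = 8000 * (q * q) + 500 * q" "(8000 * q + 600) * q = 8000 * (q * q) + 600 * q"
          "20000 * q * q = 20000 * (q * q)" by (simp_all add: algebra_simps)
        ultimately have "t1 + 750 + 220 + (8000 * q + 600) * q \<le> t + 20000 * q * q"
          using t1 by linarith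
        then have "Inst b m3 (set (init_script md d (blkM q m) q)) (7 * q * q) t3 (t + 20000 * q * q)"
          by (intro Inst_mono[OF I3]) auto
        then show ?case using same_above_trans[OF s2' same_above_mono[OF s3]] same_above_var[OF s3] v2 by simp
      qed
    qed
  qed
qed (use v b in auto)

end

section \<open>The instances of all blocks\<close>

lemma sum_fun_upd:
  fixes f :: "nat \<Rightarrow> nat"
  assumes "b < N"
  shows "(\<Sum>i<N. (f(b := v)) i) + f b = (\<Sum>i<N. f i) + v"
proof -
  have "(\<Sum>i<N. (f(b := v)) i) = v + (\<Sum>i\<in>{..<N} - {b}. f i)"
    using assms by (subst sum.remove[of _ b]) (auto intro!: sum.cong)
  moreover have "(\<Sum>i<N. f i) = f b + (\<Sum>i\<in>{..<N} - {b}. f i)"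
    using assms by (subst sum.remove[of _ b]) auto
  ultimately show ?thesis by simp
qed

text \<open>There will be at most \<open>2 * q * n + q * q\<close> generations, so the areas of all
  of them have addresses below \<open>X\<close>.\<close>

locale omv = driver +
  fixes n :: nat
  assumes n1: "n \<ge> 1" and nq: "n \<le> q * q" and X_big: "(2 * q * n + q * q + 2) * S < X"
begin

definition gen :: "memory \<Rightarrow> nat \<Rightarrow> nat" where "gen m bk = m (ad 3 bk)"

definition rem :: "memory \<Rightarrow> nat \<Rightarrow> nat" where "rem m bk = m (ad 4 bk)"

definition block :: "(nat \<Rightarrow> nat \<Rightarrow> bool) \<Rightarrow> nat \<Rightarrow> nat \<Rightarrow> nat \<Rightarrow> bool" where
  "block Mg bk i j \<longleftrightarrow> Mg (bk div q * q + i) (bk mod q * q + j)"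

text \<open>\<open>closed_from\<close> takes a total matrix but sees only indices below
  \<open>q\<close>; hence the quantification over all matrices that agree with the block. With clock
  and overhead 0, \<open>PInst\<close> keeps history and simulated time only: for a resting instance
  the clock is accounted for globally.\<close>

definition inst_ok :: "(nat \<Rightarrow> nat \<Rightarrow> bool) \<Rightarrow> memory \<Rightarrow> (nat \<Rightarrow> nat) \<Rightarrow> nat \<Rightarrow> bool" where
  "inst_ok Mg m \<tau> bk \<longleftrightarrow> gen m bk < m 16 \<and> (\<exists>tg. (\<forall>M. (\<forall>i<q. \<forall>j<q. M i j = block Mg bk i j) \<longrightarrow>
       closed_from md d M q (rem m bk) tg) \<and>
     PInst (gen m bk * S) m tg (7 * q * q + 20 * q * (q - rem m bk)) (\<tau> (gen m bk)) 0 0)"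

text \<open>Bounds the simulated time of a whole generation: \<open>27 = 7 + 20\<close>, for loading
  the matrix and for \<open>q\<close> rounds of \<open>20 * q\<close> operations.\<close>

definition budget :: real where
  "budget = real (7 * q + length (initial_edges md d q) + 27 * q * q) * T"

text \<open>
  The generation of an instance determines its memory area.  \<open>\<tau> g\<close> is the time spent by the flow
  algorithm in generation \<open>g\<close>, and \<open>\<rho>\<close> is the total number of rounds played so far.
\<close>

definition inv :: "(nat \<Rightarrow> nat \<Rightarrow> bool) \<Rightarrow> memory \<Rightarrow> (nat \<Rightarrow> nat) \<Rightarrow> nat \<Rightarrow> nat \<Rightarrow> nat \<Rightarrow> bool" where
  "inv Mg m \<tau> \<rho> e t \<longleftrightarrow> m 11 = q \<and> m 12 = n \<and> m 15 = S \<and>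
     (\<forall>i<q*q. \<forall>j<q*q. (m (ad 0 (i * (q * q) + j)) \<noteq> 0) = Mg i j) \<and>
     (\<forall>bk<q*q. rem m bk \<le> q \<and> (0 < rem m bk \<longrightarrow> inst_ok Mg m \<tau> bk)) \<and>
     (\<forall>bk<q*q. \<forall>bk'<q*q. bk \<noteq> bk' \<longrightarrow> 0 < rem m bk \<longrightarrow> 0 < rem m bk' \<longrightarrow> gen m bk \<noteq> gen m bk') \<and>
     (\<forall>j. m 16 * S \<le> j \<longrightarrow> m (ad 6 j) = 0) \<and> (\<forall>g<m 16. real (\<tau> g) \<le> budget) \<and>
     m 16 * q = \<rho> + (\<Sum>bk<q*q. rem m bk) \<and>
     t \<le> 40 * (\<Sum>g<m 16. \<tau> g) + e + 25000 * q * \<rho> + 25000 * q * q * m 16"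

lemma PInst_cong: "PInst b m tg L \<tau> t z \<Longrightarrow> (\<And>a. a < S \<Longrightarrow> m' (ad 6 (b + a)) = m (ad 6 (b + a))) \<Longrightarrow>
    L \<le> L' \<Longrightarrow> PInst b m' tg L' \<tau> 0 0"
  by (auto simp: PInst_def holds_mem_def)

lemma inst_ok_cong:
  assumes "inst_ok Mg m \<tau> bk" "gen m' bk = gen m bk" "rem m' bk = rem m bk" "m 16 \<le> m' 16"
    "\<tau>' (gen m bk) = \<tau> (gen m bk)" "\<And>a. a < S \<Longrightarrow> m' (ad 6 (gen m bk * S + a)) = m (ad 6 (gen m bk * S + a))"
  shows "inst_ok Mg m' \<tau>' bk"
proof -
  obtain tg where tg: "\<forall>M. (\<forall>i<q. \<forall>j<q. M i j = block Mg bk i j) \<longrightarrow> closed_from md d M q (rem m bk) tg"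
    "PInst (gen m bk * S) m tg (7 * q * q + 20 * q * (q - rem m bk)) (\<tau> (gen m bk)) 0 0" "gen m bk < m 16"
    using assms(1) by (auto simp: inst_ok_def)
  have "PInst (gen m bk * S) m' tg (7 * q * q + 20 * q * (q - rem m bk)) (\<tau> (gen m bk)) 0 0"
    using tg(2) by (rule PInst_cong) (use assms(6) in auto)
  moreover have "gen m bk < m' 16" using tg(3) assms(4) by simp
  ultimately show ?thesis using tg(1) unfolding inst_ok_def assms(2,3,5) by (intro conjI exI[of _ tg])
qed

lemma inv_frame:
  assumes "inv Mg m \<tau> \<rho> e t" "\<And>v. v \<in> {11,12,15,16} \<Longrightarrow> m' v = m v"
    "\<And>k j. k \<in> {0,3,4,6} \<Longrightarrow> m' (ad k j) = m (ad k j)" "t' + e \<le> t + e'"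
  shows "inv Mg m' \<tau> \<rho> e' t'"
proof -
  have v: "m' 11 = m 11" "m' 12 = m 12" "m' 15 = m 15" "m' 16 = m 16" using assms(2) by auto
  have a: "m' (ad 0 j) = m (ad 0 j)" "m' (ad 3 j) = m (ad 3 j)" "m' (ad 4 j) = m (ad 4 j)"
    "m' (ad 6 j) = m (ad 6 j)" for j using assms(3) by auto
  have r: "rem m' = rem m" "gen m' = gen m" by (auto simp: rem_def gen_def a)
  have "inst_ok Mg m' \<tau> bk" if "inst_ok Mg m \<tau> bk" for bk
    using that by (rule inst_ok_cong) (simp_all add: r v a)
  then show ?thesis using assms(1,4) unfolding inv_def v a r by auto
qed

lemma PInst_budget:
  assumes "PInst b m tg L \<tau> t z" "L \<le> 27 * q * q"
  shows "real \<tau> \<le> budget"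
proof -
  obtain rs pm where "hist rs tg" "length rs \<le> L" "inst rs \<tau> pm" using assms(1) by (auto simp: PInst_def)
  then show ?thesis using inst_time[of rs \<tau> pm tg "27 * q * q"] assms(2) by (simp add: budget_def)
qed

definition at_block :: "memory \<Rightarrow> nat \<Rightarrow> bool" where
  "at_block m bk \<longleftrightarrow> bk < q * q \<and> m 17 = bk \<and> m 13 = bk div q \<and> m 14 = bk mod q"

lemma block_index: "bk < q * q \<Longrightarrow> i < q \<Longrightarrow> bk div q * q + i < q * q \<and> bk mod q * q + i < q * q"
proof -
  assume bk: "bk < q * q" and i: "i < q"
  have "bk div q < q" using bk by (simp add: less_mult_imp_div_less)
  then have "Suc (bk div q) * q \<le> q * q" by (intro mult_le_mono1) simp
  moreover have "Suc (bk mod q) * q \<le> q * q" using q2 by (intro mult_le_mono1) (simp add: Suc_le_eq)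
  ultimately show ?thesis using i by simp
qed

lemma blkM_block:
  assumes "inv Mg m \<tau> \<rho> e t" "at_block m bk" "i < q" "j < q"
  shows "blkM q m i j = block Mg bk i j"
  using assms block_index unfolding inv_def at_block_def blkM_def block_def by auto

text \<open>Every generation provides \<open>q\<close> rounds, each of them played or remaining, and
  at most \<open>q\<close> remain for each block.\<close>

lemma gens_bound:
  assumes "inv Mg m \<tau> \<rho> e t" "\<rho> \<le> 2 * q * q * n"
  shows "(m 16 + 1) * S < X"
proof -
  have "(\<Sum>bk<q*q. rem m bk) \<le> (\<Sum>bk<q*q. q)"
    using assms(1) by (intro sum_mono) (auto simp: inv_def)
  then have "m 16 * q \<le> 2 * q * q * n + q * q * q"
    using assms by (auto simp: inv_def)
  also have "\<dots> = (2 * q * n + q * q) * q" by (simp add: algebra_simps)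
  finally have "m 16 \<le> 2 * q * n + q * q" using q2 by simp
  then have "(m 16 + 1) * S \<le> (2 * q * n + q * q + 2) * S" by (intro mult_le_mono1) simp
  then show ?thesis using X_big by simp
qed

definition NEW :: com where
  "NEW = Seq CREATE (Seq (Assign (AD 3 (V 17)) (V 16)) (Seq (Assign (Lit 16) (Op Plus (V 16) (Lit 1)))
     (Assign (AD 4 (V 17)) (V 11))))"

lemma S_pos: "S \<ge> 1" by simp

text \<open>The 140 pays for the two tests in front. Other instances survive because different
  generations have disjoint areas.\<close>

lemma wp_NEW:
  assumes I: "inv Mg m \<tau> \<rho> e t" and bk: "at_block m bk" and r0: "rem m bk = 0" and \<rho>: "\<rho> \<le> 2 * q * q * n"
  shows "wp NEW m (t + 140) (\<lambda>m' t'. (\<exists>\<tau>'. inv Mg m' \<tau>' \<rho> e t') \<and> at_block m' bk \<and> 0 < rem m' bk \<and>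
    m' 18 = m 18 \<and> m' 19 = m 19 \<and> (\<forall>k j. k \<in> {1,2} \<longrightarrow> m' (ad k j) = m (ad k j)))"
proof -
  define G where "G = m 16"
  have GX: "(G + 1) * S < X" using gens_bound[OF I \<rho>] by (simp add: G_def)
  have v: "m 11 = q" "m 15 = S" "m 16 = G" using I by (auto simp: inv_def G_def)
  have zero: "\<forall>a<S. m (ad 6 (G * S + a)) = 0" using I by (auto simp: inv_def G_def)
  have bkq: "bk < q * q" using bk by (simp add: at_block_def)
  have GSX: "G * S + S < X" using GX by simp
  have G1: "G + 1 < X" using GX S_pos by (metis less_le_trans mult_le_mono2 nat_mult_1_right not_le order.strict_trans2)
  show ?thesis unfolding NEW_def
  proof (rule wp_Seq, rule wp_conseq[OF wp_CREATE[OF v refl GSX zero]], elim conjE)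
    fix m1 t1 assume sm: "small m1" and s: "same_above 11 (G * S) S m m1" and m10: "m1 10 = G * S"
      and I1: "Inst (G * S) m1 (set (init_script md d (blkM q m) q)) (7 * q * q) t1 (t + 140 + 20000 * q * q)"
    let ?tg = "set (init_script md d (blkM q m) q)"
    obtain \<tau>G where P: "PInst (G * S) m1 ?tg (7 * q * q) \<tau>G t1 (t + 140 + 20000 * q * q)"
      using I1 by (auto simp: Inst_def)
    have sv: "m1 a = m a" if "11 \<le> a" "a < 40" for a using same_above_var[OF s that] .
    have sa: "m1 (ad k j) = m (ad k j)" if "k < 5" for k j using same_above_arr[OF s that] .
    have si: "m1 (ad 6 j) = m (ad 6 j)" if "j < G * S \<or> G * S + S \<le> j" for j using same_above_inst[OF s that] .
    define m' where "m' = m1(ad 3 bk := G, 16 := G + 1, ad 4 bk := q)"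
    define \<tau>' where "\<tau>' = \<tau>(G := \<tau>G)"
    have m17: "m1 17 = bk" "m1 16 = G" "m1 11 = q" using sv bk v by (auto simp: at_block_def)
    have gen': "gen m' b' = (if b' = bk then G else gen m b')" for b' by (simp add: m'_def gen_def sa)
    have rem': "rem m' = (rem m)(bk := q)" by (auto simp: m'_def rem_def sa fun_eq_iff)
    have at: "at_block m' bk" using bk sv by (simp add: at_block_def m'_def)
    have ok_bk: "inst_ok Mg m' \<tau>' bk"
    proof -
      have "closed_from md d M q (rem m' bk) ?tg" if "\<forall>i<q. \<forall>j<q. M i j = block Mg bk i j" for M
      proof -
        \<comment> \<open>The initial script inspects only entries with both indices below
          \<open>q\<close>.\<close>
        have "set (init_script md d M q) = ?tg"
          using that blkM_block[OF I bk] by (cases md; cases d) (auto simp: set_eq_iff init_mem)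
        then show ?thesis using closed_from_init[of md d M q] by (simp add: rem')
      qed
      moreover have "PInst (G * S) m' ?tg (7 * q * q) \<tau>G 0 0"
        using P by (rule PInst_cong) (auto simp: m'_def)
      ultimately show ?thesis
        unfolding inst_ok_def gen' rem' \<tau>'_def by (auto simp: m'_def intro!: exI[of _ ?tg])
    qed
    have ok: "inst_ok Mg m' \<tau>' b'" if "b' < q * q" "0 < rem m b'" "b' \<noteq> bk" for b'
    proof (rule inst_ok_cong)
      show o: "inst_ok Mg m \<tau> b'" using I that by (auto simp: inv_def)
      then have g: "gen m b' < G" by (simp add: inst_ok_def G_def)
      show "gen m' b' = gen m b'" "rem m' b' = rem m b'" using that by (auto simp: gen' rem')
      show "m 16 \<le> m' 16" by (simp add: m'_def G_def)
      show "\<tau>' (gen m b') = \<tau> (gen m b')" using g by (simp add: \<tau>'_def)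
      fix a assume "a < S"
      moreover have "(gen m b' + 1) * S \<le> G * S" using g by (intro mult_le_mono1) simp
      ultimately have "gen m b' * S + a < G * S" by simp
      then show "m' (ad 6 (gen m b' * S + a)) = m (ad 6 (gen m b' * S + a))" by (simp add: m'_def si)
    qed
    have "inv Mg m' \<tau>' \<rho> e (t1 + 150 + 150 + 150)"
      unfolding inv_def
    proof (intro conjI)
      show "m' 11 = q" "m' 12 = n" "m' 15 = S" using I sv by (auto simp: m'_def inv_def)
      show "\<forall>i<q * q. \<forall>j<q * q. (m' (ad 0 (i * (q * q) + j)) \<noteq> 0) = Mg i j"
        using I by (simp add: m'_def inv_def sa)
      show "\<forall>b'<q * q. rem m' b' \<le> q \<and> (0 < rem m' b' \<longrightarrow> inst_ok Mg m' \<tau>' b')"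
        using I ok ok_bk by (auto simp: rem' inv_def)
      have gl: "gen m b' < G" if "b' < q * q" "0 < rem m b'" for b'
        using I that by (auto simp: inv_def inst_ok_def G_def)
      show "\<forall>b1<q * q. \<forall>b2<q * q. b1 \<noteq> b2 \<longrightarrow> 0 < rem m' b1 \<longrightarrow> 0 < rem m' b2 \<longrightarrow> gen m' b1 \<noteq> gen m' b2"
      proof (intro allI impI)
        fix b1 b2 assume b: "b1 < q * q" "b2 < q * q" "b1 \<noteq> b2" "0 < rem m' b1" "0 < rem m' b2"
        show "gen m' b1 \<noteq> gen m' b2"
        proof (cases "b1 = bk \<or> b2 = bk")
          case True
          then show ?thesis using b gl[of b1] gl[of b2] by (auto simp: gen' rem')
        next
          case False
          then have "0 < rem m b1" "0 < rem m b2" using b by (auto simp: rem')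
          then show ?thesis using I b False unfolding inv_def gen' by auto
        qed
      qed
      show "\<forall>j. m' 16 * S \<le> j \<longrightarrow> m' (ad 6 j) = 0"
      proof (intro allI impI)
        fix j assume "m' 16 * S \<le> j"
        then have "G * S + S \<le> j" by (simp add: m'_def)
        moreover from this have "m (ad 6 j) = 0" using I by (simp add: inv_def G_def)
        ultimately show "m' (ad 6 j) = 0" by (simp add: m'_def si)
      qed
      show "\<forall>g<m' 16. real (\<tau>' g) \<le> budget"
      proof (intro allI impI)
        fix g assume "g < m' 16"
        then have "g < G \<or> g = G" by (auto simp: m'_def)
        moreover have "real \<tau>G \<le> budget" using PInst_budget[OF P] by simp
        ultimately show "real (\<tau>' g) \<le> budget" using I by (auto simp: \<tau>'_def inv_def G_def)
      qed
      have "(\<Sum>b'<q * q. rem m' b') = (\<Sum>b'<q * q. rem m b') + q"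
        unfolding rem' using sum_fun_upd[OF bkq, of "rem m" q] r0 by simp
      then show "m' 16 * q = \<rho> + (\<Sum>b'<q * q. rem m' b')"
        using I by (simp add: m'_def inv_def G_def)
      have "(\<Sum>g<m' 16. \<tau>' g) = (\<Sum>g<G. \<tau> g) + \<tau>G" by (simp add: m'_def \<tau>'_def)
      moreover have "t1 \<le> 40 * \<tau>G + (t + 140 + 20000 * q * q)" using P by (auto simp: PInst_def)
      moreover have "t \<le> 40 * (\<Sum>g<G. \<tau> g) + e + 25000 * q * \<rho> + 25000 * q * q * G"
        using I by (simp add: inv_def G_def)
      moreover have "25000 * q * q * m' 16 = 25000 * q * q * G + 25000 * (q * q)" by (simp add: m'_def)
      moreover have "4 \<le> q * q" "20000 * q * q = 20000 * (q * q)" using mult_le_mono[OF q2 q2] by auto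
      ultimately show "t1 + 150 + 150 + 150 \<le> 40 * (\<Sum>g<m' 16. \<tau>' g) + e + 25000 * q * \<rho> + 25000 * q * q * m' 16"
        by linarith
    qed
    moreover have "0 < rem m' bk" using q2 by (simp add: rem')
    moreover have "m' 18 = m 18" "m' 19 = m 19" "\<forall>k j. k \<in> {1,2} \<longrightarrow> m' (ad k j) = m (ad k j)"
      using sv by (auto simp: m'_def sa)
    ultimately have Q: "(\<exists>\<tau>'. inv Mg m' \<tau>' \<rho> e (t1 + 150 + 150 + 150)) \<and> at_block m' bk \<and> 0 < rem m' bk \<and>
      m' 18 = m 18 \<and> m' 19 = m 19 \<and> (\<forall>k j. k \<in> {1,2} \<longrightarrow> m' (ad k j) = m (ad k j))" using at by blast
    let ?m1 = "m1(ad 3 bk := G)" and ?m2 = "m1(ad 3 bk := G, 16 := G + 1)"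
    show "wp (Seq (Assign (AD 3 (V 17)) (V 16)) (Seq (Assign (Lit 16) (Op Plus (V 16) (Lit 1)))
     (Assign (AD 4 (V 17)) (V 11)))) m1 t1 (\<lambda>m' t'. (\<exists>\<tau>'. inv Mg m' \<tau>' \<rho> e t') \<and> at_block m' bk \<and> 0 < rem m' bk \<and>
      m' 18 = m 18 \<and> m' 19 = m 19 \<and> (\<forall>k j. k \<in> {1,2} \<longrightarrow> m' (ad k j) = m (ad k j)))"
    proof (rule wp_Seq, rule wp_Assign, simp, simp, simp add: smallD, rule wp_Seq, rule wp_Assign, goal_cases)
      case 4
      have e: "(m1(aval m1 (AD 3 (V 17)) := aval m1 (V 16)))(aval (m1(aval m1 (AD 3 (V 17)) := aval m1 (V 16))) (Lit 16) :=
        aval (m1(aval m1 (AD 3 (V 17)) := aval m1 (V 16))) (Op Plus (V 16) (Lit 1))) = ?m2"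
        by (simp add: m17)
      have e2: "?m2(aval ?m2 (AD 4 (V 17)) := aval ?m2 (V 11)) = m'" by (simp add: m17 m'_def)
      show ?case unfolding e
      proof (rule wp_Assign)
        show "aval ?m2 (V 11) < X" using X_sizes by (simp add: m17)
      qed (use Q in \<open>simp_all only: e2\<close>, simp_all)
    qed (use G1 m17 in auto)
  qed
qed

end

section \<open>Playing rounds: one vector against all blocks\<close>

context omv
begin

text \<open>The counter of remaining rounds is decremented first and its new value is the index of
  the round; this is why rounds are used in decreasing order. Cell 18 becomes 0 when a round
  fails.\<close>

definition PLAY :: com where
  "PLAY = Seq (Assign (AD 4 (V 17)) (Op Minus (Cell (AD 4 (V 17))) (Lit 1)))
    (Seq (Assign (Lit 10) (Op Times (Cell (AD 3 (V 17))) (V 15)))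
    (Seq (Assign (Lit 3) (Cell (AD 4 (V 17))))
    (Seq ROUND (Cond (V 5) (Assign (AD 2 (row_index (Op Minus (V 5) (Lit 1)))) (Lit 1)) (Assign (Lit 18) (Lit 0))))))"

definition row_hit :: "(nat \<Rightarrow> nat \<Rightarrow> bool) \<Rightarrow> memory \<Rightarrow> nat \<Rightarrow> nat \<Rightarrow> bool" where
  "row_hit Mg m bk i \<longleftrightarrow> (\<exists>j<q. block Mg bk i j \<and> m (ad 1 (bk mod q * q + j)) \<noteq> 0)"

text \<open>The old \<open>40 * \<tau> g\<close> moves from the global clock into the account of the
  instance, where the new time \<open>\<tau>g\<close> replaces it; \<open>25000 * q\<close> pays for
  the overhead of the round.\<close>

lemma inv_PLAY:
  assumes I: "inv Mg m \<tau> \<rho> e t" and bkq: "bk < q * q" and r: "rem m bk = Suc r"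
    and g: "g = gen m bk" and tg: "inst_ok Mg m \<tau> bk"
    and s: "\<And>a. 11 \<le> a \<Longrightarrow> a < 18 \<Longrightarrow> m' a = m a"
      "\<And>k j. k \<in> {0,3} \<Longrightarrow> m' (ad k j) = m (ad k j)" "\<And>j. m' (ad 4 j) = (if j = bk then r else m (ad 4 j))"
      "\<And>j. j < g * S \<or> g * S + S \<le> j \<Longrightarrow> m' (ad 6 j) = m (ad 6 j)"
    and P: "PInst (g * S) m' tg' (7 * q * q + 20 * q * (q - r)) \<tau>g t' z"
    and cl: "\<And>M. (\<forall>i<q. \<forall>j<q. M i j = block Mg bk i j) \<Longrightarrow> closed_from md d M q r tg'"
    and z: "z + 40 * \<tau> g \<le> 40 * (\<Sum>g<m 16. \<tau> g) + e + 25000 * q * \<rho> + 25000 * q * q * m 16 + 25000 * q"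
  shows "inv Mg m' (\<tau>(g := \<tau>g)) (\<rho> + 1) e t'"
proof -
  have gG: "g < m 16" using tg g by (simp add: inst_ok_def)
  have gen': "gen m' = gen m" by (auto simp: gen_def s)
  have rem': "rem m' = (rem m)(bk := r)" by (auto simp: rem_def s fun_eq_iff)
  have rq: "Suc r \<le> q" using I bkq r by (auto simp: inv_def)
  have v: "m' 11 = m 11" "m' 12 = m 12" "m' 15 = m 15" "m' 16 = m 16" using s(1) by auto
  have ok_bk: "inst_ok Mg m' (\<tau>(g := \<tau>g)) bk"
    unfolding inst_ok_def gen' rem' v
    using gG g cl P PInst_cong[OF P refl order_refl] by auto
  have ok: "inst_ok Mg m' (\<tau>(g := \<tau>g)) b'" if b': "b' < q * q" "0 < rem m b'" "b' \<noteq> bk" for b'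
  proof (rule inst_ok_cong)
    show o: "inst_ok Mg m \<tau> b'" using I that by (auto simp: inv_def)
    have ne: "gen m b' \<noteq> g" using I b' bkq r unfolding g inv_def by auto
    show "gen m' b' = gen m b'" "rem m' b' = rem m b'" using b' by (auto simp: gen' rem')
    show "m 16 \<le> m' 16" by (simp add: v)
    show "(\<tau>(g := \<tau>g)) (gen m b') = \<tau> (gen m b')" using ne by simp
    fix a assume a: "a < S"
    have "gen m b' * S + a < g * S \<or> g * S + S \<le> gen m b' * S + a"
    proof (cases "gen m b' < g")
      case True
      then have "Suc (gen m b') * S \<le> g * S" by (intro mult_le_mono1) simp
      then show ?thesis using a by simp
    next
      case False
      then have "Suc g * S \<le> gen m b' * S" using ne by (intro mult_le_mono1) simp
      then show ?thesis by simp
    qed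
    then show "m' (ad 6 (gen m b' * S + a)) = m (ad 6 (gen m b' * S + a))" by (rule s(4))
  qed
  show ?thesis unfolding inv_def v gen'
  proof (intro conjI)
    show "m 11 = q" "m 12 = n" "m 15 = S" using I by (auto simp: inv_def)
    show "\<forall>i<q * q. \<forall>j<q * q. (m' (ad 0 (i * (q * q) + j)) \<noteq> 0) = Mg i j"
      using I by (simp add: inv_def s)
    show "\<forall>b'<q * q. rem m' b' \<le> q \<and> (0 < rem m' b' \<longrightarrow> inst_ok Mg m' (\<tau>(g := \<tau>g)) b')"
      using I ok ok_bk rq by (auto simp: rem' inv_def)
    have "0 < rem m b" if "0 < rem m' b" for b using that r by (auto simp: rem' split: if_splits)
    then show "\<forall>b1<q * q. \<forall>b2<q * q. b1 \<noteq> b2 \<longrightarrow> 0 < rem m' b1 \<longrightarrow> 0 < rem m' b2 \<longrightarrow> gen m b1 \<noteq> gen m b2"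
      using I by (auto simp: inv_def)
    show "\<forall>j. m 16 * S \<le> j \<longrightarrow> m' (ad 6 j) = 0"
    proof (intro allI impI)
      fix j assume j: "m 16 * S \<le> j"
      have "Suc g * S \<le> m 16 * S" using gG by (intro mult_le_mono1) simp
      then have "m' (ad 6 j) = m (ad 6 j)" using j by (intro s(4)) simp
      then show "m' (ad 6 j) = 0" using I j by (simp add: inv_def)
    qed
    have "7 * q * q + 20 * q * (q - r) \<le> 27 * q * q"
    proof -
      have "20 * q * (q - r) \<le> 20 * q * q" by (intro mult_le_mono2) simp
      then show ?thesis by simp
    qed
    then have "real \<tau>g \<le> budget" by (rule PInst_budget[OF P])
    then show "\<forall>g'<m 16. real ((\<tau>(g := \<tau>g)) g') \<le> budget" using I by (auto simp: inv_def)
    have "(\<Sum>b'<q * q. rem m' b') + Suc r = (\<Sum>b'<q * q. rem m b') + r"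
      unfolding rem' using sum_fun_upd[OF bkq, of "rem m" r] r by simp
    then show "m 16 * q = \<rho> + 1 + (\<Sum>b'<q * q. rem m' b')"
      using I by (simp add: inv_def)
    have "(\<Sum>g'<m 16. (\<tau>(g := \<tau>g)) g') + \<tau> g = (\<Sum>g'<m 16. \<tau> g') + \<tau>g" by (rule sum_fun_upd[OF gG])
    moreover have "t' \<le> 40 * \<tau>g + z" using P by (auto simp: PInst_def)
    moreover have "25000 * q * (\<rho> + 1) = 25000 * q * \<rho> + 25000 * q" by simp
    ultimately show "t' \<le> 40 * (\<Sum>g'<m 16. (\<tau>(g := \<tau>g)) g') + e + 25000 * q * (\<rho> + 1) + 25000 * q * q * m 16"
      using z by linarith
  qed
qed

lemma wp_PLAY:
  assumes I: "inv Mg m \<tau> \<rho> e t" and bk: "at_block m bk" and r0: "0 < rem m bk" and \<rho>: "\<rho> \<le> 2 * q * q * n"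
  shows "wp PLAY m (t + 200) (\<lambda>m' t'. (\<exists>\<tau>'. inv Mg m' \<tau>' (\<rho> + 1) e t') \<and> at_block m' bk \<and> m' 19 = m 19 \<and>
    (\<forall>j. m' (ad 1 j) = m (ad 1 j)) \<and>
    (m' 18 = 0 \<and> (\<forall>j. m' (ad 2 j) = m (ad 2 j)) \<and>
       (\<forall>i<q. m (ad 2 (bk div q * q + i)) = 0 \<longrightarrow> \<not> row_hit Mg m bk i) \<or>
     (\<exists>i<q. m' 18 = m 18 \<and> m (ad 2 (bk div q * q + i)) = 0 \<and> row_hit Mg m bk i \<and>
       (\<forall>j. m' (ad 2 j) = (if j = bk div q * q + i then 1 else m (ad 2 j))))))"
    (is "wp PLAY m (t + 200) ?Q")
proof -
  obtain r where r: "rem m bk = Suc r" using r0 by (cases "rem m bk") auto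
  define g where "g = gen m bk"
  have bkq: "bk < q * q" and at: "m 17 = bk" "m 13 = bk div q" "m 14 = bk mod q" using bk by (auto simp: at_block_def)
  have tg: "inst_ok Mg m \<tau> bk" using I bkq r by (auto simp: inv_def)
  have gG: "g < m 16" using tg by (simp add: inst_ok_def g_def)
  obtain tg where cl: "\<And>M. (\<forall>i<q. \<forall>j<q. M i j = block Mg bk i j) \<Longrightarrow> closed_from md d M q (Suc r) tg"
    and P: "PInst (g * S) m tg (7 * q * q + 20 * q * (q - Suc r)) (\<tau> g) 0 0"
    using tg unfolding inst_ok_def r g_def by auto
  have "Suc g * S \<le> m 16 * S" using gG by (intro mult_le_mono1) simp
  then have GX: "g * S + S < X" using gens_bound[OF I \<rho>] by simp
  have rq: "Suc r \<le> q" using I bkq r by (auto simp: inv_def)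
  define E where "E = e + 25000 * q * \<rho> + 25000 * q * q * m 16"
  \<comment> \<open>The simulated time of all other generations, mere overhead from the point of
    view of generation \<open>g\<close>.\<close>
  define R where "R = (\<Sum>g'<m 16. \<tau> g') - \<tau> g"
  have "\<tau> g \<le> (\<Sum>g'<m 16. \<tau> g')" using gG by (intro member_le_sum) auto
  then have R: "(\<Sum>g'<m 16. \<tau> g') = \<tau> g + R" by (simp add: R_def)
  have tE: "t \<le> 40 * (\<tau> g + R) + E" using I unfolding inv_def R by (simp add: E_def)
  define m3 where "m3 = m(ad 4 bk := r, 10 := g * S, 3 := r)"
  have m4: "m (ad 4 bk) = Suc r" "m (ad 3 bk) = g" using r by (auto simp: rem_def g_def gen_def)
  have m15: "m 15 = S" "m 11 = q" using I by (auto simp: inv_def)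
  have I3: "Inst (g * S) m3 tg (7 * q * q + 20 * q * (q - Suc r)) (t + 200 + 150 + 150 + 150) (40 * R + E + 650)"
    unfolding Inst_def using P tE by (intro exI[of _ "\<tau> g"]) (auto simp: PInst_def m3_def holds_mem_def)
  have v3: "m3 10 = g * S" "m3 11 = q" "m3 3 = r" "r < q" using rq m15 by (auto simp: m3_def)
  have blk3: "blkM q m3 = blkM q m" "blkV q m3 = blkV q m" "blkF q m3 = blkF q m"
    by (auto simp: m3_def blkM_def blkV_def blkF_def fun_eq_iff)
  have bM: "\<forall>i<q. \<forall>j<q. blkM q m3 i j = block Mg bk i j" using blkM_block[OF I bk] blk3 by simp
  have hit: "blk_hit m3 i = row_hit Mg m bk i" if "i < q" for i
    using bM that unfolding blk_hit_def row_hit_def blk3 by (auto simp: blkV_def at)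
  have F: "blkF q m3 i \<longleftrightarrow> m (ad 2 (bk div q * q + i)) \<noteq> 0" for i by (simp add: blk3 blkF_def at)
  have main: "wp (Seq ROUND (Cond (V 5) (Assign (AD 2 (row_index (Op Minus (V 5) (Lit 1)))) (Lit 1)) (Assign (Lit 18) (Lit 0))))
     m3 (t + 200 + 150 + 150 + 150) ?Q"
  proof (rule wp_Seq, rule wp_conseq[OF wp_ROUND[OF I3 v3(1) _ v3(2-4) cl[OF bM]]], goal_cases)
    case 1
    then show ?case using GX by simp
  next
    case (2 m5 t5)
    then have s5: "same_above 8 (g * S) S m3 m5" by blast
    obtain tg' where cl': "closed_from md d (blkM q m3) q r tg'"
      and I5: "Inst (g * S) m5 tg' (7 * q * q + 20 * q * (q - Suc r) + 20 * q) t5 (40 * R + E + 650 + 20000 * q)"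
      using 2 by blast
    have L: "7 * q * q + 20 * q * (q - Suc r) + 20 * q = 7 * q * q + 20 * q * (q - r)"
    proof -
      have "q - r = Suc (q - Suc r)" using rq by simp
      then show ?thesis by simp
    qed
    have I5': "Inst (g * S) m5 tg' (7 * q * q + 20 * q * (q - r)) (t5 + 220) (40 * R + E + 870 + 20000 * q)"
      using I5 unfolding L by (rule Inst_mono) auto
    obtain \<tau>g where P5: "PInst (g * S) m5 tg' (7 * q * q + 20 * q * (q - r)) \<tau>g (t5 + 220) (40 * R + E + 870 + 20000 * q)"
      using I5' by (auto simp: Inst_def)
    have cl5: "closed_from md d M q r tg'" if "\<forall>i<q. \<forall>j<q. M i j = block Mg bk i j" for M
    proof -
      have "set (init_script md d M q) = set (init_script md d (blkM q m3) q)"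
        using that bM by (cases md; cases d) (auto simp: set_eq_iff init_mem)
      then show ?thesis using cl' by (simp add: closed_from_def)
    qed
    have sv: "m5 a = m a" if "11 \<le> a" "a < 40" for a
      using same_above_var[OF s5, of a] that by (simp add: m3_def)
    have sa: "m5 (ad k j) = m (ad k j)" if "k < 4" for k j
      using same_above_arr[OF s5, of k j] that by (simp add: m3_def)
    have "inv Mg m5 (\<tau>(g := \<tau>g)) (\<rho> + 1) e (t5 + 220)"
    proof (rule inv_PLAY[OF I bkq r g_def tg, where m' = m5 and tg' = tg'])
      show "m5 (ad 4 j) = (if j = bk then r else m (ad 4 j))" for j
        using same_above_arr[OF s5, of 4 j] by (simp add: m3_def)
      show "m5 (ad 6 j) = m (ad 6 j)" if "j < g * S \<or> g * S + S \<le> j" for j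
        using same_above_inst[OF s5 that] by (simp add: m3_def)
      show "40 * R + E + 870 + 20000 * q + 40 * \<tau> g \<le>
        40 * (\<Sum>g<m 16. \<tau> g) + e + 25000 * q * \<rho> + 25000 * q * q * m 16 + 25000 * q"
        unfolding R using q2 by (simp add: E_def)
    qed (use sv sa P5 cl5 in auto)
    then have inv': "inv Mg m' (\<tau>(g := \<tau>g)) (\<rho> + 1) e (t5 + 220)"
      if "\<And>v. v \<in> {11,12,15,16} \<Longrightarrow> m' v = m5 v" "\<And>k j. k \<in> {0,3,4,6} \<Longrightarrow> m' (ad k j) = m5 (ad k j)" for m'
      by (rule inv_frame) (use that in auto)
    have t5: "t5 + 70 + 150 = t5 + 220" by simp
    have at5: "at_block m5 bk" using bk sv by (simp add: at_block_def)
    have res: "m5 5 = 0 \<and> (\<forall>i<q. \<not> blkF q m3 i \<longrightarrow> \<not> blk_hit m3 i) \<or>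
     (\<exists>i<q. m5 5 = Suc i \<and> \<not> blkF q m3 i \<and> blk_hit m3 i)" using 2 by blast
    show ?case
    proof (rule wp_Cond)
      assume "aval m5 (V 5) \<noteq> 0"
      then obtain i where i: "i < q" "m5 5 = Suc i" "m (ad 2 (bk div q * q + i)) = 0" "row_hit Mg m bk i"
        using res F hit by auto
      let ?m = "m5(ad 2 (bk div q * q + i) := 1)"
      have "inv Mg ?m (\<tau>(g := \<tau>g)) (\<rho> + 1) e (t5 + 220)" by (rule inv') auto
      then have "\<exists>\<tau>'. inv Mg ?m \<tau>' (\<rho> + 1) e (t5 + 70 + 150)" unfolding t5 by blast
      moreover have "at_block ?m bk" "?m 19 = m 19" "\<forall>j. ?m (ad 1 j) = m (ad 1 j)" "?m 18 = m 18"
        "\<forall>j. ?m (ad 2 j) = (if j = bk div q * q + i then 1 else m (ad 2 j))"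
        using at5 sv[of 19] sv[of 18] sa by (auto simp: at_block_def)
      ultimately have "?Q ?m (t5 + 70 + 150)" using i by blast
      moreover have "aval m5 (AD 2 (row_index (Op Minus (V 5) (Lit 1)))) = ad 2 (bk div q * q + i)"
        using sv at m15 i by (simp add: row_index_def)
      ultimately show "wp (Assign (AD 2 (row_index (Op Minus (V 5) (Lit 1)))) (Lit 1)) m5 (t5 + 70) ?Q"
        using X100 by (intro wp_Assign) (simp_all add: row_index_def)
    next
      assume "aval m5 (V 5) = 0"
      then have "\<forall>i<q. m (ad 2 (bk div q * q + i)) = 0 \<longrightarrow> \<not> row_hit Mg m bk i"
        using res F hit by auto
      moreover have "inv Mg (m5(18 := 0)) (\<tau>(g := \<tau>g)) (\<rho> + 1) e (t5 + 220)" by (rule inv') auto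
      then have "\<exists>\<tau>'. inv Mg (m5(18 := 0)) \<tau>' (\<rho> + 1) e (t5 + 70 + 150)" unfolding t5 by blast
      moreover have "at_block (m5(18 := 0)) bk" "(m5(18 := 0)) 19 = m 19" "\<forall>j. (m5(18 := 0)) (ad 1 j) = m (ad 1 j)"
        "(m5(18 := 0)) 18 = 0" "\<forall>j. (m5(18 := 0)) (ad 2 j) = m (ad 2 j)"
        using at5 sv[of 19] sa by (auto simp: at_block_def)
      ultimately have "?Q (m5(18 := 0)) (t5 + 70 + 150)" by blast
      then show "wp (Assign (Lit 18) (Lit 0)) m5 (t5 + 70) ?Q"
        using X100 by (intro wp_Assign) simp_all
    qed simp
  qed
  have e1: "aval m (AD 4 (V 17)) = ad 4 bk" "aval m (Op Minus (Cell (AD 4 (V 17))) (Lit 1)) = r"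
    using at m4 by simp_all
  let ?m1 = "m(ad 4 bk := r)" and ?m2 = "m(ad 4 bk := r, 10 := g * S)"
  have e2: "aval ?m1 (Op Times (Cell (AD 3 (V 17))) (V 15)) = g * S" "aval ?m1 (Lit 10) = 10"
    using at m4 m15 by simp_all
  have e3: "aval ?m2 (Cell (AD 4 (V 17))) = r" "aval ?m2 (Lit 3) = 3" using at by simp_all
  have rX: "r < X" "g * S < X" using rq X_sizes GX by auto
  show ?thesis unfolding PLAY_def
  proof (rule wp_Seq, rule wp_Assign, unfold e1, goal_cases)
    case 4
    show ?case
    proof (rule wp_Seq, rule wp_Assign, unfold e2, goal_cases)
      case 4
      show ?case
      proof (rule wp_Seq, rule wp_Assign, unfold e3, goal_cases)
        case 4
        show ?case using main unfolding m3_def .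
      qed (use rX in simp_all)
    qed (use rX in simp_all)
  qed (use rX in simp_all)
qed

definition sound :: "(nat \<Rightarrow> nat \<Rightarrow> bool) \<Rightarrow> (nat \<Rightarrow> bool) \<Rightarrow> memory \<Rightarrow> bool" where
  "sound Mg w m \<longleftrightarrow> (\<forall>j<q*q. (m (ad 1 j) \<noteq> 0) = w j) \<and>
     (\<forall>i<q*q. m (ad 2 i) \<le> 1 \<and> (m (ad 2 i) \<noteq> 0 \<longrightarrow> (\<exists>j<q*q. Mg i j \<and> w j)))"

definition block_done :: "(nat \<Rightarrow> nat \<Rightarrow> bool) \<Rightarrow> (nat \<Rightarrow> bool) \<Rightarrow> memory \<Rightarrow> nat \<Rightarrow> bool" where
  "block_done Mg w m bk \<longleftrightarrow> (\<forall>i<q. (\<exists>j<q. block Mg bk i j \<and> w (bk mod q * q + j)) \<longrightarrow>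
     m (ad 2 (bk div q * q + i)) \<noteq> 0)"

definition found :: "memory \<Rightarrow> nat" where
  "found m = card {i. i < q * q \<and> m (ad 2 i) \<noteq> 0}"

lemma found_le: "found m \<le> q * q"
  using card_mono[of "{..<q * q}" "{i. i < q * q \<and> m (ad 2 i) \<noteq> 0}"] by (auto simp: found_def)

lemma found_upd:
  assumes "\<forall>j. m' (ad 2 j) = (if j = k then 1 else m (ad 2 j))" "m (ad 2 k) = 0" "k < q * q"
  shows "found m' = Suc (found m)"
proof -
  have "{i. i < q * q \<and> m' (ad 2 i) \<noteq> 0} = insert k {i. i < q * q \<and> m (ad 2 i) \<noteq> 0}"
    using assms by auto
  then show ?thesis using assms by (simp add: found_def)
qed

definition LOOP :: com where
  "LOOP = While (V 18) (Seq (Cond (Cell (AD 4 (V 17))) Skip NEW) PLAY)"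

text \<open>The rounds for this vector are one failure for each finished block and one success for
  each row found. The measure \<open>i\<close> is positive while the current block is being
  played.\<close>

definition loop_inv where
  "loop_inv Mg w \<rho>0 e bk i m t \<longleftrightarrow> (\<exists>\<tau> \<rho>. inv Mg m \<tau> \<rho> e t \<and> at_block m bk \<and> sound Mg w m \<and> m 19 \<noteq> 0 \<and>
     (\<forall>b<bk. block_done Mg w m b) \<and>
     (if m 18 \<noteq> 0 then \<rho> = \<rho>0 + bk + found m \<and> i = Suc (q * q - found m)
      else \<rho> = \<rho>0 + Suc bk + found m \<and> block_done Mg w m bk \<and> i = 0))"

text \<open>A pass either ends the loop or increases \<open>found\<close>, which never exceeds
  \<open>q * q\<close>.\<close>

lemma wp_LOOP:
  assumes "loop_inv Mg w \<rho>0 e bk i0 m t" and \<rho>0: "\<rho>0 + 2 * q * q \<le> 2 * q * q * n"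
    and Q: "\<And>m' t'. loop_inv Mg w \<rho>0 e bk 0 m' t' \<Longrightarrow> m' 18 = 0 \<Longrightarrow> Q m' (t' + 70)"
  shows "wp LOOP m t Q"
  unfolding LOOP_def
proof (rule wp_While[where I = "loop_inv Mg w \<rho>0 e bk", OF _ assms(1)])
  fix i m t assume L: "loop_inv Mg w \<rho>0 e bk i m t" and "aval m (V 18) \<noteq> 0"
  then have go: "m 18 \<noteq> 0" by simp
  obtain \<tau> \<rho> where I: "inv Mg m \<tau> \<rho> e t" and at: "at_block m bk" and so: "sound Mg w m" and m19: "m 19 \<noteq> 0"
    and dn: "\<forall>b<bk. block_done Mg w m b" and \<rho>: "\<rho> = \<rho>0 + bk + found m" and i: "i = Suc (q * q - found m)"
    using L go unfolding loop_inv_def by auto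
  have bkq: "bk < q * q" using at by (simp add: at_block_def)
  have \<rho>n: "\<rho> \<le> 2 * q * q * n" using \<rho> \<rho>0 found_le[of m] bkq by simp
  let ?R = "\<lambda>m1 t1. (\<exists>\<tau>' t'. inv Mg m1 \<tau>' \<rho> e t' \<and> t1 \<le> t' + 200) \<and> at_block m1 bk \<and> 0 < rem m1 bk \<and>
    m1 18 = m 18 \<and> m1 19 = m 19 \<and> (\<forall>k j. k \<in> {1,2} \<longrightarrow> m1 (ad k j) = m (ad k j))"
  have head: "wp (Cond (Cell (AD 4 (V 17))) Skip NEW) m (t + 70) ?R"
  proof (rule wp_Cond)
    assume "aval m (Cell (AD 4 (V 17))) \<noteq> 0"
    then have "0 < rem m bk" using at by (simp add: rem_def at_block_def)
    moreover have "\<exists>\<tau>' t'. inv Mg m \<tau>' \<rho> e t' \<and> t + 70 + 70 + 1 \<le> t' + 200"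
      using I by (intro exI[of _ \<tau>] exI[of _ t]) simp
    ultimately show "wp Skip m (t + 70 + 70) ?R" using at by (intro wp_Skip) blast
  next
    assume "aval m (Cell (AD 4 (V 17))) = 0"
    then have "rem m bk = 0" using at by (simp add: rem_def at_block_def)
    show "wp NEW m (t + 70 + 70) ?R"
    proof (rule wp_time[OF wp_conseq[OF wp_NEW[OF I at \<open>rem m bk = 0\<close> \<rho>n]]])
      fix m' t' assume *: "(\<exists>\<tau>'. inv Mg m' \<tau>' \<rho> e t') \<and> at_block m' bk \<and> 0 < rem m' bk \<and>
        m' 18 = m 18 \<and> m' 19 = m 19 \<and> (\<forall>k j. k \<in> {1,2} \<longrightarrow> m' (ad k j) = m (ad k j))"
      moreover have "t' \<le> t' + 200" by simp
      ultimately show "?R m' t'" by blast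
    qed simp
  qed simp
  show "wp (Seq (Cond (Cell (AD 4 (V 17))) Skip NEW) PLAY) m (t + 70) (\<lambda>m' t'. \<exists>j<i. loop_inv Mg w \<rho>0 e bk j m' t')"
  proof (rule wp_Seq, rule wp_conseq[OF head], elim conjE exE)
    fix m1 t1 \<tau>1 t2 assume I1: "inv Mg m1 \<tau>1 \<rho> e t2" and t12: "t1 \<le> t2 + 200" and at1: "at_block m1 bk"
      and r1: "0 < rem m1 bk" and v1: "m1 18 = m 18" "m1 19 = m 19" and a1: "\<forall>k j. k \<in> {1,2} \<longrightarrow> m1 (ad k j) = m (ad k j)"
    have a1': "m1 (ad 1 j) = m (ad 1 j)" "m1 (ad 2 j) = m (ad 2 j)" for j using a1 by auto
    have rh: "row_hit Mg m1 bk i \<longleftrightarrow> (\<exists>j<q. block Mg bk i j \<and> w (bk mod q * q + j))" for i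
      using so block_index[OF bkq] unfolding sound_def row_hit_def a1' by auto
    show "wp PLAY m1 t1 (\<lambda>m' t'. \<exists>j<i. loop_inv Mg w \<rho>0 e bk j m' t')"
    proof (rule wp_time[OF wp_conseq[OF wp_PLAY[OF I1 at1 r1 \<rho>n]] t12], elim conjE exE)
      fix m' t' \<tau>' assume I': "inv Mg m' \<tau>' (\<rho> + 1) e t'" and at': "at_block m' bk" and m19': "m' 19 = m1 19"
        and V': "\<forall>j. m' (ad 1 j) = m1 (ad 1 j)"
        and cases: "m' 18 = 0 \<and> (\<forall>j. m' (ad 2 j) = m1 (ad 2 j)) \<and>
       (\<forall>i<q. m1 (ad 2 (bk div q * q + i)) = 0 \<longrightarrow> \<not> row_hit Mg m1 bk i) \<or>
     (\<exists>i<q. m' 18 = m1 18 \<and> m1 (ad 2 (bk div q * q + i)) = 0 \<and> row_hit Mg m1 bk i \<and>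
       (\<forall>j. m' (ad 2 j) = (if j = bk div q * q + i then 1 else m1 (ad 2 j))))"
      have n19: "m' 19 \<noteq> 0" using m19 m19' v1 by simp
      from cases show "\<exists>j<i. loop_inv Mg w \<rho>0 e bk j m' t'"
      proof (elim disjE conjE exE)
        assume c: "m' 18 = 0" "\<forall>j. m' (ad 2 j) = m1 (ad 2 j)"
          "\<forall>i<q. m1 (ad 2 (bk div q * q + i)) = 0 \<longrightarrow> \<not> row_hit Mg m1 bk i"
        have F: "m' (ad 2 j) = m (ad 2 j)" "m' (ad 1 j) = m (ad 1 j)" for j using c(2) V' a1' by auto
        have "sound Mg w m'" using so unfolding sound_def F .
        moreover have "\<forall>b<bk. block_done Mg w m' b" using dn unfolding block_done_def F .
        moreover have "block_done Mg w m' bk" using c(3) rh unfolding block_done_def F a1' by auto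
        moreover have "found m' = found m" by (simp add: found_def F)
        ultimately have "loop_inv Mg w \<rho>0 e bk 0 m' t'"
          unfolding loop_inv_def using I' at' n19 c(1) \<rho> by auto
        then show ?thesis using i by blast
      next
        fix i' assume c: "i' < q" "m' 18 = m1 18" "m1 (ad 2 (bk div q * q + i')) = 0" "row_hit Mg m1 bk i'"
          "\<forall>j. m' (ad 2 j) = (if j = bk div q * q + i' then 1 else m1 (ad 2 j))"
        let ?k = "bk div q * q + i'"
        have k: "?k < q * q" using block_index[OF bkq c(1)] by blast
        have F: "m' (ad 2 j) = (if j = ?k then 1 else m (ad 2 j))" "m' (ad 1 j) = m (ad 1 j)" for j using c(5) V' a1' by auto
        have fd: "found m' = Suc (found m)" by (rule found_upd) (use F c(3) k a1' in auto)
        have "\<exists>j<q*q. Mg ?k j \<and> w j" using c(4) block_index[OF bkq] unfolding rh block_def by blast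
        then have "sound Mg w m'" using so unfolding sound_def F by auto
        moreover have "\<forall>b<bk. block_done Mg w m' b" using dn unfolding block_done_def F by auto
        moreover have "found m' \<le> q * q" by (rule found_le)
        ultimately have "loop_inv Mg w \<rho>0 e bk (Suc (q * q - found m')) m' t'"
          unfolding loop_inv_def using I' at' n19 c(2) v1 go \<rho> fd by auto
        moreover have "Suc (q * q - found m') < i" using i fd found_le[of m'] by simp
        ultimately show ?thesis by blast
      qed
    qed
  qed
next
  fix i m t assume "loop_inv Mg w \<rho>0 e bk i m t" "aval m (V 18) = 0"
  then have "loop_inv Mg w \<rho>0 e bk 0 m t" "m 18 = 0" by (auto simp: loop_inv_def)
  then show "Q m (t + 70)" by (rule Q)
qed simp

definition BLOCKS :: com where
  "BLOCKS = FOR 17 (Op Times (V 11) (V 11)) (Seq (Assign (Lit 13) (Op Div (V 17) (V 11)))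
     (Seq (Assign (Lit 14) (Op Mod (V 17) (V 11))) (Seq (Assign (Lit 18) (Lit 1)) LOOP)))"

lemma wp_BLOCKS:
  assumes I: "inv Mg m \<tau> \<rho>0 e t" and so: "sound Mg w m" "m 19 \<noteq> 0" "found m = 0"
    and \<rho>0: "\<rho>0 + 2 * q * q \<le> 2 * q * q * n"
    and Q: "\<And>m' t' \<tau>' \<rho>'. inv Mg m' \<tau>' \<rho>' (e + 220 + 1000 * (q * q)) t' \<Longrightarrow> \<rho>' \<le> \<rho>0 + 2 * q * q \<Longrightarrow> sound Mg w m' \<Longrightarrow>
      m' 19 \<noteq> 0 \<Longrightarrow> (\<forall>b<q*q. block_done Mg w m' b) \<Longrightarrow> Q m' t'"
  shows "wp BLOCKS m t Q"
proof -
  let ?I = "\<lambda>k m t. m 17 = k \<and> (\<exists>\<tau> \<rho>. inv Mg m \<tau> \<rho> (e + 150 + 1000 * k) t \<and>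
    \<rho> = \<rho>0 + k + found m \<and> sound Mg w m \<and> m 19 \<noteq> 0 \<and> (\<forall>b<k. block_done Mg w m b))"
  show ?thesis unfolding BLOCKS_def
  proof (rule wp_FOR[where n = "q * q" and I = ?I])
    show "q * q < X" using X_size by simp
    have "inv Mg (m(17 := 0)) \<tau> \<rho>0 (e + 150 + 1000 * 0) (t + 150)" using I by (rule inv_frame) auto
    moreover have "sound Mg w (m(17 := 0))" "found (m(17 := 0)) = 0" using so by (auto simp: sound_def found_def)
    ultimately show "?I 0 (m(17 := 0)) (t + 150)"
      using so by auto
  next
    fix k m t assume "?I k m t"
    then show "m 17 = k \<and> aval m (Op Times (V 11) (V 11)) = q * q" by (auto simp: inv_def)
  next
    fix k m t assume k: "k < q * q" and sm: "small m" and "?I k m t"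
    then obtain \<tau> where m17: "m 17 = k" and I: "inv Mg m \<tau> (\<rho>0 + k + found m) (e + 150 + 1000 * k) t"
      and so: "sound Mg w m" "m 19 \<noteq> 0" "\<forall>b<k. block_done Mg w m b" by auto
    have m11: "m 11 = q" using I by (simp add: inv_def)
    define m1 where "m1 = m(13 := k div q, 14 := k mod q, 18 := 1)"
    have I1: "inv Mg m1 \<tau> (\<rho>0 + k + found m) (e + 150 + 1000 * k + 600) (t + 70 + 150 + 150 + 150)"
      using I by (rule inv_frame) (auto simp: m1_def)
    have f1: "found m1 = found m" by (simp add: found_def m1_def)
    have "loop_inv Mg w \<rho>0 (e + 150 + 1000 * k + 600) k (Suc (q * q - found m1)) m1 (t + 70 + 150 + 150 + 150)"
      unfolding loop_inv_def using I1 so k m17 f1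
      by (intro exI[of _ \<tau>] exI[of _ "\<rho>0 + k + found m"]) (auto simp: m1_def at_block_def sound_def block_done_def)
    then have "wp LOOP m1 (t + 70 + 150 + 150 + 150) (\<lambda>m' t'. m' 17 = k \<and> ?I (Suc k) (m'(17 := Suc k)) (t' + 150))"
    proof (rule wp_LOOP[OF _ \<rho>0])
      fix m' t' assume "loop_inv Mg w \<rho>0 (e + 150 + 1000 * k + 600) k 0 m' t'" "m' 18 = 0"
      then obtain \<tau>' where I': "inv Mg m' \<tau>' (\<rho>0 + Suc k + found m') (e + 150 + 1000 * k + 600) t'"
        and *: "at_block m' k" "sound Mg w m'" "m' 19 \<noteq> 0" "\<forall>b<k. block_done Mg w m' b" "block_done Mg w m' k"
        by (auto simp: loop_inv_def)
      have "inv Mg (m'(17 := Suc k)) \<tau>' (\<rho>0 + Suc k + found m') (e + 150 + 1000 * Suc k) (t' + 70 + 150)"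
        using I' by (rule inv_frame) auto
      moreover have "found (m'(17 := Suc k)) = found m'" by (simp add: found_def)
      ultimately show "m' 17 = k \<and> ?I (Suc k) (m'(17 := Suc k)) (t' + 70 + 150)"
        using * by (auto simp: at_block_def sound_def block_done_def less_Suc_eq)
    qed
    moreover have "k div q < X" "k mod q < X"
    proof -
      have "k < X" using k X_size by simp
      then show "k div q < X" "k mod q < X" by (meson div_le_dividend mod_less_eq_dividend le_less_trans)+
    qed
    ultimately show "wp (Seq (Assign (Lit 13) (Op Div (V 17) (V 11)))
       (Seq (Assign (Lit 14) (Op Mod (V 17) (V 11))) (Seq (Assign (Lit 18) (Lit 1)) LOOP))) m (t + 70) (\<lambda>m' t'. m' 17 = k \<and>
        ?I (Suc k) (m'(17 := Suc k)) (t' + 150))"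
      using X100 m11 m17 by (intro wp_Seq wp_Assign) (simp_all add: m1_def)
  next
    fix m t assume "?I (q * q) m t"
    then obtain \<tau> where I: "inv Mg m \<tau> (\<rho>0 + q * q + found m) (e + 150 + 1000 * (q * q)) t"
      and *: "sound Mg w m" "m 19 \<noteq> 0" "\<forall>b<q * q. block_done Mg w m b" by auto
    have "inv Mg m \<tau> (\<rho>0 + q * q + found m) (e + 220 + 1000 * (q * q)) (t + 70)"
      using I by (rule inv_frame) auto
    then show "Q m (t + 70)" using * found_le[of m] by (intro Q) auto
  qed auto
qed

end

text \<open>The power is unrolled into \<open>c\<close> multiplications, \<open>c\<close> being a
  constant of the flow algorithm.\<close>

fun SPOW :: "nat \<Rightarrow> com" where
  "SPOW 0 = Assign (Lit 15) (Lit 1)"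
| "SPOW (Suc k) = Seq (SPOW k) (Assign (Lit 15) (Op Times (V 15) (Op Plus (Op Times (Lit 7) (V 11)) (Lit 2))))"

text \<open>Lets commands without input and output be grouped into one \<open>wp\<close> statement
  ahead of the output loop.\<close>

lemma (in machine) wpx_Seq_assoc:
  assumes "wpx (Seq (Seq c1 c2) c3) m xs ys t Q"
  shows "wpx (Seq c1 (Seq c2 c3)) m xs ys t Q"
  unfolding wpx_def
proof
  assume "small m"
  then obtain u m' xs' ys' t' where *: "exec B (Seq (Seq c1 c2) c3) (m, xs, ys) u (m', xs', ys')" "t + u \<le> t'"
    "small m'" "Q m' xs' ys' t'" using assms unfolding wpx_def by blast
  from *(1) obtain u1 s1 u2 where 1: "exec B (Seq c1 c2) (m, xs, ys) u1 s1" "exec B c3 s1 u2 (m', xs', ys')" "u = u1 + u2"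
    by (rule exec_Seq)
  from 1(1) obtain u3 s3 u4 where 2: "exec B c1 (m, xs, ys) u3 s3" "exec B c2 s3 u4 s1" "u1 = u3 + u4"
    by (rule exec_Seq)
  have "exec B (Seq c1 (Seq c2 c3)) (m, xs, ys) (u3 + (u4 + u2)) (m', xs', ys')"
    by (intro exec.Seq[OF 2(1)] exec.Seq[OF 2(2)] 1(2))
  then show "\<exists>u m' xs' ys' t'. exec B (Seq c1 (Seq c2 c3)) (m, xs, ys) u (m', xs', ys') \<and> t + u \<le> t' \<and> small m' \<and> Q m' xs' ys' t'"
    using * 1(3) 2(3) by (intro exI conjI) (auto simp: add.assoc)
qed

section \<open>The online step for one vector\<close>

context omv
begin

definition STEP :: com where
  "STEP = Seq (FOR 2 (V 12) (Read (AD 1 (V 2)))) (Seq (FOR 2 (V 12) (Assign (AD 2 (V 2)) (Lit 0)))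
     (Seq BLOCKS (FOR 2 (V 12) (Write (Cell (AD 2 (V 2)))))))"

text \<open>Padding with zeros up to \<open>q * q\<close>, so that the blocks tile the matrix
  exactly.\<close>

definition matrix :: "(nat \<Rightarrow> nat \<Rightarrow> bool) \<Rightarrow> nat \<Rightarrow> nat \<Rightarrow> bool" where
  "matrix M i j \<longleftrightarrow> i < n \<and> j < n \<and> M i j"

definition step_cost :: nat where "step_cost = 2000 * n + 2000 * (q * q) + 2000"

definition init_cost :: nat where "init_cost = 5000 + 300 * q + 200 * c + 1500 * n * n"

text \<open>The loops over a request stop at \<open>n\<close>, so the padding of the vector and of
  the found rows has to be known as zero beforehand. Cell 19 tells later requests from the first
  one.\<close>

definition ready :: "(nat \<Rightarrow> nat \<Rightarrow> bool) \<Rightarrow> nat \<Rightarrow> memory \<Rightarrow> nat \<Rightarrow> bool" where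
  "ready M k m t \<longleftrightarrow> (\<exists>\<tau> \<rho>. inv (matrix M) m \<tau> \<rho> (init_cost + step_cost * k) t \<and> \<rho> \<le> 2 * q * q * k) \<and>
     m 19 \<noteq> 0 \<and> (\<forall>i. n \<le> i \<and> i < q * q \<longrightarrow> m (ad 1 i) = 0 \<and> m (ad 2 i) = 0)"

text \<open>The entry at \<open>i\<close>, \<open>j\<close> belongs to the block with coordinates
  \<open>i div q\<close> and \<open>j div q\<close>; every one of the product therefore shows up in
  a finished block.\<close>

lemma blocks_complete:
  assumes so: "sound Mg w m" and dn: "\<forall>b<q*q. block_done Mg w m b" and i: "i < q * q"
  shows "m (ad 2 i) = of_bool (\<exists>j<q*q. Mg i j \<and> w j)"
proof (cases "\<exists>j<q*q. Mg i j \<and> w j")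
  case True
  then obtain j where j: "j < q * q" "Mg i j" "w j" by blast
  have iq: "i div q < q" "j div q < q" using i j by (simp_all add: less_mult_imp_div_less)
  define b where "b = i div q * q + j div q"
  have "Suc (i div q) * q \<le> q * q" using iq by (intro mult_le_mono1) simp
  then have b: "b < q * q" "b div q = i div q" "b mod q = j div q" using iq by (auto simp: b_def)
  have ij: "b div q * q + i mod q = i" "b mod q * q + j mod q = j" unfolding b by simp_all
  have "i mod q < q" "j mod q < q" using q2 by auto
  moreover have "block Mg b (i mod q) (j mod q)" "w (b mod q * q + j mod q)"
    using j unfolding block_def ij by auto
  ultimately have "m (ad 2 (b div q * q + i mod q)) \<noteq> 0" using dn b(1) unfolding block_done_def by blast
  then have "m (ad 2 i) \<noteq> 0" unfolding ij(1) .
  then show ?thesis using so i True by (auto simp: sound_def le_Suc_eq)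
next
  case False
  then show ?thesis using so i by (auto simp: sound_def)
qed

lemma n_less_X: "n < X"
  using nq X_size by simp

lemma wpx_STEP:
  assumes R: "ready M k m t" and k: "k < n"
  shows "wpx STEP m (enc_vector n v) [] (t + 70) (\<lambda>m' xs' ys' t'. ys' = enc_vector n (bool_mult n M v) \<and> ready M (Suc k) m' t')"
    (is "wpx STEP m _ [] _ ?Q")
proof -
  let ?Mg = "matrix M"
  define w where "w = (\<lambda>j. j < n \<and> v j)"
  define e where "e = init_cost + step_cost * k"
  obtain \<tau> \<rho> where I: "inv ?Mg m \<tau> \<rho> e t" and \<rho>: "\<rho> \<le> 2 * q * q * k" and m19: "m 19 \<noteq> 0"
    and z: "\<forall>i. n \<le> i \<and> i < q * q \<longrightarrow> m (ad 1 i) = 0 \<and> m (ad 2 i) = 0"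
    using R by (auto simp: ready_def e_def)
  have tail: "wpx (FOR 2 (V 12) (Write (Cell (AD 2 (V 2))))) m1 [] [] t1 ?Q"
    if I1: "inv ?Mg m1 \<tau>1 \<rho>1 (e + 2000 * (q * q) + 1000 + 1000 * n) t1" and \<rho>1: "\<rho>1 \<le> 2 * q * q * Suc k"
      and so: "sound ?Mg w m1" and m19: "m1 19 \<noteq> 0" and dn: "\<forall>b<q*q. block_done ?Mg w m1 b" for m1 t1 \<tau>1 \<rho>1
  proof -
    have F: "m1 (ad 2 i) = of_bool (bool_mult n M v i)" if "i < n" for i
    proof -
      have "m1 (ad 2 i) = of_bool (\<exists>j<q*q. ?Mg i j \<and> w j)"
        using that nq by (intro blocks_complete[OF so dn]) simp
      moreover have "(\<exists>j<q*q. ?Mg i j \<and> w j) \<longleftrightarrow> bool_mult n M v i"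
        using that less_le_trans[OF _ nq] by (auto simp: matrix_def w_def bool_mult_def)
      ultimately show ?thesis by simp
    qed
    have Z: "\<forall>i. n \<le> i \<and> i < q * q \<longrightarrow> m1 (ad 1 i) = 0 \<and> m1 (ad 2 i) = 0"
    proof (intro allI impI)
      fix i assume i: "n \<le> i \<and> i < q * q"
      then have "m1 (ad 2 i) = of_bool (\<exists>j<q*q. ?Mg i j \<and> w j)" by (intro blocks_complete[OF so dn]) simp
      moreover have "\<not> w i" "\<not> (\<exists>j<q*q. ?Mg i j \<and> w j)" using i by (auto simp: w_def matrix_def)
      ultimately show "m1 (ad 1 i) = 0 \<and> m1 (ad 2 i) = 0" using so i by (auto simp: sound_def)
    qed
    show ?thesis
    proof (rule wpx_FOR[where n = n and I = "\<lambda>j m2 xs ys t2. m2 2 = j \<and> (\<forall>a. a \<noteq> 2 \<longrightarrow> m2 a = m1 a) \<and>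
        ys = map (\<lambda>i. of_bool (bool_mult n M v i)) [0..<j] \<and> t2 \<le> t1 + 150 + 400 * j"])
      show "n < X" by (rule n_less_X)
    next
      fix j m2 and xs ys :: "nat list" and t2 assume "m2 2 = j \<and> (\<forall>a. a \<noteq> 2 \<longrightarrow> m2 a = m1 a) \<and>
        ys = map (\<lambda>i. of_bool (bool_mult n M v i)) [0..<j] \<and> t2 \<le> t1 + 150 + 400 * j"
      then show "m2 2 = j \<and> aval m2 (V 12) = n" using I1 by (simp add: inv_def)
    next
      fix j m2 and xs ys :: "nat list" and t2 assume j: "j < n" and *: "m2 2 = j \<and> (\<forall>a. a \<noteq> 2 \<longrightarrow> m2 a = m1 a) \<and>
        ys = map (\<lambda>i. of_bool (bool_mult n M v i)) [0..<j] \<and> t2 \<le> t1 + 150 + 400 * j"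
      then have "m2 (ad 2 j) = of_bool (bool_mult n M v j)" using F[OF j] by simp
      then show "wpx (Write (Cell (AD 2 (V 2)))) m2 xs ys (t2 + 70) (\<lambda>m' xs' ys' t'. m' 2 = j \<and> (m'(2 := Suc j)) 2 = Suc j \<and>
        (\<forall>a. a \<noteq> 2 \<longrightarrow> (m'(2 := Suc j)) a = m1 a) \<and>
        ys' = map (\<lambda>i. of_bool (bool_mult n M v i)) [0..<Suc j] \<and> t' + 150 \<le> t1 + 150 + 400 * Suc j)"
        using * by (intro wpx_Write) auto
    next
      fix m2 and xs ys :: "nat list" and t2 assume *: "m2 2 = n \<and> (\<forall>a. a \<noteq> 2 \<longrightarrow> m2 a = m1 a) \<and>
        ys = map (\<lambda>i. of_bool (bool_mult n M v i)) [0..<n] \<and> t2 \<le> t1 + 150 + 400 * n"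
      have "inv ?Mg m2 \<tau>1 \<rho>1 (init_cost + step_cost * Suc k) (t2 + 70)"
        using I1 by (rule inv_frame) (use * in \<open>auto simp: e_def step_cost_def\<close>)
      then show "?Q m2 xs ys (t2 + 70)"
        using * \<rho>1 m19 Z by (auto simp: ready_def enc_vector_def)
    qed auto
  qed
  have clear: "wp (Seq (FOR 2 (V 12) (Assign (AD 2 (V 2)) (Lit 0))) BLOCKS) m1 t1
      (\<lambda>m' t'. wpx (FOR 2 (V 12) (Write (Cell (AD 2 (V 2))))) m' [] [] t' ?Q)"
    if I1: "inv ?Mg m1 \<tau> \<rho> (e + 300 + 400 * n) t1" and V1: "\<forall>j<q*q. (m1 (ad 1 j) \<noteq> 0) = w j"
      and m19: "m1 19 \<noteq> 0" and z1: "\<forall>i. n \<le> i \<and> i < q * q \<longrightarrow> m1 (ad 2 i) = 0" for m1 t1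
  proof (rule wp_Seq, rule wp_FOR[where n = n and I = "\<lambda>j m2 t2. m2 2 = j \<and> (\<forall>a. a < 40 \<longrightarrow> a \<noteq> 2 \<longrightarrow> m2 a = m1 a) \<and>
        (\<forall>a b. a < 8 \<longrightarrow> a \<noteq> 2 \<longrightarrow> m2 (ad a b) = m1 (ad a b)) \<and> (\<forall>i. i < j \<or> n \<le> i \<and> i < q * q \<longrightarrow> m2 (ad 2 i) = 0) \<and>
        t2 \<le> t1 + 150 + 400 * j"])
    show "n < X" by (rule n_less_X)
    show "(m1(2 := 0)) 2 = 0 \<and> (\<forall>a. a < 40 \<longrightarrow> a \<noteq> 2 \<longrightarrow> (m1(2 := 0)) a = m1 a) \<and>
        (\<forall>a b. a < 8 \<longrightarrow> a \<noteq> 2 \<longrightarrow> (m1(2 := 0)) (ad a b) = m1 (ad a b)) \<and>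
        (\<forall>i. i < 0 \<or> n \<le> i \<and> i < q * q \<longrightarrow> (m1(2 := 0)) (ad 2 i) = 0) \<and> t1 + 150 \<le> t1 + 150 + 400 * 0"
      using z1 by auto
  next
    fix j m2 t2 assume "m2 2 = j \<and> (\<forall>a. a < 40 \<longrightarrow> a \<noteq> 2 \<longrightarrow> m2 a = m1 a) \<and>
        (\<forall>a b. a < 8 \<longrightarrow> a \<noteq> 2 \<longrightarrow> m2 (ad a b) = m1 (ad a b)) \<and> (\<forall>i. i < j \<or> n \<le> i \<and> i < q * q \<longrightarrow> m2 (ad 2 i) = 0) \<and>
        t2 \<le> t1 + 150 + 400 * j"
    then show "m2 2 = j \<and> aval m2 (V 12) = n" using I1 by (simp add: inv_def)
  next
    fix j m2 t2 assume "j < n" and "m2 2 = j \<and> (\<forall>a. a < 40 \<longrightarrow> a \<noteq> 2 \<longrightarrow> m2 a = m1 a) \<and>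
        (\<forall>a b. a < 8 \<longrightarrow> a \<noteq> 2 \<longrightarrow> m2 (ad a b) = m1 (ad a b)) \<and> (\<forall>i. i < j \<or> n \<le> i \<and> i < q * q \<longrightarrow> m2 (ad 2 i) = 0) \<and>
        t2 \<le> t1 + 150 + 400 * j"
    then show "wp (Assign (AD 2 (V 2)) (Lit 0)) m2 (t2 + 70) (\<lambda>m' t'. m' 2 = j \<and> (m'(2 := Suc j)) 2 = Suc j \<and>
        (\<forall>a. a < 40 \<longrightarrow> a \<noteq> 2 \<longrightarrow> (m'(2 := Suc j)) a = m1 a) \<and>
        (\<forall>a b. a < 8 \<longrightarrow> a \<noteq> 2 \<longrightarrow> (m'(2 := Suc j)) (ad a b) = m1 (ad a b)) \<and>
        (\<forall>i. i < Suc j \<or> n \<le> i \<and> i < q * q \<longrightarrow> (m'(2 := Suc j)) (ad 2 i) = 0) \<and> t' + 150 \<le> t1 + 150 + 400 * Suc j)"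
      using X100 by (intro wp_Assign) (auto simp: less_Suc_eq)
  next
    fix m2 t2 assume *: "m2 2 = n \<and> (\<forall>a. a < 40 \<longrightarrow> a \<noteq> 2 \<longrightarrow> m2 a = m1 a) \<and>
        (\<forall>a b. a < 8 \<longrightarrow> a \<noteq> 2 \<longrightarrow> m2 (ad a b) = m1 (ad a b)) \<and> (\<forall>i. i < n \<or> n \<le> i \<and> i < q * q \<longrightarrow> m2 (ad 2 i) = 0) \<and>
        t2 \<le> t1 + 150 + 400 * n"
    have I2: "inv ?Mg m2 \<tau> \<rho> (e + 600 + 800 * n) (t2 + 70)"
      using I1 by (rule inv_frame) (use * in auto)
    have F2: "\<forall>i<q*q. m2 (ad 2 i) = 0" using * by (meson not_le)
    then have so: "sound ?Mg w m2" using V1 * unfolding sound_def by auto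
    have f: "found m2 = 0" using F2 by (auto simp: found_def)
    \<comment> \<open>Of the rounds allotted to all \<open>n\<close> vectors, enough are left for
      this one.\<close>
    have "2 * q * q * Suc k \<le> 2 * q * q * n" using k by (intro mult_le_mono2) simp
    then have r: "\<rho> + 2 * q * q \<le> 2 * q * q * n" using \<rho> by simp
    show "wp BLOCKS m2 (t2 + 70) (\<lambda>m' t'. wpx (FOR 2 (V 12) (Write (Cell (AD 2 (V 2))))) m' [] [] t' ?Q)"
    proof (rule wp_BLOCKS[OF I2 so _ f r])
      show "m2 19 \<noteq> 0" using * m19 by simp
      fix m3 t3 \<tau>3 \<rho>3 assume I3: "inv ?Mg m3 \<tau>3 \<rho>3 (e + 600 + 800 * n + 220 + 1000 * (q * q)) t3"
        and r3: "\<rho>3 \<le> \<rho> + 2 * q * q" and rest: "sound ?Mg w m3" "m3 19 \<noteq> 0" "\<forall>b<q*q. block_done ?Mg w m3 b"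
      have "inv ?Mg m3 \<tau>3 \<rho>3 (e + 2000 * (q * q) + 1000 + 1000 * n) t3"
        using I3 by (rule inv_frame) auto
      moreover have "\<rho>3 \<le> 2 * q * q * Suc k" using r3 \<rho> by simp
      ultimately show "wpx (FOR 2 (V 12) (Write (Cell (AD 2 (V 2))))) m3 [] [] t3 ?Q" using rest by (rule tail)
    qed
  qed auto
  have regroup: "wpx (Seq (FOR 2 (V 12) (Assign (AD 2 (V 2)) (Lit 0)))
     (Seq BLOCKS (FOR 2 (V 12) (Write (Cell (AD 2 (V 2))))))) m1 [] [] t1 ?Q"
    if "inv ?Mg m1 \<tau> \<rho> (e + 300 + 400 * n) t1" "\<forall>j<q*q. (m1 (ad 1 j) \<noteq> 0) = w j"
      "m1 19 \<noteq> 0" "\<forall>i. n \<le> i \<and> i < q * q \<longrightarrow> m1 (ad 2 i) = 0" for m1 t1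
  proof -
    have "wpx (Seq (FOR 2 (V 12) (Assign (AD 2 (V 2)) (Lit 0))) BLOCKS) m1 [] [] t1
      (\<lambda>m' xs' ys' t'. wpx (FOR 2 (V 12) (Write (Cell (AD 2 (V 2))))) m' xs' ys' t' ?Q)"
      by (rule wp_wpx) (rule clear[OF that])
    then have "wpx (Seq (Seq (FOR 2 (V 12) (Assign (AD 2 (V 2)) (Lit 0))) BLOCKS)
      (FOR 2 (V 12) (Write (Cell (AD 2 (V 2)))))) m1 [] [] t1 ?Q" by (rule wpx_Seq)
    then show ?thesis by (rule wpx_Seq_assoc)
  qed
  show ?thesis unfolding STEP_def
  proof (rule wpx_Seq, rule wpx_FOR[where n = n and I = "\<lambda>j m2 xs ys t2. m2 2 = j \<and> (\<forall>a. a < 40 \<longrightarrow> a \<noteq> 2 \<longrightarrow> m2 a = m a) \<and>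
        (\<forall>a b. a < 8 \<longrightarrow> a \<noteq> 1 \<longrightarrow> m2 (ad a b) = m (ad a b)) \<and> (\<forall>i<j. m2 (ad 1 i) = of_bool (v i)) \<and>
        (\<forall>i. n \<le> i \<and> i < q * q \<longrightarrow> m2 (ad 1 i) = 0) \<and>
        xs = map (\<lambda>i. of_bool (v i)) [j..<n] \<and> ys = [] \<and> t2 \<le> t + 220 + 400 * j"])
    show "n < X" by (rule n_less_X)
    show "(m(2 := 0)) 2 = 0 \<and> (\<forall>a. a < 40 \<longrightarrow> a \<noteq> 2 \<longrightarrow> (m(2 := 0)) a = m a) \<and>
        (\<forall>a b. a < 8 \<longrightarrow> a \<noteq> 1 \<longrightarrow> (m(2 := 0)) (ad a b) = m (ad a b)) \<and> (\<forall>i<0. (m(2 := 0)) (ad 1 i) = of_bool (v i)) \<and>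
        (\<forall>i. n \<le> i \<and> i < q * q \<longrightarrow> (m(2 := 0)) (ad 1 i) = 0) \<and>
        enc_vector n v = map (\<lambda>i. of_bool (v i)) [0..<n] \<and> [] = [] \<and> t + 70 + 150 \<le> t + 220 + 400 * 0"
      using z by (auto simp: enc_vector_def)
  next
    fix j m2 and xs ys :: "nat list" and t2 assume "m2 2 = j \<and> (\<forall>a. a < 40 \<longrightarrow> a \<noteq> 2 \<longrightarrow> m2 a = m a) \<and>
        (\<forall>a b. a < 8 \<longrightarrow> a \<noteq> 1 \<longrightarrow> m2 (ad a b) = m (ad a b)) \<and> (\<forall>i<j. m2 (ad 1 i) = of_bool (v i)) \<and>
        (\<forall>i. n \<le> i \<and> i < q * q \<longrightarrow> m2 (ad 1 i) = 0) \<and>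
        xs = map (\<lambda>i. of_bool (v i)) [j..<n] \<and> ys = [] \<and> t2 \<le> t + 220 + 400 * j"
    then show "m2 2 = j \<and> aval m2 (V 12) = n" using I by (simp add: inv_def)
  next
    fix j m2 and xs ys :: "nat list" and t2 assume j: "j < n" and *: "m2 2 = j \<and> (\<forall>a. a < 40 \<longrightarrow> a \<noteq> 2 \<longrightarrow> m2 a = m a) \<and>
        (\<forall>a b. a < 8 \<longrightarrow> a \<noteq> 1 \<longrightarrow> m2 (ad a b) = m (ad a b)) \<and> (\<forall>i<j. m2 (ad 1 i) = of_bool (v i)) \<and>
        (\<forall>i. n \<le> i \<and> i < q * q \<longrightarrow> m2 (ad 1 i) = 0) \<and>
        xs = map (\<lambda>i. of_bool (v i)) [j..<n] \<and> ys = [] \<and> t2 \<le> t + 220 + 400 * j"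
    show "wpx (Read (AD 1 (V 2))) m2 xs ys (t2 + 70) (\<lambda>m' xs' ys' t'. m' 2 = j \<and> (m'(2 := Suc j)) 2 = Suc j \<and>
        (\<forall>a. a < 40 \<longrightarrow> a \<noteq> 2 \<longrightarrow> (m'(2 := Suc j)) a = m a) \<and>
        (\<forall>a b. a < 8 \<longrightarrow> a \<noteq> 1 \<longrightarrow> (m'(2 := Suc j)) (ad a b) = m (ad a b)) \<and> (\<forall>i<Suc j. (m'(2 := Suc j)) (ad 1 i) = of_bool (v i)) \<and>
        (\<forall>i. n \<le> i \<and> i < q * q \<longrightarrow> (m'(2 := Suc j)) (ad 1 i) = 0) \<and>
        xs' = map (\<lambda>i. of_bool (v i)) [Suc j..<n] \<and> ys' = [] \<and> t' + 150 \<le> t + 220 + 400 * Suc j)"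
    proof (rule wpx_Read)
      show "xs = of_bool (v j) # map (\<lambda>i. of_bool (v i)) [Suc j..<n]" using * j by (simp add: upt_conv_Cons)
    qed (use * j X100 in \<open>auto simp: less_Suc_eq\<close>)
  next
    fix m2 and xs ys :: "nat list" and t2 assume *: "m2 2 = n \<and> (\<forall>a. a < 40 \<longrightarrow> a \<noteq> 2 \<longrightarrow> m2 a = m a) \<and>
        (\<forall>a b. a < 8 \<longrightarrow> a \<noteq> 1 \<longrightarrow> m2 (ad a b) = m (ad a b)) \<and> (\<forall>i<n. m2 (ad 1 i) = of_bool (v i)) \<and>
        (\<forall>i. n \<le> i \<and> i < q * q \<longrightarrow> m2 (ad 1 i) = 0) \<and>
        xs = map (\<lambda>i. of_bool (v i)) [n..<n] \<and> ys = [] \<and> t2 \<le> t + 220 + 400 * n"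
    then have e: "xs = []" "ys = []" by auto
    show "wpx (Seq (FOR 2 (V 12) (Assign (AD 2 (V 2)) (Lit 0)))
       (Seq BLOCKS (FOR 2 (V 12) (Write (Cell (AD 2 (V 2))))))) m2 xs ys (t2 + 70) ?Q"
      unfolding e
    proof (rule regroup)
      show "inv ?Mg m2 \<tau> \<rho> (e + 300 + 400 * n) (t2 + 70)" using I by (rule inv_frame) (use * in auto)
      show "\<forall>j<q * q. (m2 (ad 1 j) \<noteq> 0) = w j"
      proof (intro allI impI)
        fix j assume "j < q * q"
        then show "(m2 (ad 1 j) \<noteq> 0) = w j" using * by (cases "j < n") (auto simp: w_def)
      qed
    qed (use * m19 z in auto)
  qed auto
qed

end

section \<open>Preprocessing and the whole session\<close>

definition LOADQ :: com where
  "LOADQ = Seq (Assign (Lit 11) (Lit 2)) (While (Op Less (Op Times (V 11) (V 11)) (V 12)) (Assign (Lit 11) (Op Plus (V 11) (Lit 1))))"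

lemma cell_index: "i * Z + j = i' * Z + j' \<Longrightarrow> j < Z \<Longrightarrow> j' < (Z::nat) \<Longrightarrow> i = i' \<and> j = j'"
proof -
  assume e: "i * Z + j = i' * Z + j'" and j: "j < Z" "j' < Z"
  have "(i * Z + j) div Z = (i' * Z + j') div Z" "(i * Z + j) mod Z = (i' * Z + j') mod Z" using e by simp_all
  then show ?thesis using j by simp
qed

text \<open>Minimality of \<open>q\<close> makes the linear search in \<open>LOADQ\<close> stop
  exactly there.\<close>

locale omv_main = omv +
  assumes q_min: "\<And>q'. 2 \<le> q' \<Longrightarrow> q' < q \<Longrightarrow> q' * q' < n"
begin

definition LOADM :: com where
  "LOADM = FOR 2 (V 12) (FOR 3 (V 12) (Read (AD 0 (Op Plus (Op Times (V 2) (Op Times (V 11) (V 11))) (V 3)))))"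

definition PRE :: com where
  "PRE = Seq (Assign (Lit 19) (Lit 1)) (Seq (Read (Lit 12)) (Seq LOADQ (Seq (SPOW c) LOADM)))"

lemma wp_LOADQ:
  assumes "m 12 = n" and Q: "Q (m(11 := q)) (t + 220 + 220 * q)"
    and mono: "\<And>m t t'. Q m t \<Longrightarrow> t' \<le> t \<Longrightarrow> Q m t'"
  shows "wp LOADQ m t Q"
  unfolding LOADQ_def
proof (rule wp_Seq, rule wp_Assign)
  let ?m = "m(aval m (Lit 11) := aval m (Lit 2))"
  show "wp (While (Op Less (Op Times (V 11) (V 11)) (V 12)) (Assign (Lit 11) (Op Plus (V 11) (Lit 1)))) ?m (t + 150) Q"
  proof (rule wp_While[where i = "q - 2" and I = "\<lambda>i m1 t1. m1 = m(11 := q - i) \<and> i \<le> q - 2 \<and> t1 \<le> t + 150 + 220 * (q - i)"])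
    show "?m = m(11 := q - (q - 2)) \<and> q - 2 \<le> q - 2 \<and> t + 150 \<le> t + 150 + 220 * (q - (q - 2))"
      using q2 by auto
  next
    fix i m1 t1 assume I: "m1 = m(11 := q - i) \<and> i \<le> q - 2 \<and> t1 \<le> t + 150 + 220 * (q - i)"
      and c: "aval m1 (Op Less (Op Times (V 11) (V 11)) (V 12)) \<noteq> 0"
    then have "(q - i) * (q - i) < n" using assms(1) by (auto split: if_splits)
    then have "i \<noteq> 0" using nq by (cases i) auto
    then have i: "0 < i" "i \<le> q" using I by auto
    have qi: "Suc (q - i) = q - (i - 1)" using i by simp
    have "q - i + 1 < X" using i X_sizes by simp
    then show "wp (Assign (Lit 11) (Op Plus (V 11) (Lit 1))) m1 (t1 + 70)
        (\<lambda>m' t'. \<exists>j<i. m' = m(11 := q - j) \<and> j \<le> q - 2 \<and> t' \<le> t + 150 + 220 * (q - j))"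
      using I i qi by (intro wp_Assign) (auto intro!: exI[of _ "i - 1"])
  next
    fix i m1 t1 assume I: "m1 = m(11 := q - i) \<and> i \<le> q - 2 \<and> t1 \<le> t + 150 + 220 * (q - i)"
      and c: "aval m1 (Op Less (Op Times (V 11) (V 11)) (V 12)) = 0"
    then have "\<not> (q - i) * (q - i) < n" using assms(1) by (auto split: if_splits)
    moreover have "2 \<le> q - i" using I q2 by linarith
    ultimately have "\<not> q - i < q" using q_min[of "q - i"] by auto
    then have "i = 0" using q2 by auto
    then show "Q m1 (t1 + 70)" using mono[OF Q, of "t1 + 70"] I by simp
  qed simp
qed (use X100 in auto)

lemma wp_SPOW:
  assumes "m 11 = q" "k \<le> c" and Q: "Q (m(15 := (7 * q + 2) ^ k)) (t + 150 * (k + 1))"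
  shows "wp (SPOW k) m t Q"
  using assms(2) Q
proof (induction k arbitrary: Q)
  case 0
  then show ?case using X100 by (simp del: fun_upd_apply, intro wp_Assign) (simp_all del: fun_upd_apply)
next
  case (Suc k)
  have "(7 * q + 2) ^ Suc k \<le> S" using Suc.prems(1) by (intro power_increasing) auto
  moreover have "S \<le> (2 * q * n + q * q + 2) * S" by simp
  ultimately have lt: "(7 * q + 2) ^ Suc k < X" using X_big by linarith
  show ?case unfolding SPOW.simps
  proof (rule wp_Seq, rule Suc.IH)
    show "k \<le> c" using Suc.prems(1) by simp
    show "wp (Assign (Lit 15) (Op Times (V 15) (Op Plus (Op Times (Lit 7) (V 11)) (Lit 2))))
        (m(15 := (7 * q + 2) ^ k)) (t + 150 * (k + 1)) Q"
    proof -
      let ?m = "m(15 := (7 * q + 2) ^ k)"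
      have e: "aval ?m (Op Times (V 15) (Op Plus (Op Times (Lit 7) (V 11)) (Lit 2))) = (7 * q + 2) ^ Suc k"
        using assms(1) by (simp add: mult.commute)
      have tt: "t + 150 * (Suc k + 1) = t + 150 * (k + 1) + 150" by simp
      show ?thesis
      proof (rule wp_Assign, unfold e aval.simps(1) fun_upd_upd)
        show "Q (m(15 := (7 * q + 2) ^ Suc k)) (t + 150 * (k + 1) + 150)"
          using Suc.prems(2) unfolding tt .
      qed (use lt in simp_all)
    qed
  qed
qed

text \<open>Entries are read in row-major order up to \<open>i\<close>, \<open>j\<close>. The rest,
  padding included, is zero because the memory starts that way.\<close>

definition loaded :: "(nat \<Rightarrow> nat \<Rightarrow> bool) \<Rightarrow> nat \<Rightarrow> nat \<Rightarrow> memory \<Rightarrow> bool" where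
  "loaded M i j m \<longleftrightarrow> m 11 = q \<and> m 12 = n \<and> m 15 = S \<and> m 16 = 0 \<and> m 19 = 1 \<and>
     (\<forall>a b. a \<in> {1,2,3,4,6} \<longrightarrow> m (ad a b) = 0) \<and>
     (\<forall>i'<q*q. \<forall>j'<q*q. m (ad 0 (i' * (q * q) + j')) =
        of_bool (matrix M i' j' \<and> (i' < i \<or> i' = i \<and> j' < j)))"

abbreviation mrow where "mrow M i \<equiv> map (\<lambda>j. of_bool (M i j) :: nat) [0..<n]"

lemma loaded_step:
  assumes "loaded M i j m" "i < n" "j < n"
  shows "loaded M i (Suc j) (m(ad 0 (i * (q * q) + j) := of_bool (M i j)))"
proof -
  have ij: "i < q * q" "j < q * q" using assms nq by auto
  have "(m(ad 0 (i * (q * q) + j) := of_bool (M i j))) (ad 0 (i' * (q * q) + j')) =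
      of_bool (matrix M i' j' \<and> (i' < i \<or> i' = i \<and> j' < Suc j))" if "i' < q * q" "j' < q * q" for i' j'
  proof (cases "i' = i \<and> j' = j")
    case True
    then show ?thesis using assms by (simp add: matrix_def)
  next
    case False
    then have "i' * (q * q) + j' \<noteq> i * (q * q) + j" using cell_index[of i' "q * q" j' i j] that ij by auto
    moreover have "(i' < i \<or> i' = i \<and> j' < Suc j) \<longleftrightarrow> (i' < i \<or> i' = i \<and> j' < j)" using False by (auto simp: less_Suc_eq)
    ultimately show ?thesis using assms(1) that unfolding loaded_def by simp
  qed
  then show ?thesis using assms(1) unfolding loaded_def by auto
qed

lemma loaded_row: "loaded M i n m \<longleftrightarrow> loaded M (Suc i) 0 m"
  unfolding loaded_def by (auto simp: matrix_def less_Suc_eq of_bool_def)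

lemma loaded_var: "v < 11 \<Longrightarrow> loaded M i j (m(v := x)) = loaded M i j m"
  unfolding loaded_def by auto

lemma wpx_LOADM:
  assumes "loaded M 0 0 m" and Q: "\<And>m'. loaded M n 0 m' \<Longrightarrow> Q m' [] [] (t + 220 + (370 * n + 600) * n)"
    and mono: "\<And>m xs ys t t'. Q m xs ys t \<Longrightarrow> t' \<le> t \<Longrightarrow> Q m xs ys t'"
  shows "wpx LOADM m (concat (map (mrow M) [0..<n])) [] t Q"
  unfolding LOADM_def
proof (rule wpx_FOR[where n = n and I = "\<lambda>i m xs ys t1. m 2 = i \<and> loaded M i 0 m \<and>
    xs = concat (map (mrow M) [i..<n]) \<and> ys = [] \<and> t1 \<le> t + 150 + (370 * n + 600) * i"])
  show "n < X" by (rule n_less_X)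
  show "(m(2 := 0)) 2 = 0 \<and> loaded M 0 0 (m(2 := 0)) \<and> concat (map (mrow M) [0..<n]) = concat (map (mrow M) [0..<n]) \<and>
    [] = [] \<and> t + 150 \<le> t + 150 + (370 * n + 600) * 0"
    using assms(1) by (simp add: loaded_var)
next
  fix i m and xs ys :: "nat list" and t1 assume "m 2 = i \<and> loaded M i 0 m \<and>
    xs = concat (map (mrow M) [i..<n]) \<and> ys = [] \<and> t1 \<le> t + 150 + (370 * n + 600) * i"
  then show "m 2 = i \<and> aval m (V 12) = n" by (simp add: loaded_def)
next
  fix i m and xs ys :: "nat list" and t1 assume i: "i < n" and *: "m 2 = i \<and> loaded M i 0 m \<and>
    xs = concat (map (mrow M) [i..<n]) \<and> ys = [] \<and> t1 \<le> t + 150 + (370 * n + 600) * i"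
  let ?rest = "concat (map (mrow M) [Suc i..<n])"
  have xs: "xs = map (\<lambda>j. of_bool (M i j)) [0..<n] @ ?rest" using * i by (simp add: upt_conv_Cons)
  show "wpx (FOR 3 (V 12) (Read (AD 0 (Op Plus (Op Times (V 2) (Op Times (V 11) (V 11))) (V 3))))) m xs ys (t1 + 70)
    (\<lambda>m' xs' ys' t'. m' 2 = i \<and> (m'(2 := Suc i)) 2 = Suc i \<and> loaded M (Suc i) 0 (m'(2 := Suc i)) \<and>
    xs' = ?rest \<and> ys' = [] \<and> t' + 150 \<le> t + 150 + (370 * n + 600) * Suc i)"
  proof (rule wpx_FOR[where n = n and I = "\<lambda>j m1 xs1 ys1 t2. m1 3 = j \<and> m1 2 = i \<and> loaded M i j m1 \<and>
      xs1 = map (\<lambda>j. of_bool (M i j)) [j..<n] @ ?rest \<and> ys1 = [] \<and> t2 \<le> t1 + 220 + 370 * j"])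
    show "n < X" by (rule n_less_X)
    show "(m(3 := 0)) 3 = 0 \<and> (m(3 := 0)) 2 = i \<and> loaded M i 0 (m(3 := 0)) \<and>
      xs = map (\<lambda>j. of_bool (M i j)) [0..<n] @ ?rest \<and> ys = [] \<and> t1 + 70 + 150 \<le> t1 + 220 + 370 * 0"
      using * xs by (simp add: loaded_var)
  next
    fix j m1 and xs1 ys1 :: "nat list" and t2 assume "m1 3 = j \<and> m1 2 = i \<and> loaded M i j m1 \<and>
      xs1 = map (\<lambda>j. of_bool (M i j)) [j..<n] @ ?rest \<and> ys1 = [] \<and> t2 \<le> t1 + 220 + 370 * j"
    then show "m1 3 = j \<and> aval m1 (V 12) = n" by (simp add: loaded_def)
  next
    fix j m1 and xs1 ys1 :: "nat list" and t2 assume j: "j < n" and **: "m1 3 = j \<and> m1 2 = i \<and> loaded M i j m1 \<and>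
      xs1 = map (\<lambda>j. of_bool (M i j)) [j..<n] @ ?rest \<and> ys1 = [] \<and> t2 \<le> t1 + 220 + 370 * j"
    have ld: "loaded M i (Suc j) (m1(ad 0 (i * (q * q) + j) := of_bool (M i j)))"
      using ** by (intro loaded_step i j) auto
    have m11: "m1 11 = q" using ** by (simp add: loaded_def)
    show "wpx (Read (AD 0 (Op Plus (Op Times (V 2) (Op Times (V 11) (V 11))) (V 3)))) m1 xs1 ys1 (t2 + 70)
      (\<lambda>m' xs' ys' t'. m' 3 = j \<and> (m'(3 := Suc j)) 3 = Suc j \<and> (m'(3 := Suc j)) 2 = i \<and>
       loaded M i (Suc j) (m'(3 := Suc j)) \<and> xs' = map (\<lambda>j. of_bool (M i j)) [Suc j..<n] @ ?rest \<and> ys' = [] \<and>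
       t' + 150 \<le> t1 + 220 + 370 * Suc j)"
    proof (rule wpx_Read)
      show "xs1 = of_bool (M i j) # (map (\<lambda>j. of_bool (M i j)) [Suc j..<n] @ ?rest)"
        using ** j by (simp add: upt_conv_Cons)
    qed (use ** ld m11 X100 in \<open>auto simp: loaded_var\<close>)
  next
    fix m1 and xs1 ys1 :: "nat list" and t2 assume **: "m1 3 = n \<and> m1 2 = i \<and> loaded M i n m1 \<and>
      xs1 = map (\<lambda>j. of_bool (M i j)) [n..<n] @ ?rest \<and> ys1 = [] \<and> t2 \<le> t1 + 220 + 370 * n"
    then show "m1 2 = i \<and> (m1(2 := Suc i)) 2 = Suc i \<and> loaded M (Suc i) 0 (m1(2 := Suc i)) \<and>
    xs1 = ?rest \<and> ys1 = [] \<and> t2 + 70 + 150 \<le> t + 150 + (370 * n + 600) * Suc i"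
      using * by (simp add: loaded_var flip: loaded_row)
  qed auto
next
  fix m and xs ys :: "nat list" and t1 assume *: "m 2 = n \<and> loaded M n 0 m \<and>
    xs = concat (map (mrow M) [n..<n]) \<and> ys = [] \<and> t1 \<le> t + 150 + (370 * n + 600) * n"
  then show "Q m xs ys (t1 + 70)" using mono[OF Q[of m], of "t1 + 70"] by simp
qed auto

text \<open>No generation exists and no rounds remain, so the clauses about instances hold
  vacuously.\<close>

lemma loaded_ready:
  assumes "loaded M n 0 m" "t \<le> init_cost"
  shows "ready M 0 m t"
proof -
  have l: "m 11 = q" "m 12 = n" "m 15 = S" "m 16 = 0" "m 19 = 1" "\<forall>a b. a \<in> {1,2,3,4,6} \<longrightarrow> m (ad a b) = 0"
    using assms(1) by (simp_all add: loaded_def)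
  have M: "(m (ad 0 (i * (q * q) + j)) \<noteq> 0) = matrix M i j" if "i < q * q" "j < q * q" for i j
    using assms(1) that unfolding loaded_def by (auto simp: matrix_def)
  have "inv (matrix M) m (\<lambda>_. 0) 0 (init_cost + step_cost * 0) t"
    unfolding inv_def using l M assms(2) by (auto simp: rem_def)
  then show ?thesis using l by (auto simp: ready_def)
qed

definition MAIN :: com where
  "MAIN = Cond (V 19) STEP PRE"

lemma wpx_PRE:
  "wpx MAIN initial_memory (enc_matrix n M) [] 0 (\<lambda>m' xs' ys' t'. ready M 0 m' t')"
  unfolding MAIN_def
proof (rule wpx_Cond)
  let ?m1 = "initial_memory(19 := 1, 12 := n)"
  let ?m2 = "?m1(11 := q, 15 := S)"
  have ld: "loaded M 0 0 ?m2" by (auto simp: loaded_def)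
  have time: "730 + 220 * q + 150 * (c + 1) + 220 + (370 * n + 600) * n \<le> init_cost"
  proof -
    have "n \<le> n * n" by simp
    then have "1100 + 220 * q + 150 * c + 370 * (n * n) + 600 * n \<le> 5000 + 300 * q + 200 * c + 1500 * (n * n)"
      by linarith
    then show ?thesis by (simp add: init_cost_def algebra_simps)
  qed
  have 3: "wpx LOADM ?m2 (concat (map (mrow M) [0..<n])) [] (730 + 220 * q + 150 * (c + 1)) (\<lambda>m' xs' ys' t'. ready M 0 m' t')"
  proof (rule wpx_LOADM[OF ld])
    show "ready M 0 m' (730 + 220 * q + 150 * (c + 1) + 220 + (370 * n + 600) * n)" if "loaded M n 0 m'" for m'
      using that time by (rule loaded_ready)
    show "ready M 0 m t'" if "ready M 0 m t" "t' \<le> t" for m xs ys t t'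
    proof -
      obtain \<tau> \<rho> where *: "inv (matrix M) m \<tau> \<rho> (init_cost + step_cost * 0) t" "\<rho> \<le> 2 * q * q * 0"
        using \<open>ready M 0 m t\<close> by (auto simp: ready_def)
      have "inv (matrix M) m \<tau> \<rho> (init_cost + step_cost * 0) t'"
        using *(1) by (rule inv_frame) (use \<open>t' \<le> t\<close> in auto)
      then show ?thesis using *(2) \<open>ready M 0 m t\<close> unfolding ready_def by blast
    qed
  qed
  have 2: "wpx (Seq LOADQ (Seq (SPOW c) LOADM)) ?m1 (concat (map (mrow M) [0..<n])) [] 500 (\<lambda>m' xs' ys' t'. ready M 0 m' t')"
  proof (rule wpx_Seq, rule wp_wpx, rule wp_LOADQ)
    show "wpx (Seq (SPOW c) LOADM) (?m1(11 := q)) (concat (map (mrow M) [0..<n])) [] (500 + 220 + 220 * q) (\<lambda>m' xs' ys' t'. ready M 0 m' t')"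
    proof (rule wpx_Seq, rule wp_wpx, rule wp_SPOW)
      show "wpx LOADM (?m1(11 := q, 15 := S)) (concat (map (mrow M) [0..<n])) [] (500 + 220 + 220 * q + 150 * (c + 1)) (\<lambda>m' xs' ys' t'. ready M 0 m' t')"
        by (rule wpx_time[OF 3]) simp
    qed auto
    show "wpx (Seq (SPOW c) LOADM) m (concat (map (mrow M) [0..<n])) [] t' (\<lambda>m' xs' ys' t'. ready M 0 m' t')"
      if "wpx (Seq (SPOW c) LOADM) m (concat (map (mrow M) [0..<n])) [] t (\<lambda>m' xs' ys' t'. ready M 0 m' t')" "t' \<le> t" for m t t'
      using that by (rule wpx_time)
  qed simp
  have em: "enc_matrix n M = n # concat (map (mrow M) [0..<n])" by (simp add: enc_matrix_def)
  show "wpx PRE initial_memory (enc_matrix n M) [] (0 + 70) (\<lambda>m' xs' ys' t'. ready M 0 m' t')"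
    unfolding PRE_def em
  proof (rule wpx_Seq, rule wpx_Assign, goal_cases)
    case 4
    show ?case
    proof (rule wpx_Seq, rule wpx_Read[where x = n and xs' = "concat (map (mrow M) [0..<n])"], goal_cases)
      case 4
      show ?case using wpx_time[OF 2, of "0 + 70 + 150 + 150"] by simp
    qed (use n_less_X in auto)
  qed (use X100 in auto)
qed auto

lemma wpx_MAIN:
  assumes "ready M k m t" "k < n"
  shows "wpx MAIN m (enc_vector n v) [] t (\<lambda>m' xs' ys' t'. ys' = enc_vector n (bool_mult n M v) \<and> ready M (Suc k) m' t')"
  unfolding MAIN_def
proof (rule wpx_Cond)
  show "wpx STEP m (enc_vector n v) [] (t + 70) (\<lambda>m' xs' ys' t'. ys' = enc_vector n (bool_mult n M v) \<and> ready M (Suc k) m' t')"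
    by (rule wpx_STEP[OF assms])
  assume "aval m (V 19) = 0"
  then show "wpx PRE m (enc_vector n v) [] (t + 70) (\<lambda>m' xs' ys' t'. ys' = enc_vector n (bool_mult n M v) \<and> ready M (Suc k) m' t')"
    using assms(1) by (simp add: ready_def)
qed simp

text \<open>The number of generations times their budget, slowed down by the simulation, plus the
  overheads in \<open>inv\<close> at the maximal number of rounds.\<close>

definition total_cost :: real where
  "total_cost = 40 * (real (2 * q * n + q * q) * budget) + real (init_cost + step_cost * n +
     25000 * q * (2 * q * q * n) + 25000 * q * q * (2 * q * n + q * q))"

lemma ready_time:
  assumes "ready M n m t"
  shows "real t \<le> total_cost"
proof -
  obtain \<tau> \<rho> where I: "inv (matrix M) m \<tau> \<rho> (init_cost + step_cost * n) t" and \<rho>: "\<rho> \<le> 2 * q * q * n"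
    using assms by (auto simp: ready_def)
  have "(\<Sum>bk<q*q. rem m bk) \<le> (\<Sum>bk<q*q. q)"
    using I by (intro sum_mono) (auto simp: inv_def)
  then have "m 16 * q \<le> 2 * q * q * n + q * q * q"
    using I \<rho> by (auto simp: inv_def)
  also have "\<dots> = (2 * q * n + q * q) * q" by (simp add: algebra_simps)
  finally have G: "m 16 \<le> 2 * q * n + q * q" using q2 by simp
  have b0: "budget \<ge> 0" unfolding budget_def using T_nonneg by simp
  have "real (\<Sum>g<m 16. \<tau> g) \<le> (\<Sum>g<m 16. budget)"
    unfolding of_nat_sum using I by (intro sum_mono) (auto simp: inv_def)
  also have "\<dots> \<le> real (2 * q * n + q * q) * budget"
    using G b0 by (simp add: mult_right_mono del: of_nat_add of_nat_mult)
  finally have s: "real (\<Sum>g<m 16. \<tau> g) \<le> real (2 * q * n + q * q) * budget" .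
  have "t \<le> 40 * (\<Sum>g<m 16. \<tau> g) + (init_cost + step_cost * n) + 25000 * q * \<rho> + 25000 * q * q * m 16"
    using I by (simp add: inv_def)
  also have "\<dots> \<le> 40 * (\<Sum>g<m 16. \<tau> g) + (init_cost + step_cost * n + 25000 * q * (2 * q * q * n) + 25000 * q * q * (2 * q * n + q * q))"
    using mult_le_mono2[OF \<rho>, of "25000 * q"] mult_le_mono2[OF G, of "25000 * q * q"] by linarith
  finally have "real t \<le> 40 * real (\<Sum>g<m 16. \<tau> g) + real (init_cost + step_cost * n + 25000 * q * (2 * q * q * n) + 25000 * q * q * (2 * q * n + q * q))"
    by (metis of_nat_add of_nat_le_iff of_nat_mult of_nat_numeral)
  then show ?thesis using s unfolding total_cost_def by linarith
qed

lemma session_vectors: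
  assumes "k \<le> n" "ready M (n - k) m t" "small m"
  shows "\<exists>u. session B MAIN m (map (\<lambda>k. enc_vector n (v k)) [n - k..<n])
    (map (\<lambda>k. enc_vector n (bool_mult n M (v k))) [n - k..<n]) u \<and> real (t + u) \<le> total_cost"
  using assms
proof (induction k arbitrary: m t)
  case 0
  then show ?case using ready_time by (auto intro: session.Nil)
next
  case (Suc k)
  let ?k = "n - Suc k"
  have k: "?k < n" "Suc ?k = n - k" using Suc.prems by auto
  obtain u m' xs' ys' t' where *: "exec B MAIN (m, enc_vector n (v ?k), []) u (m', xs', ys')" "t + u \<le> t'" "small m'"
    "ys' = enc_vector n (bool_mult n M (v ?k))" "ready M (n - k) m' t'"
    using wpx_MAIN[OF Suc.prems(2) k(1), of "v ?k"] Suc.prems(3) k(2) unfolding wpx_def by auto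
  obtain u' where u': "session B MAIN m' (map (\<lambda>k. enc_vector n (v k)) [n - k..<n])
    (map (\<lambda>k. enc_vector n (bool_mult n M (v k))) [n - k..<n]) u'" "real (t' + u') \<le> total_cost"
    using Suc.IH[OF _ *(5,3)] Suc.prems(1) by auto
  have upt: "[?k..<n] = ?k # [n - k..<n]" using k by (simp add: upt_conv_Cons)
  have "session B MAIN m (map (\<lambda>k. enc_vector n (v k)) [?k..<n])
    (map (\<lambda>k. enc_vector n (bool_mult n M (v k))) [?k..<n]) (u + u')"
    unfolding upt list.map using *(1) u'(1) unfolding *(4) by (rule session.Cons)
  moreover have "real (t + (u + u')) \<le> total_cost" using *(2) u'(2) by linarith
  ultimately show ?case by blast
qed

lemma omv_session:
  "\<exists>out0 u. session B MAIN initial_memory (enc_matrix n M # map (\<lambda>k. enc_vector n (v k)) [0..<n])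
    (out0 # map (\<lambda>k. enc_vector n (bool_mult n M (v k))) [0..<n]) u \<and> real u \<le> total_cost"
proof -
  have "small initial_memory" using X100 by (simp add: small_def)
  then obtain u m' xs' ys' t' where *: "exec B MAIN (initial_memory, enc_matrix n M, []) u (m', xs', ys')" "0 + u \<le> t'"
    "small m'" "ready M 0 m' t'"
    using wpx_PRE[of M] unfolding wpx_def by blast
  obtain u' where u': "session B MAIN m' (map (\<lambda>k. enc_vector n (v k)) [0..<n])
    (map (\<lambda>k. enc_vector n (bool_mult n M (v k))) [0..<n]) u'" "real (t' + u') \<le> total_cost"
    using session_vectors[of n M m' t' v] *(3,4) by auto
  have "session B MAIN initial_memory (enc_matrix n M # map (\<lambda>k. enc_vector n (v k)) [0..<n])
    (ys' # map (\<lambda>k. enc_vector n (bool_mult n M (v k))) [0..<n]) (u + u')"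
    using *(1) u'(1) by (rule session.Cons)
  moreover have "real (u + u') \<le> total_cost" using *(2) u'(2) by linarith
  ultimately show ?thesis by blast
qed

end

section \<open>The reduction\<close>

text \<open>The minimum 2 is due to class 0, which has to contain both terminals.\<close>

definition block_size :: "nat \<Rightarrow> nat" where
  "block_size n = (LEAST q. 2 \<le> q \<and> n \<le> q * q)"

lemma block_size:
  shows "2 \<le> block_size n" "n \<le> block_size n * block_size n"
    and "\<And>q'. 2 \<le> q' \<Longrightarrow> q' < block_size n \<Longrightarrow> q' * q' < n"
    and "n \<ge> 1 \<Longrightarrow> block_size n * block_size n \<le> 4 * n"
proof -
  let ?P = "\<lambda>q. 2 \<le> q \<and> n \<le> q * q"
  have "?P (n + 2)" by simp
  then have P: "?P (block_size n)" unfolding block_size_def by (rule LeastI)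
  then show "2 \<le> block_size n" "n \<le> block_size n * block_size n" by auto
  show min: "q' * q' < n" if "2 \<le> q'" "q' < block_size n" for q'
    using not_less_Least[of q' ?P] that unfolding block_size_def by auto
  show "block_size n * block_size n \<le> 4 * n" if "n \<ge> 1"
  proof (cases "block_size n = 2")
    case False
    \<comment> \<open>By minimality \<open>r * r < n\<close>, and \<open>r + 1 \<le> 2 * r\<close>
      costs the factor 4.\<close>
    define r where "r = block_size n - 1"
    have r: "block_size n = r + 1" "2 \<le> r" using P False by (auto simp: r_def)
    have "r * r < n" using min[of r] r by simp
    moreover have "(r + 1) * (r + 1) \<le> (2 * r) * (2 * r)" using r by (intro mult_le_mono) auto
    ultimately show ?thesis unfolding r(1) by simp
  qed (use that in simp)
qed

text \<open>\<open>7 * q + 2 \<le> (n + 2) ^ 3\<close> bounds the area of an instance by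
  \<open>(n + 2) ^ (3 * c)\<close>; the number of areas and all constants fit into
  \<open>(n + 2) ^ 8\<close>. The number 2187 is \<open>3 ^ 7\<close>, from
  \<open>n + 2 \<ge> 3\<close>.\<close>

lemma word_bounds:
  fixes n q c :: nat
  assumes n: "n \<ge> 1" and q: "q * q \<le> 4 * n" "q \<le> n + 1"
  defines "X \<equiv> (n + 2) ^ (3 * c + 8)"
  shows "100 \<le> X" "40 * q * q + 100 < X" "(2 * q * n + q * q + 2) * (7 * q + 2) ^ c < X"
proof -
  define a where "a = n + 2"
  have a: "3 \<le> a" using n by (simp add: a_def)
  have p: "3 ^ k \<le> a ^ k" for k using a by (rule power_mono) simp
  have "a * 3 ^ 7 \<le> a * a ^ 7" by (intro mult_le_mono2 p)
  also have "\<dots> = a ^ 8" by (simp add: eval_nat_numeral)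
  also have "\<dots> \<le> X" unfolding X_def a_def[symmetric] using a by (intro power_increasing) auto
  finally have X: "2187 * a \<le> X" by simp
  then show "100 \<le> X" using a by simp
  have "40 * q * q + 100 \<le> 160 * n + 100" using q(1) by simp
  also have "\<dots> < 2187 * a" by (simp add: a_def)
  finally show "40 * q * q + 100 < X" using X by simp
  have "7 * q + 2 \<le> 9 * a" using q(2) by (simp add: a_def)
  also have "\<dots> \<le> a ^ 2 * a" using p[of 2] by (intro mult_le_mono1) simp
  finally have "7 * q + 2 \<le> a ^ 3" by (simp add: eval_nat_numeral)
  then have "(7 * q + 2) ^ c \<le> (a ^ 3) ^ c" by (rule power_mono) simp
  then have 1: "(7 * q + 2) ^ c \<le> a ^ (3 * c)" by (simp add: power_mult)
  have "q * n \<le> (n + 1) * n" using q(2) by (rule mult_le_mono1)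
  then have "2 * q * n + q * q + 2 \<le> 2 * (n * n) + 6 * n + 2" using q(1) by simp
  also have "\<dots> < 2 * (a * a)" by (simp add: a_def algebra_simps)
  also have "\<dots> \<le> (a * a) * (a * a)" using mult_le_mono[OF a a] by (intro mult_le_mono1) simp
  also have "\<dots> \<le> a ^ 8" using a power_increasing[of 4 8 a] by (simp add: eval_nat_numeral)
  finally have 2: "2 * q * n + q * q + 2 < a ^ 8" .
  have "(2 * q * n + q * q + 2) * (7 * q + 2) ^ c \<le> (2 * q * n + q * q + 2) * a ^ (3 * c)"
    using 1 by (rule mult_le_mono2)
  also have "\<dots> < a ^ 8 * a ^ (3 * c)" using 2 a by (intro mult_strict_right_mono) auto
  also have "\<dots> = X" unfolding X_def a_def[symmetric] by (simp add: power_add)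
  finally show "(2 * q * n + q * q + 2) * (7 * q + 2) ^ c < X" .
qed

lemma block_size_le: "n \<ge> 1 \<Longrightarrow> block_size n \<le> n + 1"
proof (rule ccontr)
  assume n: "n \<ge> 1" and "\<not> block_size n \<le> n + 1"
  then have "(n + 1) * (n + 1) < n" using block_size(3)[of "n + 1" n] by simp
  then show False by simp
qed

lemma flow_algorithm_instance:
  assumes q: "q \<ge> 2" and cap: "\<And>x y. edge_cap d q x y \<le> W (7 * q)"
    and solves: "\<forall>n s t es rs. s < n \<longrightarrow> t < n \<longrightarrow> s \<noteq> t \<longrightarrow> (md = Incremental \<longrightarrow> es = []) \<longrightarrow>
     legal Incremental d n (W n) empty_graph (insertions es) \<longrightarrow>
     legal md d n (W n) (fold (update d) (insertions es) empty_graph) rs \<longrightarrow>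
     (\<exists>out0 outs \<tau>.
        session ((n + 2) ^ c) p initial_memory
          (enc_init n s t es # map enc_request rs) (out0 # outs) \<tau> \<and>
        correct_answers d n s t (fold (update d) (insertions es) empty_graph) rs outs \<and>
        real \<tau> \<le> real (n + length es + length rs) * T n)"
  shows "flow_algorithm md d q (W (7 * q)) c p (T (7 * q))"
proof
  show "2 \<le> q" "\<And>x y. edge_cap d q x y \<le> W (7 * q)" by fact+
  have empty: "empty_graph = node_graph d q {}" by (simp add: edge_graph_def)
  have "legal Incremental d (7 * q) (W (7 * q)) empty_graph (insertions (initial_edges md d q))"
  proof (cases "md = Incremental")
    case True
    then show ?thesis by (simp add: initial_edges_def insertions_def)
  next
    case False
    then show ?thesis unfolding empty
      using legal_insertions[OF q cap, of "{}" "full_script d q"] set_full_script[OF q, of d]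
        distinct_full_script[of d q]
      by (simp add: initial_edges_def)
  qed
  moreover have "md = Incremental \<longrightarrow> initial_edges md d q = []" by (simp add: initial_edges_def)
  moreover fix rs assume "legal md d (7 * q) (W (7 * q)) (fold (update d) (insertions (initial_edges md d q)) empty_graph) rs"
  ultimately show "\<exists>out0 outs \<tau>. session ((7 * q + 2) ^ c) p initial_memory
          (enc_init (7 * q) 0 1 (initial_edges md d q) # map enc_request rs) (out0 # outs) \<tau> \<and>
        correct_answers d (7 * q) 0 1 (fold (update d) (insertions (initial_edges md d q)) empty_graph) rs outs \<and>
        real \<tau> \<le> real (7 * q + length (initial_edges md d q) + length rs) * T (7 * q)"
    using q by (intro solves[rule_format]) auto
qed

section \<open>Growth of the running time\<close>

definition cost_bound :: "nat \<Rightarrow> nat \<Rightarrow> nat \<Rightarrow> real \<Rightarrow> real" where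
  "cost_bound c q n T = 40 * (real (2 * q * n + q * q) * (real (7 * q + 11 * q * q + 27 * q * q) * T)) +
     real (5000 + 300 * q + 200 * c + 1500 * n * n + (2000 * n + 2000 * (q * q) + 2000) * n +
       25000 * q * (2 * q * q * n) + 25000 * q * q * (2 * q * n + q * q))"

text \<open>All terms are dominated by \<open>P\<close>, which is \<open>n\<close> times the cube of
  \<open>q\<close>, or by \<open>P * T\<close>; \<open>q * q \<le> 4 * n\<close> then converts
  powers of \<open>q\<close> into powers of \<open>n\<close>. The constants are
  \<open>7200 = 40 * 4 * 45\<close>, \<open>50400 = 7 * 7200\<close> and
  \<open>16 = 4 powr 2\<close>.\<close>

lemma cost_bound_growth:
  assumes n: "n \<ge> 1" and q: "q \<ge> 2" "q * q \<le> 4 * n" "n \<le> q * q" and \<epsilon>: "0 < \<epsilon>" "\<epsilon> \<le> 1"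
    and T: "0 \<le> T" "T \<le> C * real (7 * q) powr (1 - \<epsilon>)"
  shows "cost_bound c q n T \<le> 16 * (50400 * C + real (200000 + 200 * c)) * real n powr (3 - \<epsilon> / 2)"
proof -
  define x where "x = real n"
  define y where "y = real q"
  have x1: "x \<ge> 1" and y2: "y \<ge> 2" using n q by (simp_all add: x_def y_def)
  have yx: "y * y \<le> 4 * x" "x \<le> y * y"
    using q(2,3) unfolding x_def y_def by (metis of_nat_le_iff of_nat_mult of_nat_numeral)+
  define P where "P = x * (y * y * y)"
  have yy: "2 * y \<le> y * y" using y2 by simp
  have A: "2 * y * x + y * y \<le> 4 * y * x" 
  proof -
    have "4 * x \<le> (2 * y) * x" using x1 y2 by (intro mult_right_mono) auto
    then show ?thesis using yx(1) by linarith
  qed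
  have B: "7 * y + 11 * y * y + 27 * y * y \<le> 45 * (y * y)" using yy y2 by simp
  have first: "40 * ((2 * y * x + y * y) * ((7 * y + 11 * y * y + 27 * y * y) * T)) \<le> 7200 * P * T"
  proof -
    have "(2 * y * x + y * y) * ((7 * y + 11 * y * y + 27 * y * y) * T) \<le> (4 * y * x) * ((45 * (y * y)) * T)"
      using A B T(1) x1 y2 by (intro mult_mono mult_right_mono) auto
    then show ?thesis unfolding P_def by (simp add: algebra_simps)
  qed
  have P1: "1 \<le> P" "y \<le> P" "x \<le> P" "x * x \<le> P" "y * y * x \<le> P"
  proof -
    have y3: "y * y \<le> y * y * y" using y2 by simp
    have "x * (y * y) \<le> x * (y * y * y)" using y3 x1 by (intro mult_left_mono) auto
    then show 5: "y * y * x \<le> P" by (simp add: P_def mult.commute)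
    have "x * x \<le> x * (y * y)" using yx x1 by (intro mult_left_mono) auto
    then show 4: "x * x \<le> P" using 5 by (simp add: mult.commute)
    show "x \<le> P" using 4 x1 by (smt (verit) mult_le_cancel_left1)
    then show "1 \<le> P" using x1 by simp
    have "y \<le> y * y" using y2 by simp
    also have "\<dots> \<le> y * y * x" using mult_left_mono[OF x1, of "y * y"] by simp
    finally show "y \<le> P" using 5 by simp
  qed
  have D: "y * y * (2 * y * x + y * y) \<le> 4 * P"
  proof -
    have "y * y * (2 * y * x + y * y) \<le> y * y * (4 * y * x)" using A y2 by (intro mult_left_mono) auto
    then show ?thesis by (simp add: P_def algebra_simps)
  qed
  have second: "5000 + 300 * y + 200 * real c + 1500 * x * x + (2000 * x + 2000 * (y * y) + 2000) * x +
       25000 * y * (2 * y * y * x) + 25000 * y * y * (2 * y * x + y * y) \<le> real (200000 + 200 * c) * P"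
  proof -
    have "5000 \<le> 5000 * P" "200 * real c \<le> 200 * real c * P" using P1(1) by (simp_all add: mult_le_cancel_left1)
    moreover have "(2000 * x + 2000 * (y * y) + 2000) * x = 2000 * (x * x) + 2000 * (y * y * x) + 2000 * x"
      "25000 * y * (2 * y * y * x) = 50000 * P" "25000 * y * y * (2 * y * x + y * y) = 25000 * (y * y * (2 * y * x + y * y))"
      "1500 * x * x = 1500 * (x * x)" "real (200000 + 200 * c) * P = 200000 * P + 200 * real c * P"
      by (simp_all add: algebra_simps P_def)
    ultimately show ?thesis using P1 D by linarith
  qed
  have cb: "cost_bound c q n T = 40 * ((2 * y * x + y * y) * ((7 * y + 11 * y * y + 27 * y * y) * T)) +
     (5000 + 300 * y + 200 * real c + 1500 * x * x + (2000 * x + 2000 * (y * y) + 2000) * x +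
       25000 * y * (2 * y * y * x) + 25000 * y * y * (2 * y * x + y * y))"
    unfolding cost_bound_def x_def y_def by simp
  define R where "R = x * y powr (4 - \<epsilon>)"
  have C0: "0 \<le> C"
  proof -
    have "0 < real (7 * q) powr (1 - \<epsilon>)" using q by simp
    then show ?thesis using T by (smt (verit) mult_neg_pos)
  qed
  \<comment> \<open>Here \<open>\<epsilon> \<le> 1\<close> enters: the overhead is linear in
    \<open>P\<close>, which has to stay within the bound for the flow time.\<close>
  have PR: "P \<le> R"
  proof -
    have "y * y * y = y powr 3" using y2 by (simp add: powr_numeral eval_nat_numeral)
    also have "\<dots> \<le> y powr (4 - \<epsilon>)" using y2 \<epsilon> by (intro powr_mono) auto
    finally show ?thesis unfolding P_def R_def using x1 by (intro mult_left_mono) auto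
  qed
  have PT: "P * T \<le> 7 * C * R"
  proof -
    have "7 powr (1 - \<epsilon>) \<le> 7 powr (1::real)" using \<epsilon> by (intro powr_mono) auto
    then have "real (7 * q) powr (1 - \<epsilon>) \<le> 7 * y powr (1 - \<epsilon>)"
      using y2 by (simp add: powr_mult y_def mult_right_mono)
    then have "T \<le> C * (7 * y powr (1 - \<epsilon>))" using T(2) C0 by (meson mult_left_mono order_trans)
    then have "P * T \<le> P * (C * (7 * y powr (1 - \<epsilon>)))" using P1(1) by (intro mult_left_mono) auto
    also have "\<dots> = 7 * C * (x * (y powr 3 * y powr (1 - \<epsilon>)))"
      using y2 by (simp add: P_def powr_numeral eval_nat_numeral)
    also have "y powr 3 * y powr (1 - \<epsilon>) = y powr (4 - \<epsilon>)" by (simp flip: powr_add)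
    finally show ?thesis by (simp add: R_def)
  qed
  have "cost_bound c q n T \<le> 7200 * (P * T) + real (200000 + 200 * c) * P"
    unfolding cb using first second mult.assoc[of 7200 P T] by linarith
  also have "\<dots> \<le> 7200 * (7 * C * R) + real (200000 + 200 * c) * R"
    using PT PR by (intro add_mono mult_left_mono) auto
  also have "\<dots> = (50400 * C + real (200000 + 200 * c)) * R" by (simp add: algebra_simps)
  also have "\<dots> \<le> (50400 * C + real (200000 + 200 * c)) * (16 * x powr (3 - \<epsilon> / 2))"
  proof (intro mult_left_mono)
    have "y powr (4 - \<epsilon>) = (y * y) powr (2 - \<epsilon> / 2)"
      using y2 by (simp add: powr_mult flip: powr_add)
    also have "\<dots> \<le> (4 * x) powr (2 - \<epsilon> / 2)" using yx y2 \<epsilon> by (intro powr_mono2) auto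
    also have "\<dots> = 4 powr (2 - \<epsilon> / 2) * x powr (2 - \<epsilon> / 2)" using x1 by (simp add: powr_mult)
    also have "\<dots> \<le> 4 powr 2 * x powr (2 - \<epsilon> / 2)" using \<epsilon> by (intro mult_right_mono powr_mono) auto
    finally have "y powr (4 - \<epsilon>) \<le> 16 * x powr (2 - \<epsilon> / 2)" by (simp add: powr_numeral)
    then have "R \<le> x * (16 * x powr (2 - \<epsilon> / 2))" unfolding R_def using x1 by (intro mult_left_mono) auto
    also have "\<dots> = 16 * (x powr 1 * x powr (2 - \<epsilon> / 2))" using x1 by simp
    also have "x powr 1 * x powr (2 - \<epsilon> / 2) = x powr (3 - \<epsilon> / 2)" unfolding powr_add[symmetric] by simp
    finally show "R \<le> 16 * x powr (3 - \<epsilon> / 2)" .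
  qed (use C0 in auto)
  finally show ?thesis unfolding x_def by (simp only: mult_ac)
qed

lemma (in omv_main) total_cost_le: "total_cost \<le> cost_bound c q n T"
proof -
  have "real (7 * q + length (initial_edges md d q) + 27 * q * q) * T \<le> real (7 * q + 11 * q * q + 27 * q * q) * T"
    using length_initial_edges[of md d q] by (intro mult_right_mono of_nat_mono T_nonneg) simp
  then have "budget \<le> real (7 * q + 11 * q * q + 27 * q * q) * T" unfolding budget_def .
  then have "40 * (real (2 * q * n + q * q) * budget) \<le>
      40 * (real (2 * q * n + q * q) * (real (7 * q + 11 * q * q + 27 * q * q) * T))"
    by (intro mult_left_mono) auto
  then show ?thesis unfolding total_cost_def cost_bound_def init_cost_def step_cost_def by linarith
qed

theorem flow_to_OMv:
  assumes cap: "\<And>q x y. q \<ge> 2 \<Longrightarrow> edge_cap d q x y \<le> W (7 * q)"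
    and solves: "solves_dynamic_flow md d W p T"
    and T: "T \<in> O(\<lambda>n. real n powr (1 - \<epsilon>))" and \<epsilon>: "0 < \<epsilon>" "\<epsilon> \<le> 1"
  shows "\<exists>p' T'. solves_OMv p' T' \<and> T' \<in> O(\<lambda>n. real n powr (3 - \<epsilon> / 2))"
proof -
  obtain c where c: "\<forall>n s t es rs. s < n \<longrightarrow> t < n \<longrightarrow> s \<noteq> t \<longrightarrow> (md = Incremental \<longrightarrow> es = []) \<longrightarrow>
     legal Incremental d n (W n) empty_graph (insertions es) \<longrightarrow>
     legal md d n (W n) (fold (update d) (insertions es) empty_graph) rs \<longrightarrow>
     (\<exists>out0 outs \<tau>.
        session ((n + 2) ^ c) p initial_memory
          (enc_init n s t es # map enc_request rs) (out0 # outs) \<tau> \<and>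
        correct_answers d n s t (fold (update d) (insertions es) empty_graph) rs outs \<and>
        real \<tau> \<le> real (n + length es + length rs) * T n)"
    using solves unfolding solves_dynamic_flow_def by blast
  define T' where "T' = (\<lambda>n. cost_bound c (block_size n) n (T (7 * block_size n)))"
  have alg: "flow_algorithm md d q (W (7 * q)) c p (T (7 * q))" if "q \<ge> 2" for q
    using flow_algorithm_instance[OF that cap[OF that] c] .
  \<comment> \<open>\<open>MAIN\<close> depends on the mode, the orientation, \<open>c\<close> and
    \<open>p\<close> only; it reads \<open>n\<close> and computes \<open>q\<close>, so one program
    serves all sizes. The exponent is that of \<open>X ^ 64\<close> for
    \<open>X = (n + 2) ^ (3 * c + 8)\<close>.\<close>
  have "solves_OMv (omv_main.MAIN md d c p) T'"
    unfolding solves_OMv_def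
  proof (intro exI[of _ "64 * (3 * c + 8)"] allI impI)
    fix n :: nat and M v assume n: "1 \<le> n"
    define q where "q = block_size n"
    define X where "X = (n + 2) ^ (3 * c + 8)"
    have q: "q \<ge> 2" "n \<le> q * q" "q * q \<le> 4 * n" "q \<le> n + 1"
      using block_size(1,2,4)[of n] block_size_le[OF n] n unfolding q_def by auto
    have B: "X ^ 64 = (n + 2) ^ (64 * (3 * c + 8))" by (simp add: X_def power_mult[symmetric] mult.commute)
    interpret flow_algorithm md d q "W (7 * q)" c p "T (7 * q)" by (rule alg[OF q(1)])
    interpret omv_main md d q "W (7 * q)" c p "T (7 * q)" "(n + 2) ^ (64 * (3 * c + 8))" X n
    proof
      show "100 \<le> X" "40 * q * q + 100 < X" "(2 * q * n + q * q + 2) * (7 * q + 2) ^ c < X"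
        unfolding X_def by (rule word_bounds[OF n q(3,4)])+
      show "X ^ 64 \<le> (n + 2) ^ (64 * (3 * c + 8))" using B by simp
      show "q' * q' < n" if "2 \<le> q'" "q' < q" for q' using block_size(3)[of q' n] that by (simp add: q_def)
    qed (use n q in auto)
    obtain out0 u where "session ((n + 2) ^ (64 * (3 * c + 8))) (omv_main.MAIN md d c p) initial_memory
       (enc_matrix n M # map (\<lambda>k. enc_vector n (v k)) [0..<n])
       (out0 # map (\<lambda>k. enc_vector n (bool_mult n M (v k))) [0..<n]) u" "real u \<le> total_cost"
      using omv_session[of M v] by blast
    moreover have "total_cost \<le> T' n" using total_cost_le by (simp add: T'_def q_def)
    ultimately show "\<exists>out0 t. session ((n + 2) ^ (64 * (3 * c + 8))) (omv_main.MAIN md d c p) initial_memory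
       (enc_matrix n M # map (\<lambda>k. enc_vector n (v k)) [0..<n])
       (out0 # map (\<lambda>k. enc_vector n (bool_mult n M (v k))) [0..<n]) t \<and> real t \<le> T' n"
      by (meson order_trans)
  qed
  moreover have "T' \<in> O(\<lambda>n. real n powr (3 - \<epsilon> / 2))"
  proof -
    obtain C where C: "C > 0" "eventually (\<lambda>n. norm (T n) \<le> C * norm (real n powr (1 - \<epsilon>))) at_top"
      using T by (elim landau_o.bigE)
    then obtain N where N: "\<And>m. m \<ge> N \<Longrightarrow> \<bar>T m\<bar> \<le> C * real m powr (1 - \<epsilon>)"
      by (auto simp: eventually_at_top_linorder)
    have "norm (T' n) \<le> 16 * (50400 * C + real (200000 + 200 * c)) * norm (real n powr (3 - \<epsilon> / 2))"
      if n: "n \<ge> N * N + 1" for n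
    proof -
      define q where "q = block_size n"
      have q: "q \<ge> 2" "n \<le> q * q" "q * q \<le> 4 * n" using block_size(1,2,4)[of n] n unfolding q_def by auto
      \<comment> \<open>The bound on \<open>T\<close> holds for large arguments only;
        \<open>n > N * N\<close> and \<open>n \<le> q * q\<close> make \<open>7 * q\<close> large
        enough.\<close>
      have "N \<le> q"
      proof (rule ccontr)
        assume "\<not> N \<le> q"
        then have "q * q \<le> N * N" by (intro mult_le_mono) auto
        then show False using q(2) n by simp
      qed
      then have "T (7 * q) \<le> C * real (7 * q) powr (1 - \<epsilon>)" using N[of "7 * q"] by simp
      moreover have T0: "0 \<le> T (7 * q)" using alg[OF q(1)] by (rule flow_algorithm.T_nonneg)
      ultimately have "T' n \<le> 16 * (50400 * C + real (200000 + 200 * c)) * real n powr (3 - \<epsilon> / 2)"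
        unfolding T'_def q_def[symmetric] using n q \<epsilon> by (intro cost_bound_growth) auto
      moreover have "0 \<le> T' n"
        unfolding T'_def q_def[symmetric] cost_bound_def using T0
        by (intro add_nonneg_nonneg mult_nonneg_nonneg of_nat_0_le_iff) auto
      ultimately show ?thesis by simp
    qed
    then show ?thesis
      by (intro bigoI[of _ "16 * (50400 * C + real (200000 + 200 * c))"])
        (auto simp: eventually_at_top_linorder)
  qed
  ultimately show ?thesis by blast
qed

theorem theorem3:
  fixes \<epsilon> :: real and k :: nat
  assumes "OMv_conjecture"
    and "\<epsilon> > 0"
    and "k \<ge> 1"
  shows "\<forall>md \<in> {Incremental, Decremental}.
      \<not> (\<exists>p T. solves_dynamic_flow md Directed (\<lambda>n. 1) p T \<and>
            T \<in> O(\<lambda>n. real n powr (1 - \<epsilon>))) \<and>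
      \<not> (\<exists>p T. solves_dynamic_flow md Undirected (\<lambda>n. n ^ k) p T \<and>
            T \<in> O(\<lambda>n. real n powr (1 - \<epsilon>)))"
proof -
  have no: "\<not> (\<exists>p T. solves_dynamic_flow md d W p T \<and> T \<in> O(\<lambda>n. real n powr (1 - \<epsilon>)))"
    if cap: "\<And>q x y. q \<ge> 2 \<Longrightarrow> edge_cap d q x y \<le> W (7 * q)" for md d W
  proof
    assume "\<exists>p T. solves_dynamic_flow md d W p T \<and> T \<in> O(\<lambda>n. real n powr (1 - \<epsilon>))"
    then obtain p T where s: "solves_dynamic_flow md d W p T" and T: "T \<in> O(\<lambda>n. real n powr (1 - \<epsilon>))" by blast
    \<comment> \<open>A bound with a larger exponent saving implies the bound with saving 1, and the
      reduction is stated for savings of at most 1.\<close>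
    define \<delta> where "\<delta> = min \<epsilon> 1"
    have \<delta>: "0 < \<delta>" "\<delta> \<le> 1" using assms(2) by (auto simp: \<delta>_def)
    have "(\<lambda>n. real n powr (1 - \<epsilon>)) \<in> O(\<lambda>n. real n powr (1 - \<delta>))"
    proof (rule bigoI[of _ 1])
      have "norm (real n powr (1 - \<epsilon>)) \<le> 1 * norm (real n powr (1 - \<delta>))" if "n \<ge> 1" for n :: nat
        using that by (simp add: \<delta>_def powr_mono)
      then show "\<forall>\<^sub>F n in at_top. norm (real n powr (1 - \<epsilon>)) \<le> 1 * norm (real n powr (1 - \<delta>))"
        by (auto simp: eventually_at_top_linorder)
    qed
    with T have "T \<in> O(\<lambda>n. real n powr (1 - \<delta>))" by (rule landau_o.big_trans)
    from flow_to_OMv[OF cap s this \<delta>] have "\<exists>p' T'. solves_OMv p' T' \<and> T' \<in> O(\<lambda>n. real n powr (3 - \<delta> / 2))" .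
    moreover have "\<delta> / 2 > 0" using \<delta> by simp
    ultimately show False using assms(1) unfolding OMv_conjecture_def by blast
  qed
  \<comment> \<open>The largest capacity, \<open>2 * q\<close>, is below the number of nodes and
    hence below each of its positive powers.\<close>
  have "edge_cap Undirected q x y \<le> (7 * q) ^ k" if "q \<ge> 2" for q x y
  proof -
    have "edge_cap Undirected q x y \<le> 7 * q" using that by (simp add: edge_cap_def)
    also have "\<dots> \<le> (7 * q) ^ k" using assms(3) that by (intro self_le_power) auto
    finally show ?thesis .
  qed
  then show ?thesis
    using no[of Directed "\<lambda>n. 1"] no[of Undirected "\<lambda>n. n ^ k"] by (auto simp: edge_cap_def[of Directed])
qed

end
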